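(* Let $u$ be a weak subsolution of $-\operatorname{div}\mathcal{B}(x,u,\nabla u)+\mathcal{L}(u)=0$ in $\Omega$. Then there exists $c=c(N,p,s,\Lambda,C_1,C_2)>0$ such that $$\operatorname*{ess\,sup}_{B_{r/2}(x_0)}u\le\delta\,\mathrm{Tail}(u^+;x_0,\tfrac r2)+c\,\delta^{-\frac{(p-1)\kappa}{p(\kappa-1)}}\Big(\frac1{|B_r(x_0)|}\int_{B_r(x_0)}(u^+)^p\,dx\Big)^{1/p}$$ whenever $B_r(x_0)\subset\Omega$ with $r\in(0,1]$ and $\delta\in(0,1]$, where $\kappa=\frac N{N-p}$ if $1<p<N$ and $\kappa=2$ if $p\ge N$.
   Context: $\Omega\subset\mathbb{R}^N$ ($N\ge2$) is a bounded smooth domain, $1<p<\infty$, $0<s<1$. $\mathcal{B}:\Omega\times\mathbb{R}\times\mathbb{R}^N\to\mathbb{R}^N$ is measurable in $x$ and continuous in $(u,\zeta)$, and satisfies (H1): $\mathcal{B}(x,u,\zeta)\cdot\zeta\ge C_1|\zeta|^p$ and $|\mathcal{B}(x,u,\zeta)|\le C_2|\zeta|^{p-1}$ for a.e. $x\in\Omega$ and all $(u,\zeta)\in\mathbb{R}^{N+1}$, with constants $C_1,C_2>0$. $K$ is a measurable kernel, symmetric in $x,y$, with $\Lambda^{-1}|x-y|^{-N-ps}\le K(x,y)\le\Lambda|x-y|^{-N-ps}$ for some $\Lambda\ge1$; $d\mu=K(x,y)\,dx\,dy$. $\mathcal{L}(u)(x)=\mathrm{P.V.}\int_{\mathbb{R}^N}|u(x)-u(y)|^{p-2}(u(x)-u(y))K(x,y)\,dy$.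 A function $u\in L^\infty(\mathbb{R}^N)\cap W^{1,p}_{\rm loc}(\Omega)$ is a weak subsolution if for every $\Omega'\Subset\Omega$ and every nonnegative $\phi\in W^{1,p}_0(\Omega')$ (extended by zero), $\int_{\Omega'}\mathcal{B}(x,u,\nabla u)\cdot\nabla\phi\,dx+\int_{\mathbb{R}^N}\int_{\mathbb{R}^N}|u(x)-u(y)|^{p-2}(u(x)-u(y))(\phi(x)-\phi(y))\,d\mu\le0$. The tail is $\mathrm{Tail}(v;x_0,r)=\big(r^p\int_{\mathbb{R}^N\setminus B_r(x_0)}\frac{|v(y)|^{p-1}}{|y-x_0|^{N+ps}}dy\big)^{1/(p-1)}$. $k^+=\max\{k,0\}$. *)

theory Defs
  imports "HOL-Analysis.Analysis" "HOL-Probability.Essential_Supremum"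
begin

definition partial :: "('a::euclidean_space \<Rightarrow> real) \<Rightarrow> 'a \<Rightarrow> 'a \<Rightarrow> real" where
  "partial f i x = deriv (\<lambda>t. f (x + t *\<^sub>R i)) 0"

(* C^\<infinity>(R^N): all partial derivatives of all orders exist and are continuous *)
definition smooth_fun :: "('a::euclidean_space \<Rightarrow> real) \<Rightarrow> bool" where
  "smooth_fun f \<longleftrightarrow> (\<exists>F. f \<in> F \<and> (\<forall>g\<in>F. continuous_on UNIV g \<and>
      (\<forall>i\<in>Basis. (\<forall>x. (\<lambda>t. g (x + t *\<^sub>R i)) differentiable (at 0)) \<and> partial g i \<in> F)))"

definition sgrad :: "('a::euclidean_space \<Rightarrow> real) \<Rightarrow> 'a \<Rightarrow> 'a" where
  "sgrad f x = (\<Sum>i\<in>Basis. partial f i x *\<^sub>R i)"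

definition test_fun :: "'a::euclidean_space set \<Rightarrow> ('a \<Rightarrow> real) \<Rightarrow> bool" where
  "test_fun U \<phi> \<longleftrightarrow> smooth_fun \<phi> \<and> compact (closure {x. \<phi> x \<noteq> 0}) \<and> closure {x. \<phi> x \<noteq> 0} \<subseteq> U"

definition weak_grad :: "'a::euclidean_space set \<Rightarrow> ('a \<Rightarrow> real) \<Rightarrow> ('a \<Rightarrow> 'a) \<Rightarrow> bool" where
  "weak_grad U u G \<longleftrightarrow> (\<forall>\<phi>. test_fun U \<phi> \<longrightarrow> (\<forall>i\<in>Basis.
      set_integrable lebesgue U (\<lambda>x. u x * partial \<phi> i x) \<and>
      set_integrable lebesgue U (\<lambda>x. (G x \<bullet> i) * \<phi> x) \<and>
      (LINT x:U|lebesgue. u x * partial \<phi> i x) = - (LINT x:U|lebesgue. (G x \<bullet> i) * \<phi> x)))"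

definition W1p_loc :: "'a::euclidean_space set \<Rightarrow> real \<Rightarrow> ('a \<Rightarrow> real) \<Rightarrow> ('a \<Rightarrow> 'a) \<Rightarrow> bool" where
  "W1p_loc U p u G \<longleftrightarrow> set_borel_measurable lebesgue U u \<and> set_borel_measurable lebesgue U G \<and>
     (\<forall>C. compact C \<and> C \<subseteq> U \<longrightarrow> set_integrable lebesgue C (\<lambda>x. \<bar>u x\<bar> powr p) \<and>
                                     set_integrable lebesgue C (\<lambda>x. norm (G x) powr p)) \<and>
     weak_grad U u G"

definition W1p :: "'a::euclidean_space set \<Rightarrow> real \<Rightarrow> ('a \<Rightarrow> real) \<Rightarrow> ('a \<Rightarrow> 'a) \<Rightarrow> bool" where
  "W1p U p u G \<longleftrightarrow> set_borel_measurable lebesgue U u \<and> set_borel_measurable lebesgue U G \<and>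
     set_integrable lebesgue U (\<lambda>x. \<bar>u x\<bar> powr p) \<and>
     set_integrable lebesgue U (\<lambda>x. norm (G x) powr p) \<and> weak_grad U u G"

definition W01p :: "'a::euclidean_space set \<Rightarrow> real \<Rightarrow> ('a \<Rightarrow> real) \<Rightarrow> ('a \<Rightarrow> 'a) \<Rightarrow> bool" where
  "W01p U p \<phi> G \<longleftrightarrow> W1p U p \<phi> G \<and> (\<forall>x. x \<notin> U \<longrightarrow> \<phi> x = 0) \<and>
     (\<exists>\<psi>::nat \<Rightarrow> 'a \<Rightarrow> real. (\<forall>k. test_fun U (\<psi> k)) \<and>
        (\<lambda>k. (LINT x:U|lebesgue. \<bar>\<psi> k x - \<phi> x\<bar> powr p + norm (sgrad (\<psi> k) x - G x) powr p))
          \<longlonglongrightarrow> 0)"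

definition ppow :: "real \<Rightarrow> real \<Rightarrow> real" where
  "ppow p t = \<bar>t\<bar> powr (p - 2) * t"

definition weak_subsolution ::
  "'a::euclidean_space set \<Rightarrow> real \<Rightarrow> ('a \<Rightarrow> real \<Rightarrow> 'a \<Rightarrow> 'a) \<Rightarrow> ('a \<Rightarrow> 'a \<Rightarrow> real) \<Rightarrow> ('a \<Rightarrow> real) \<Rightarrow> bool" where
  "weak_subsolution \<Omega> p \<B> K u \<longleftrightarrow>
     u \<in> borel_measurable lebesgue \<and> (\<exists>M. AE x in lebesgue. \<bar>u x\<bar> \<le> M) \<and>
     (\<exists>G. W1p_loc \<Omega> p u G \<and>
       (\<forall>\<Omega>' \<phi> G\<phi>. open \<Omega>' \<and> compact (closure \<Omega>') \<and> closure \<Omega>' \<subseteq> \<Omega> \<and>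
           W01p \<Omega>' p \<phi> G\<phi> \<and> (AE x in lebesgue. 0 \<le> \<phi> x) \<longrightarrow>
          set_integrable lebesgue \<Omega>' (\<lambda>x. \<B> x (u x) (G x) \<bullet> G\<phi> x) \<and>
          integrable lebesgue (\<lambda>(x,y). ppow p (u x - u y) * (\<phi> x - \<phi> y) * K x y) \<and>
          (LINT x:\<Omega>'|lebesgue. \<B> x (u x) (G x) \<bullet> G\<phi> x)
            + (LINT z|lebesgue. (\<lambda>(x,y). ppow p (u x - u y) * (\<phi> x - \<phi> y) * K x y) z) \<le> 0))"

definition Tail :: "real \<Rightarrow> real \<Rightarrow> ('a::euclidean_space \<Rightarrow> real) \<Rightarrow> 'a \<Rightarrow> real \<Rightarrow> real" where
  "Tail p s v x0 r = (r powr p * (LINT y:(UNIV - ball x0 r)|lebesgue.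
       \<bar>v y\<bar> powr (p - 1) / dist y x0 powr (real DIM('a) + p * s))) powr (1 / (p - 1))"

definition smooth_bounded_domain :: "'a::euclidean_space set \<Rightarrow> bool" where
  "smooth_bounded_domain \<Omega> \<longleftrightarrow> open \<Omega> \<and> connected \<Omega> \<and> bounded \<Omega> \<and> \<Omega> \<noteq> {} \<and>
     (\<forall>z\<in>frontier \<Omega>. \<exists>U \<psi>. open U \<and> z \<in> U \<and> smooth_fun \<psi> \<and>
        (\<forall>x\<in>U \<inter> frontier \<Omega>. sgrad \<psi> x \<noteq> 0) \<and> \<Omega> \<inter> U = {x\<in>U. \<psi> x < 0})"

definition kappa :: "nat \<Rightarrow> real \<Rightarrow> real" where
  "kappa N p = (if p < real N then real N / (real N - p) else 2)"

end

theory Submission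
  imports Defs
begin

text \<open>
  De Giorgi iteration on the truncations \<open>(u - k_j)_+\<close> over shrinking balls \<open>B_j\<close>. Testing with
  \<open>(u - k)_+ \<eta>^p\<close> gives a Caccioppoli inequality in which the nonlocal term contributes a
  local energy term (pairs inside the ball) and a tail term (one point outside). The Sobolev
  inequality is replaced by an elementary Faber--Krahn inequality: if \<open>f\<close> vanishes outside \<open>E\<close>
  and \<open>|B_r| \<ge> 2 |E|\<close>, then from every point of \<open>E\<close> at least half of the translates by vectors of
  \<open>B_r\<close> leave \<open>E\<close>, so averaging \<open>\<parallel>f(\<cdot> + v) - f\<parallel>_p \<le> C |v| \<parallel>\<nabla>f\<parallel>_p\<close> over \<open>v \<in> B_r\<close> bounds
  \<open>\<parallel>f\<parallel>_p\<close> by \<open>C r \<parallel>\<nabla>f\<parallel>_p\<close>, i.e. by \<open>C |E|^(1/N) \<parallel>\<nabla>f\<parallel>_p\<close>. Since \<open>1 - 1/\<kappa> \<le> p/N\<close>, this yields the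
  recursion \<open>y_(j+1) \<le> C \<delta>^(1-p) b^j y_j^(2 - 1/\<kappa>)\<close> for the normalised energies.
\<close>

section \<open>Smooth bump functions\<close>

definition vanishes_outside :: "'a set \<Rightarrow> ('a \<Rightarrow> 'b::zero) \<Rightarrow> bool" where
  "vanishes_outside S f \<longleftrightarrow> (\<forall>x. x \<notin> S \<longrightarrow> f x = 0)"

lemma vanishes_outsideD: "vanishes_outside S f \<Longrightarrow> x \<notin> S \<Longrightarrow> f x = 0"
  by (simp add: vanishes_outside_def)

lemma vanishes_outside_mono: "vanishes_outside S f \<Longrightarrow> S \<subseteq> T \<Longrightarrow> vanishes_outside T f"
  by (auto simp: vanishes_outside_def)

definition flat_exp :: "nat \<Rightarrow> real \<Rightarrow> real" where
  "flat_exp n t = (if t > 0 then exp (- (1 / t)) / t ^ n else 0)"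

lemma flat_exp_tendsto_0: "(flat_exp n \<longlongrightarrow> 0) (at 0)"
proof -
  have "((\<lambda>x. inverse x ^ n / exp (inverse x)) \<longlongrightarrow> (0::real)) (at_right 0)"
    by (rule filterlim_compose[OF tendsto_power_div_exp_0 filterlim_inverse_at_top_right])
  then have "(flat_exp n \<longlongrightarrow> 0) (at_right 0)"
    by (rule Lim_transform_eventually)
       (auto simp: eventually_at_right_field flat_exp_def exp_minus field_simps intro!: exI[of _ 1])
  moreover have "(flat_exp n \<longlongrightarrow> 0) (at_left 0)"
    by (rule Lim_transform_eventually[OF tendsto_const])
       (auto simp: eventually_at_left_field flat_exp_def intro!: exI[of _ "-1"])
  ultimately show ?thesis by (simp add: filterlim_split_at)
qed

lemma flat_exp_has_derivative:
  "(flat_exp n has_real_derivative (flat_exp (n + 2) t - real n * flat_exp (n + 1) t)) (at t)"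
proof -
  consider (pos) "t > 0" | (neg) "t < 0" | (zero) "t = 0" by linarith
  then show ?thesis
  proof cases
    case pos
    have "((\<lambda>t. exp (- (1 / t)) / t ^ n) has_real_derivative
        (flat_exp (n + 2) t - real n * flat_exp (n + 1) t)) (at t)"
    proof (cases n)
      case (Suc m)
      have "t ^ m = t * t ^ (m - Suc 0) \<or> m = 0" by (cases m) auto
      then show ?thesis using pos Suc
        by (auto intro!: derivative_eq_intros simp: flat_exp_def field_simps power2_eq_square)
    qed (use pos in \<open>auto intro!: derivative_eq_intros
          simp: flat_exp_def field_simps power2_eq_square\<close>)
    then show ?thesis
      by (rule has_field_derivative_transform_within_open[of _ _ _ "{0<..}"])
         (use pos in \<open>auto simp: flat_exp_def\<close>)
  next
    case neg
    have "((\<lambda>t. 0) has_real_derivative (flat_exp (n + 2) t - real n * flat_exp (n + 1) t)) (at t)"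
      using neg by (auto simp: flat_exp_def)
    then show ?thesis
      by (rule has_field_derivative_transform_within_open[of _ _ _ "{..<0}"])
         (use neg in \<open>auto simp: flat_exp_def\<close>)
  next
    case zero
    have "((\<lambda>h. (flat_exp n (0 + h) - flat_exp n 0) / h) \<longlongrightarrow> 0) (at 0)"
      by (rule Lim_transform_eventually[OF flat_exp_tendsto_0[of "Suc n"]])
         (auto simp: flat_exp_def eventually_at intro!: exI[of _ 1])
    then have "(flat_exp n has_real_derivative 0) (at 0)" by (simp add: DERIV_def)
    then show ?thesis using zero by (simp add: flat_exp_def)
  qed
qed

inductive_set bumps :: "real \<Rightarrow> (real \<Rightarrow> real) set" for a where
  base: "(\<lambda>t. flat_exp m (a - t) * flat_exp n (a + t)) \<in> bumps a"
| add: "f \<in> bumps a \<Longrightarrow> g \<in> bumps a \<Longrightarrow> (\<lambda>t. f t + g t) \<in> bumps a"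
| scale: "f \<in> bumps a \<Longrightarrow> (\<lambda>t. c * f t) \<in> bumps a"

lemma bumps_closed_derivative:
  "f \<in> bumps a \<Longrightarrow> \<exists>f'\<in>bumps a. \<forall>t. (f has_real_derivative f' t) (at t)"
proof (induction rule: bumps.induct)
  case (base m n)
  let ?b = "\<lambda>m n t. flat_exp m (a - t) * flat_exp n (a + t)"
  have "(\<lambda>t. ((-1) * ?b (m+2) n t + real m * ?b (m+1) n t)
      + (?b m (n+2) t + (- real n) * ?b m (n+1) t)) \<in> bumps a" (is "?f' \<in> _")
    by (intro bumps.intros)
  moreover have "(?b m n has_real_derivative ?f' t) (at t)" for t
  proof -
    have left: "((\<lambda>t. flat_exp m (a - t)) has_real_derivative
        (flat_exp (m + 2) (a - t) - real m * flat_exp (m + 1) (a - t)) * (0 - 1)) (at t)"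
      by (rule DERIV_chain2[OF flat_exp_has_derivative]) (auto intro!: derivative_eq_intros)
    have right: "((\<lambda>t. flat_exp n (a + t)) has_real_derivative
        (flat_exp (n + 2) (a + t) - real n * flat_exp (n + 1) (a + t)) * (0 + 1)) (at t)"
      by (rule DERIV_chain2[OF flat_exp_has_derivative]) (auto intro!: derivative_eq_intros)
    show ?thesis
      by (rule DERIV_cong[OF DERIV_mult[OF left right]]) (simp add: algebra_simps)
  qed
  ultimately show ?case by (intro bexI[of _ ?f']) auto
next
  case (add f g)
  then obtain f' g' where "f' \<in> bumps a" "g' \<in> bumps a"
    "\<And>t. (f has_real_derivative f' t) (at t)" "\<And>t. (g has_real_derivative g' t) (at t)" by blast
  then show ?case by (intro bexI[of _ "\<lambda>t. f' t + g' t"]) (auto intro!: bumps.add DERIV_add)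
next
  case (scale f c)
  then obtain f' where "f' \<in> bumps a" "\<And>t. (f has_real_derivative f' t) (at t)" by blast
  then show ?case by (intro bexI[of _ "\<lambda>t. c * f' t"]) (auto intro!: bumps.scale DERIV_cmult)
qed

lemma bumps_outside: "f \<in> bumps a \<Longrightarrow> \<bar>t\<bar> \<ge> a \<Longrightarrow> f t = 0"
  by (induction rule: bumps.induct) (auto simp: flat_exp_def)

text \<open>Half-width \<open>a / DIM('a)\<close> puts the supporting cube into the ball of radius \<open>a\<close>.\<close>
definition tensor_bumps :: "real \<Rightarrow> ('a::euclidean_space \<Rightarrow> real) set" where
  "tensor_bumps a =
     {\<lambda>x. c * (\<Prod>i\<in>Basis. g i (x \<bullet> i)) | c g. \<forall>i. g i \<in> bumps (a / real DIM('a))}"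

lemma tensor_bumps_cmult: "f \<in> tensor_bumps a \<Longrightarrow> (\<lambda>x. c * f x) \<in> tensor_bumps a"
  unfolding tensor_bumps_def by (force simp flip: mult.assoc)

lemma tensor_bumps_vanishes_outside:
  fixes f :: "'a::euclidean_space \<Rightarrow> real"
  assumes "f \<in> tensor_bumps a"
  shows "vanishes_outside (ball 0 a) f"
  unfolding vanishes_outside_def
proof (intro allI impI)
  fix x :: 'a assume "x \<notin> ball 0 a"
  then have norm_x: "norm x \<ge> a" by simp
  obtain c g where f: "f = (\<lambda>x. c * (\<Prod>i\<in>Basis. g i (x \<bullet> i)))"
    and g: "\<And>i. g i \<in> bumps (a / real DIM('a))"
    using assms unfolding tensor_bumps_def by blast
  have "\<exists>i\<in>Basis. \<bar>x \<bullet> i\<bar> \<ge> a / real DIM('a)"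
  proof (rule ccontr)
    assume "\<not> ?thesis"
    then have "(\<Sum>i\<in>Basis. \<bar>x \<bullet> i\<bar>) < (\<Sum>i\<in>(Basis::'a set). a / real DIM('a))"
      by (intro sum_strict_mono) auto
    then show False using norm_le_l1[of x] norm_x by simp
  qed
  then obtain i where "i \<in> Basis" "g i (x \<bullet> i) = 0" using bumps_outside[OF g] by blast
  then have "(\<Prod>i\<in>Basis. g i (x \<bullet> i)) = 0" by (intro prod_zero) auto
  then show "f x = 0" by (simp add: f)
qed

section \<open>Continuously differentiable functions and their gradients\<close>

definition C1_grad :: "('a::euclidean_space \<Rightarrow> real) \<Rightarrow> ('a \<Rightarrow> 'a) \<Rightarrow> bool" where
  "C1_grad f D \<longleftrightarrow> (\<forall>x. (f has_derivative (\<lambda>h. D x \<bullet> h)) (at x)) \<and> continuous_on UNIV D"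

lemma C1_gradD: "C1_grad f D \<Longrightarrow> (f has_derivative (\<lambda>h. D x \<bullet> h)) (at x within S)"
  by (simp add: C1_grad_def has_derivative_at_withinI)

lemma C1_grad_continuous:
  assumes "C1_grad f D"
  shows "continuous_on S f" "continuous_on S D"
  using has_derivative_continuous_on[OF C1_gradD[OF assms]] assms
  by (auto simp: C1_grad_def intro: continuous_on_subset)

lemma C1_grad_measurable:
  assumes "C1_grad f D"
  shows "f \<in> borel_measurable borel" "D \<in> borel_measurable borel"
  using C1_grad_continuous[OF assms] by (auto intro!: borel_measurable_continuous_onI)

lemma C1_grad_line:
  assumes "C1_grad f D"
  shows "((\<lambda>t. f (x + t *\<^sub>R v)) has_real_derivative D (x + t *\<^sub>R v) \<bullet> v) (at t within T)"
proof -
  have "((\<lambda>t. x + t *\<^sub>R v) has_derivative (\<lambda>h. h *\<^sub>R v)) (at t within T)"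
    by (auto intro!: derivative_eq_intros)
  from has_derivative_compose[OF this C1_gradD[OF assms, where S=UNIV]]
  show ?thesis by (simp add: has_field_derivative_def mult_commute_abs)
qed

lemma C1_grad_partial: "C1_grad f D \<Longrightarrow> partial f i x = D x \<bullet> i"
  using C1_grad_line[of f D x i 0 UNIV] by (simp add: partial_def DERIV_imp_deriv)

lemma C1_grad_sgrad: "C1_grad f D \<Longrightarrow> sgrad f = D"
  by (simp add: fun_eq_iff sgrad_def C1_grad_partial euclidean_representation)

lemma sgrad_inner_Basis: "i \<in> Basis \<Longrightarrow> sgrad f x \<bullet> i = partial f i x"
  by (simp add: sgrad_def inner_sum_left inner_Basis if_distrib cong: if_cong)

lemma C1_grad_const: "C1_grad (\<lambda>_. c) (\<lambda>_. 0)"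
  by (simp add: C1_grad_def)

lemma C1_grad_reflect:
  assumes "C1_grad g D"
  shows "C1_grad (\<lambda>y. g (x - y)) (\<lambda>y. - D (x - y))"
  unfolding C1_grad_def
proof (intro conjI allI)
  fix y
  have "((\<lambda>y. x - y) has_derivative (\<lambda>h. - h)) (at y)" by (auto intro!: derivative_eq_intros)
  from has_derivative_compose[OF this C1_gradD[OF assms, where S=UNIV]]
  show "((\<lambda>y. g (x - y)) has_derivative (\<lambda>h. - D (x - y) \<bullet> h)) (at y)" by simp
next
  show "continuous_on UNIV (\<lambda>y. - D (x - y))"
    by (intro continuous_intros continuous_on_compose2[OF C1_grad_continuous(2)[OF assms, of UNIV]])
       auto
qed

lemma C1_grad_chain_mult:
  assumes v: "C1_grad v Dv" and \<zeta>: "C1_grad \<zeta> D\<zeta>"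
    and F: "\<And>t. (F has_real_derivative F' t) (at t)" "continuous_on UNIV F'"
  shows "C1_grad (\<lambda>x. F (v x) * \<zeta> x) (\<lambda>x. (F' (v x) * \<zeta> x) *\<^sub>R Dv x + F (v x) *\<^sub>R D\<zeta> x)"
  unfolding C1_grad_def
proof (intro conjI allI)
  fix x
  have "((\<lambda>x. F (v x)) has_derivative (\<lambda>h. F' (v x) * (Dv x \<bullet> h))) (at x)"
    using has_derivative_compose[OF C1_gradD[OF v, where S=UNIV]
        F(1)[unfolded has_field_derivative_def]] by simp
  from has_derivative_mult[OF this C1_gradD[OF \<zeta>]]
  show "((\<lambda>x. F (v x) * \<zeta> x) has_derivative
      (\<lambda>h. ((F' (v x) * \<zeta> x) *\<^sub>R Dv x + F (v x) *\<^sub>R D\<zeta> x) \<bullet> h)) (at x)"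
    by (rule has_derivative_eq_rhs) (auto simp: inner_add_left algebra_simps)
next
  have F_continuous: "continuous_on UNIV F" by (rule DERIV_continuous_on[OF F(1)])
  note v_continuous = C1_grad_continuous[OF v, of UNIV]
  show "continuous_on UNIV (\<lambda>x. (F' (v x) * \<zeta> x) *\<^sub>R Dv x + F (v x) *\<^sub>R D\<zeta> x)"
    by (intro continuous_intros continuous_on_compose2[OF F(2) v_continuous(1)]
        continuous_on_compose2[OF F_continuous v_continuous(1)] v_continuous(2)
        C1_grad_continuous[OF \<zeta>]) auto
qed

lemma C1_grad_compose:
  assumes "C1_grad v Dv" "\<And>t. (F has_real_derivative F' t) (at t)" "continuous_on UNIV F'"
  shows "C1_grad (\<lambda>x. F (v x)) (\<lambda>x. F' (v x) *\<^sub>R Dv x)"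
  using C1_grad_chain_mult[OF assms(1) C1_grad_const[of 1] assms(2,3)] by simp

lemma C1_grad_mean_value:
  assumes "C1_grad f D"
  obtains t where "0 < t" "t < 1" "f (x + h) - f x = D (x + t *\<^sub>R h) \<bullet> h"
  using MVT2[of 0 1 "\<lambda>t. f (x + t *\<^sub>R h)" "\<lambda>t. D (x + t *\<^sub>R h) \<bullet> h"]
    C1_grad_line[OF assms, of x h _ UNIV] by auto

lemma C1_grad_Lipschitz:
  assumes "C1_grad f D" "\<And>x. norm (D x) \<le> L"
  shows "\<bar>f y - f x\<bar> \<le> L * dist x y"
proof -
  obtain t where "f (x + (y - x)) - f x = D (x + t *\<^sub>R (y - x)) \<bullet> (y - x)"
    using C1_grad_mean_value[OF assms(1)] by blast
  then have "\<bar>f y - f x\<bar> \<le> norm (D (x + t *\<^sub>R (y - x))) * norm (y - x)"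
    using Cauchy_Schwarz_ineq2 by simp
  also have "\<dots> \<le> L * norm (y - x)" using assms(2) by (intro mult_right_mono) auto
  finally show ?thesis by (simp add: dist_norm norm_minus_commute)
qed

lemma C1_grad_taylor:
  assumes C1: "C1_grad f D" and L: "\<And>x y. norm (D y - D x) \<le> L * dist x y" "0 \<le> L"
  shows "\<bar>f (x + h) - f x - D x \<bullet> h\<bar> \<le> L * norm h ^ 2"
proof -
  obtain t where t: "0 < t" "t < 1" "f (x + h) - f x = D (x + t *\<^sub>R h) \<bullet> h"
    using C1_grad_mean_value[OF C1] by metis
  have "\<bar>f (x + h) - f x - D x \<bullet> h\<bar> = \<bar>(D (x + t *\<^sub>R h) - D x) \<bullet> h\<bar>"
    using t by (simp add: inner_diff_left)
  also have "\<dots> \<le> norm (D (x + t *\<^sub>R h) - D x) * norm h" by (rule Cauchy_Schwarz_ineq2)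
  also have "\<dots> \<le> (L * norm (t *\<^sub>R h)) * norm h"
    using L(1)[of "x + t *\<^sub>R h" x] by (intro mult_right_mono) (auto simp: dist_norm)
  also have "\<dots> \<le> (L * norm h) * norm h"
    using t L(2) by (intro mult_right_mono mult_left_mono) (auto simp: mult_left_le_one_le)
  finally show ?thesis by (simp add: power2_eq_square)
qed

lemma line_derivative_zero_outside:
  fixes f :: "'a::euclidean_space \<Rightarrow> real"
  assumes "closed S" "vanishes_outside S f" "x \<notin> S"
  shows "((\<lambda>t. f (x + t *\<^sub>R v)) has_real_derivative 0) (at 0)"
proof (rule has_field_derivative_transform_within_open[of "\<lambda>t. 0" 0 0 "(\<lambda>t. x + t *\<^sub>R v) -` (- S)"])
  show "open ((\<lambda>t. x + t *\<^sub>R v) -` (- S))"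
    using assms(1) by (intro continuous_open_vimage) (auto intro!: continuous_intros)
qed (use assms in \<open>auto simp: vanishes_outside_def\<close>)

lemma partial_vanishes_outside:
  assumes "closed S" "vanishes_outside S f"
  shows "vanishes_outside S (partial f i)"
  unfolding vanishes_outside_def partial_def
proof (intro allI impI)
  fix x assume "x \<notin> S"
  then show "deriv (\<lambda>t. f (x + t *\<^sub>R i)) 0 = 0"
    by (intro DERIV_imp_deriv line_derivative_zero_outside[OF assms])
qed

lemma C1_grad_vanishes_outside:
  assumes "C1_grad f D" "closed S" "vanishes_outside S f"
  shows "vanishes_outside S D"
  unfolding vanishes_outside_def
proof (intro allI impI)
  fix x assume "x \<notin> S"
  then have "partial f (D x) x = 0"
    by (rule vanishes_outsideD[OF partial_vanishes_outside[OF assms(2,3)]])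
  then show "D x = 0" by (simp add: C1_grad_partial[OF assms(1)])
qed

lemma smooth_funD:
  assumes "smooth_fun \<phi>" "i \<in> Basis"
  shows "continuous_on UNIV \<phi>" "continuous_on UNIV (partial \<phi> i)"
    "((\<lambda>t. \<phi> (x + t *\<^sub>R i)) has_real_derivative partial \<phi> i x) (at 0)"
proof -
  obtain F where F: "\<phi> \<in> F" "\<forall>g\<in>F. continuous_on UNIV g \<and>
      (\<forall>i\<in>Basis. (\<forall>x. (\<lambda>t. g (x + t *\<^sub>R i)) differentiable (at 0)) \<and> partial g i \<in> F)"
    using assms(1) unfolding smooth_fun_def by blast
  then show "continuous_on UNIV \<phi>" "continuous_on UNIV (partial \<phi> i)" using assms(2) by blast+
  have "(\<lambda>t. \<phi> (x + t *\<^sub>R i)) field_differentiable (at 0)"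
    using F assms(2) by (meson field_differentiable_def real_differentiable_def)
  then show "((\<lambda>t. \<phi> (x + t *\<^sub>R i)) has_real_derivative partial \<phi> i x) (at 0)"
    unfolding partial_def by (rule field_differentiable_derivI)
qed

lemma smooth_funI:
  assumes "f \<in> F" and "\<And>g. g \<in> F \<Longrightarrow> C1_grad g (sgrad g)"
    and "\<And>g i. g \<in> F \<Longrightarrow> i \<in> Basis \<Longrightarrow> partial g i \<in> F"
  shows "smooth_fun f"
  unfolding smooth_fun_def
proof (intro exI[of _ F] conjI ballI allI)
  fix g x and i :: 'a assume "g \<in> F"
  then have C1: "C1_grad g (sgrad g)" by (rule assms(2))
  show "continuous_on UNIV g" by (rule C1_grad_continuous[OF C1])
  show "(\<lambda>t. g (x + t *\<^sub>R i)) differentiable at 0"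
    using C1_grad_line[OF C1, of x i 0 UNIV] real_differentiable_def by blast
qed (use assms in auto)

lemma test_funI:
  assumes "smooth_fun f" "vanishes_outside C f" "compact C" "C \<subseteq> U"
  shows "test_fun U f"
proof -
  have "closure {x. f x \<noteq> 0} \<subseteq> C"
    using assms
    by (intro closure_minimal) (auto simp: compact_imp_closed dest: vanishes_outsideD)
  moreover from this have "compact (closure {x. f x \<noteq> 0})"
    using assms(3) compact_Int_closed[OF assms(3) closed_closure] by (metis inf.absorb_iff2)
  ultimately show ?thesis using assms unfolding test_fun_def by blast
qed

lemma test_fun_vanishes_outside:
  assumes "test_fun U \<phi>"
  shows "vanishes_outside U \<phi>" "vanishes_outside U (partial \<phi> i)"
proof -
  let ?S = "closure {x. \<phi> x \<noteq> 0}"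
  have "vanishes_outside ?S \<phi>"
    using closure_subset[of "{x. \<phi> x \<noteq> 0}"] by (auto simp: vanishes_outside_def)
  moreover from this have "vanishes_outside ?S (partial \<phi> i)"
    by (intro partial_vanishes_outside) auto
  moreover have "?S \<subseteq> U" using assms by (simp add: test_fun_def)
  ultimately show "vanishes_outside U \<phi>" "vanishes_outside U (partial \<phi> i)"
    by (metis vanishes_outside_mono)+
qed

section \<open>Gradients of tensor bumps\<close>

lemma has_derivative_prod_components:
  fixes g :: "'a::euclidean_space \<Rightarrow> real \<Rightarrow> real"
  assumes "\<And>i t. (g i has_real_derivative g' i t) (at t)"
  shows "((\<lambda>x. \<Prod>i\<in>Basis. g i (x \<bullet> i)) has_derivative
    (\<lambda>h. (\<Sum>i\<in>Basis. (\<Prod>j\<in>Basis. (g(i := g' i)) j (x \<bullet> j)) *\<^sub>R i) \<bullet> h)) (at x)"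
proof -
  have factor: "((\<lambda>x. g i (x \<bullet> i)) has_derivative (\<lambda>h. g' i (x \<bullet> i) * (h \<bullet> i))) (at x)" for i
  proof -
    have "((\<lambda>x. x \<bullet> i) has_derivative (\<lambda>h. h \<bullet> i)) (at x)" by (auto intro!: derivative_eq_intros)
    from has_derivative_compose[OF this assms[of i "x \<bullet> i", unfolded has_field_derivative_def]]
    show ?thesis .
  qed
  have "(\<Prod>j\<in>Basis. (g(i := g' i)) j (x \<bullet> j)) = g' i (x \<bullet> i) * (\<Prod>j\<in>Basis - {i}. g j (x \<bullet> j))"
    if "i \<in> Basis" for i
    using that by (simp add: prod.remove[of Basis i])
  then show ?thesis
    by (intro has_derivative_eq_rhs[OF has_derivative_prod[OF factor]])
       (simp add: fun_eq_iff inner_sum_right inner_commute mult_ac)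
qed

lemma tensor_bumps_gradient:
  fixes f :: "'a::euclidean_space \<Rightarrow> real"
  assumes "f \<in> tensor_bumps a"
  obtains D where "\<And>i. i \<in> Basis \<Longrightarrow> (\<lambda>x. D x \<bullet> i) \<in> tensor_bumps a"
    "\<And>x. (f has_derivative (\<lambda>h. D x \<bullet> h)) (at x)"
proof -
  obtain c g where f: "f = (\<lambda>x. c * (\<Prod>i\<in>Basis. g i (x \<bullet> i)))"
    and g: "\<And>i. g i \<in> bumps (a / real DIM('a))"
    using assms unfolding tensor_bumps_def by blast
  obtain g' where g': "\<And>i. g' i \<in> bumps (a / real DIM('a))"
    "\<And>i t. (g i has_real_derivative g' i t) (at t)"
    using bumps_closed_derivative[OF g] by metis
  define D where "D x = c *\<^sub>R (\<Sum>i\<in>Basis. (\<Prod>j\<in>Basis. (g(i := g' i)) j (x \<bullet> j)) *\<^sub>R i)" for x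
  have "(\<lambda>x. D x \<bullet> i) \<in> tensor_bumps a" if "i \<in> Basis" for i
  proof -
    have "D x \<bullet> i = c * (\<Prod>j\<in>Basis. (g(i := g' i)) j (x \<bullet> j))" for x
      using that by (simp add: D_def inner_sum_left inner_Basis if_distrib cong: if_cong)
    then show ?thesis
      unfolding tensor_bumps_def using g g' by (auto intro!: exI[of _ c] exI[of _ "g(i := g' i)"])
  qed
  moreover have "(f has_derivative (\<lambda>h. D x \<bullet> h)) (at x)" for x
    using has_derivative_mult_right[OF has_derivative_prod_components[OF g'(2)], of c]
    by (simp add: f D_def)
  ultimately show ?thesis using that by blast
qed

lemma tensor_bumps_continuous: "f \<in> tensor_bumps a \<Longrightarrow> continuous_on S f"
  by (metis tensor_bumps_gradient continuous_at_imp_continuous_on has_derivative_continuous)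

lemma tensor_bumps_measurable: "f \<in> tensor_bumps a \<Longrightarrow> f \<in> borel_measurable borel"
  by (rule borel_measurable_continuous_onI[OF tensor_bumps_continuous])

lemma tensor_bumps_C1_grad:
  assumes "f \<in> tensor_bumps a"
  shows "C1_grad f (sgrad f)" "i \<in> Basis \<Longrightarrow> partial f i \<in> tensor_bumps a"
proof -
  obtain D where D: "\<And>i. i \<in> Basis \<Longrightarrow> (\<lambda>x. D x \<bullet> i) \<in> tensor_bumps a"
    "\<And>x. (f has_derivative (\<lambda>h. D x \<bullet> h)) (at x)" using tensor_bumps_gradient[OF assms] by metis
  have "continuous_on UNIV (\<lambda>x. \<Sum>i\<in>Basis. (D x \<bullet> i) *\<^sub>R i)"
    by (intro continuous_intros tensor_bumps_continuous[OF D(1)])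
  then have C1: "C1_grad f D" using D(2) by (simp add: C1_grad_def euclidean_representation)
  then show "C1_grad f (sgrad f)" by (simp add: C1_grad_sgrad)
  show "partial f i \<in> tensor_bumps a" if "i \<in> Basis"
    using D(1)[OF that] by (simp add: C1_grad_partial[OF C1, abs_def])
qed

lemma compact_support_bounded:
  fixes f :: "'a::euclidean_space \<Rightarrow> 'b::real_normed_vector"
  assumes "continuous_on UNIV f" "compact C" "vanishes_outside C f"
  obtains M where "M > 0" "\<And>x. norm (f x) \<le> M"
proof -
  have "bounded (f ` C)"
    using assms
    by (intro compact_imp_bounded compact_continuous_image) (auto intro: continuous_on_subset)
  then obtain M where M: "M > 0" "\<forall>x\<in>C. norm (f x) \<le> M" unfolding bounded_pos by auto
  then have "norm (f x) \<le> M" for x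
    using vanishes_outsideD[OF assms(3), of x] by (cases "x \<in> C") auto
  with M(1) show ?thesis using that by blast
qed

lemma tensor_bumps_bounded:
  fixes f :: "'a::euclidean_space \<Rightarrow> real"
  assumes "f \<in> tensor_bumps a"
  obtains M where "M > 0" "\<And>x. \<bar>f x\<bar> \<le> M"
proof -
  have "vanishes_outside (cball 0 a) f"
    using tensor_bumps_vanishes_outside[OF assms] by (rule vanishes_outside_mono) auto
  then show ?thesis
    using compact_support_bounded[OF tensor_bumps_continuous[OF assms] compact_cball] that by auto
qed

lemma bounded_components:
  fixes D :: "'b \<Rightarrow> 'a::euclidean_space"
  assumes "\<And>i. i \<in> Basis \<Longrightarrow> \<exists>M. \<forall>x. \<bar>D x \<bullet> i\<bar> \<le> M"
  obtains M where "M > 0" "\<And>x. norm (D x) \<le> M"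
proof -
  obtain M where M: "\<And>i x. i \<in> Basis \<Longrightarrow> \<bar>D x \<bullet> i\<bar> \<le> M i" using assms by metis
  have "norm (D x) \<le> (\<Sum>i\<in>Basis. M i)" for x
    using norm_le_l1[of "D x"] sum_mono[of Basis "\<lambda>i. \<bar>D x \<bullet> i\<bar>" M] M by fastforce
  then have "norm (D x) \<le> max 1 (\<Sum>i\<in>Basis. M i)" for x by (meson max.coboundedI2)
  then show ?thesis using that[of "max 1 (\<Sum>i\<in>Basis. M i)"] by auto
qed

lemma tensor_bumps_sgrad_bounded:
  fixes f :: "'a::euclidean_space \<Rightarrow> real"
  assumes "f \<in> tensor_bumps a"
  obtains M where "M > 0" "\<And>x. norm (sgrad f x) \<le> M"
proof (rule bounded_components[of "sgrad f"])
  show "\<exists>M. \<forall>x. \<bar>sgrad f x \<bullet> i\<bar> \<le> M" if "i \<in> Basis" for i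
    using tensor_bumps_bounded[OF tensor_bumps_C1_grad(2)[OF assms that]]
    by (metis sgrad_inner_Basis[OF that])
qed (use that in blast)

lemma tensor_bumps_sgrad_Lipschitz:
  fixes f :: "'a::euclidean_space \<Rightarrow> real"
  assumes "f \<in> tensor_bumps a"
  obtains L where "L > 0" "\<And>x y. norm (sgrad f y - sgrad f x) \<le> L * dist x y"
proof -
  have "\<exists>L. \<forall>x y. \<bar>(sgrad f y - sgrad f x) \<bullet> i\<bar> \<le> L * dist x y" if "i \<in> Basis" for i
  proof -
    have bump: "partial f i \<in> tensor_bumps a" by (rule tensor_bumps_C1_grad(2)[OF assms that])
    obtain M where "\<And>x. norm (sgrad (partial f i) x) \<le> M"
      using tensor_bumps_sgrad_bounded[OF bump] by blast
    from C1_grad_Lipschitz[OF tensor_bumps_C1_grad(1)[OF bump] this] show ?thesis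
      using sgrad_inner_Basis[OF that, of f] by (metis inner_diff_left)
  qed
  then obtain L where L:
    "\<And>i x y. i \<in> Basis \<Longrightarrow> \<bar>(sgrad f y - sgrad f x) \<bullet> i\<bar> \<le> L i * dist x y" by metis
  have "norm (sgrad f y - sgrad f x) \<le> max 1 (\<Sum>i\<in>Basis. L i) * dist x y" for x y
  proof -
    have "norm (sgrad f y - sgrad f x) \<le> (\<Sum>i\<in>Basis. \<bar>(sgrad f y - sgrad f x) \<bullet> i\<bar>)"
      by (rule norm_le_l1)
    also have "\<dots> \<le> (\<Sum>i\<in>Basis. L i * dist x y)" by (intro sum_mono L)
    also have "\<dots> \<le> max 1 (\<Sum>i\<in>Basis. L i) * dist x y"
      by (simp flip: sum_distrib_right add: mult_right_mono)
    finally show ?thesis .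
  qed
  then show ?thesis using that[of "max 1 (\<Sum>i\<in>Basis. L i)"] by simp
qed

section \<open>Mollification\<close>

definition mollifier :: "real \<Rightarrow> ('a::euclidean_space \<Rightarrow> real) \<Rightarrow> bool" where
  "mollifier a \<rho> \<longleftrightarrow> \<rho> \<in> tensor_bumps a \<and> (\<forall>x. 0 \<le> \<rho> x) \<and> integral\<^sup>L lborel \<rho> = 1"

lemma compact_support_integrable:
  fixes f :: "'a::euclidean_space \<Rightarrow> 'b::euclidean_space"
  assumes "continuous_on UNIV f" "compact C" "vanishes_outside C f"
  shows "integrable lborel f"
proof -
  have "set_integrable lborel C f"
    unfolding set_integrable_def
    using assms by (intro borel_integrable_compact) (auto intro: continuous_on_subset)
  moreover have "(\<lambda>x. indicator C x *\<^sub>R f x) = f"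
    using vanishes_outsideD[OF assms(3)] by (auto simp: indicator_def)
  ultimately show ?thesis by (simp add: set_integrable_def)
qed

lemma tensor_bumps_integrable:
  fixes f :: "'a::euclidean_space \<Rightarrow> real"
  assumes "f \<in> tensor_bumps a"
  shows "integrable lborel f"
proof (rule compact_support_integrable[OF tensor_bumps_continuous[OF assms] compact_cball])
  show "vanishes_outside (cball 0 a) f"
    using tensor_bumps_vanishes_outside[OF assms] by (rule vanishes_outside_mono) auto
qed

lemma integral_pos_of_continuous:
  fixes g :: "'a::euclidean_space \<Rightarrow> real"
  assumes "continuous_on UNIV g" "integrable lborel g" "\<And>x. 0 \<le> g x" "g a \<noteq> 0"
  shows "0 < integral\<^sup>L lborel g"
proof -
  have "integral\<^sup>L lborel g \<noteq> 0"
  proof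
    assume "integral\<^sup>L lborel g = 0"
    then have g_zero: "AE x in lborel. g x = 0"
      using integral_nonneg_eq_0_iff_AE[OF assms(2)] assms(3) by auto
    have support_open: "open {x. g x \<noteq> 0}" by (rule open_Collect_neq) (auto intro: assms(1))
    have "{x. g x \<noteq> 0} \<in> null_sets lborel"
      using g_zero borel_open[OF support_open] by (auto simp: AE_iff_null_sets[of "{x. g x \<noteq> 0}"])
    then have "negligible {x. g x \<noteq> 0}"
      by (simp add: negligible_iff_null_sets null_sets_completionI)
    then show False using open_not_negligible[OF support_open] assms(4) by blast
  qed
  then show ?thesis using integral_nonneg_AE[of g lborel] assms(3) by (auto simp: less_le)
qed

lemma mollifier_exists:
  assumes "a > 0"
  obtains \<rho> :: "'a::euclidean_space \<Rightarrow> real" where "mollifier a \<rho>"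
proof -
  define b where "b t = flat_exp 0 (a / real DIM('a) - t) * flat_exp 0 (a / real DIM('a) + t)" for t
  define g where "g x = (\<Prod>i\<in>Basis. b (x \<bullet> i))" for x :: 'a
  have "b \<in> bumps (a / real DIM('a))" unfolding b_def[abs_def] by (rule bumps.base)
  then have g: "g \<in> tensor_bumps a"
    unfolding tensor_bumps_def g_def[abs_def] by (auto intro!: exI[of _ 1] exI[of _ "\<lambda>_. b"])
  have g_nonneg: "g x \<ge> 0" for x
    by (auto simp: g_def b_def flat_exp_def intro!: prod_nonneg)
  have "g 0 \<noteq> 0" using assms by (simp add: g_def b_def flat_exp_def)
  then have integral_pos: "0 < integral\<^sup>L lborel g"
    by (intro integral_pos_of_continuous[OF tensor_bumps_continuous[OF g]
        tensor_bumps_integrable[OF g]] g_nonneg)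
  have "mollifier a (\<lambda>x. inverse (integral\<^sup>L lborel g) * g x)"
    unfolding mollifier_def
    using g g_nonneg integral_pos tensor_bumps_integrable[OF g] by (auto intro!: tensor_bumps_cmult)
  then show ?thesis by (rule that)
qed

definition conv ::
  "('a::euclidean_space \<Rightarrow> real) \<Rightarrow> ('a \<Rightarrow> 'b::euclidean_space) \<Rightarrow> 'a \<Rightarrow> 'b" where
  "conv g f x = (\<integral>y. g (x - y) *\<^sub>R f y \<partial>lborel)"

definition conv_grad :: "('a::euclidean_space \<Rightarrow> 'a) \<Rightarrow> ('a \<Rightarrow> real) \<Rightarrow> 'a \<Rightarrow> 'a" where
  "conv_grad D f x = (\<integral>y. f y *\<^sub>R D (x - y) \<partial>lborel)"

lemma conv_integrable:
  fixes f :: "'a::euclidean_space \<Rightarrow> 'b::euclidean_space"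
  assumes "g \<in> tensor_bumps a" "integrable lborel f"
  shows "integrable lborel (\<lambda>y. g (x - y) *\<^sub>R f y)"
proof -
  obtain M where M: "\<And>x. \<bar>g x\<bar> \<le> M" using tensor_bumps_bounded[OF assms(1)] by blast
  note [measurable] = tensor_bumps_measurable[OF assms(1)] borel_measurable_integrable[OF assms(2)]
  show ?thesis
  proof (rule Bochner_Integration.integrable_bound[of _ "\<lambda>y. M * norm (f y)"])
    show "AE y in lborel. norm (g (x - y) *\<^sub>R f y) \<le> norm (M * norm (f y))"
      using M order_trans[OF M abs_ge_self[of M]] by (auto simp: abs_mult intro!: mult_right_mono)
  qed (use assms(2) in auto)
qed

lemma conv_grad_integrable:
  fixes f :: "'a::euclidean_space \<Rightarrow> real"
  assumes "g \<in> tensor_bumps a" "integrable lborel f"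
  shows "integrable lborel (\<lambda>y. f y *\<^sub>R sgrad g (x - y))"
proof -
  obtain M where M: "\<And>x. norm (sgrad g x) \<le> M"
    using tensor_bumps_sgrad_bounded[OF assms(1)] by blast
  note [measurable] = C1_grad_measurable(2)[OF tensor_bumps_C1_grad(1)[OF assms(1)]]
    borel_measurable_integrable[OF assms(2)]
  show ?thesis
  proof (rule Bochner_Integration.integrable_bound[of _ "\<lambda>y. \<bar>f y\<bar> * M"])
    show "AE y in lborel. norm (f y *\<^sub>R sgrad g (x - y)) \<le> norm (\<bar>f y\<bar> * M)"
      using M order_trans[OF M abs_ge_self[of M]] by (auto simp: abs_mult intro!: mult_left_mono)
  qed (use assms(2) in auto)
qed

lemma conv_grad_inner_Basis:
  assumes "g \<in> tensor_bumps a" "integrable lborel f" "i \<in> Basis"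
  shows "conv_grad (sgrad g) f x \<bullet> i = conv (partial g i) f x"
proof -
  have "conv_grad (sgrad g) f x \<bullet> i = (\<integral>y. (f y *\<^sub>R sgrad g (x - y)) \<bullet> i \<partial>lborel)"
    unfolding conv_grad_def
    by (rule integral_inner_left[symmetric]) (use conv_grad_integrable[OF assms(1,2)] in auto)
  then show ?thesis by (simp add: conv_def sgrad_inner_Basis[OF assms(3)] mult.commute)
qed

lemma has_derivative_if_quadratic_error:
  fixes f :: "'a::euclidean_space \<Rightarrow> real"
  assumes "\<And>h. \<bar>f (x + h) - f x - d \<bullet> h\<bar> \<le> C * norm h ^ 2"
  shows "(f has_derivative (\<lambda>h. d \<bullet> h)) (at x)"
  unfolding has_derivative_at
proof (intro conjI bounded_linear_inner_right)
  show "(\<lambda>h. norm (f (x + h) - f x - d \<bullet> h) / norm h) \<midarrow>0\<rightarrow> 0"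
  proof (rule Lim_null_comparison)
    have "norm (norm (f (x + h) - f x - d \<bullet> h) / norm h) \<le> C * norm h" for h
      using assms[of h] by (cases "h = 0") (auto simp: divide_le_eq power2_eq_square mult.assoc)
    then show "\<forall>\<^sub>F h in at 0. norm (norm (f (x + h) - f x - d \<bullet> h) / norm h) \<le> C * norm h" by simp
    show "(\<lambda>h. C * norm h) \<midarrow>0\<rightarrow> 0" by (auto intro!: tendsto_eq_intros)
  qed
qed

lemma conv_has_derivative:
  fixes f :: "'a::euclidean_space \<Rightarrow> real"
  assumes g: "g \<in> tensor_bumps a" and f: "integrable lborel f"
  shows "(conv g f has_derivative (\<lambda>h. conv_grad (sgrad g) f x \<bullet> h)) (at x)"
proof -
  obtain L where L: "L > 0" "\<And>x y. norm (sgrad g y - sgrad g x) \<le> L * dist x y"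
    using tensor_bumps_sgrad_Lipschitz[OF g] by blast
  define remainder where
    "remainder h y = (g (x + h - y) - g (x - y) - sgrad g (x - y) \<bullet> h) * f y" for h y
  have remainder_le: "norm (remainder h y) \<le> L * norm h ^ 2 * \<bar>f y\<bar>" for h y
  proof -
    have "\<bar>g (x - y + h) - g (x - y) - sgrad g (x - y) \<bullet> h\<bar> \<le> L * norm h ^ 2"
      by (rule C1_grad_taylor[OF tensor_bumps_C1_grad(1)[OF g] L(2)]) (use L(1) in simp)
    then show ?thesis
      by (simp add: remainder_def abs_mult mult_right_mono add.commute add_diff_eq diff_add_eq)
  qed
  note grad_integrable = conv_grad_integrable[OF g f, of x]
  have linear_term: "conv_grad (sgrad g) f x \<bullet> h = (\<integral>y. (sgrad g (x - y) \<bullet> h) * f y \<partial>lborel)"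
    "integrable lborel (\<lambda>y. (sgrad g (x - y) \<bullet> h) * f y)" for h
    using integral_inner_left[of h lborel "\<lambda>y. f y *\<^sub>R sgrad g (x - y)"]
      integrable_inner_left[of h lborel "\<lambda>y. f y *\<^sub>R sgrad g (x - y)"] grad_integrable
    by (auto simp: conv_grad_def mult.commute)
  have remainder: "integrable lborel (remainder h)"
    "conv g f (x + h) - conv g f x - conv_grad (sgrad g) f x \<bullet> h = (\<integral>y. remainder h y \<partial>lborel)"
      for h
    using conv_integrable[OF g f] linear_term
    unfolding remainder_def conv_def by (simp_all add: left_diff_distrib)
  show ?thesis
  proof (rule has_derivative_if_quadratic_error)
    fix h
    have "\<bar>\<integral>y. remainder h y \<partial>lborel\<bar> \<le> (\<integral>y. norm (remainder h y) \<partial>lborel)"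
      using integral_norm_bound by simp
    also have "\<dots> \<le> (\<integral>y. L * norm h ^ 2 * \<bar>f y\<bar> \<partial>lborel)"
      using f remainder(1) remainder_le by (intro integral_mono) auto
    finally show "\<bar>conv g f (x + h) - conv g f x - conv_grad (sgrad g) f x \<bullet> h\<bar>
        \<le> (L * (\<integral>y. \<bar>f y\<bar> \<partial>lborel)) * norm h ^ 2"
      unfolding remainder(2) by (simp add: mult_ac)
  qed
qed

lemma conv_continuous:
  fixes f :: "'a::euclidean_space \<Rightarrow> real"
  assumes "g \<in> tensor_bumps a" "integrable lborel f"
  shows "continuous_on UNIV (conv g f)"
  using has_derivative_continuous[OF conv_has_derivative[OF assms]]
  by (simp add: continuous_at_imp_continuous_on)

lemma conv_C1_grad:
  fixes f :: "'a::euclidean_space \<Rightarrow> real"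
  assumes "g \<in> tensor_bumps a" "integrable lborel f"
  shows "C1_grad (conv g f) (conv_grad (sgrad g) f)"
proof -
  have "continuous_on UNIV (\<lambda>x. \<Sum>i\<in>Basis. (conv_grad (sgrad g) f x \<bullet> i) *\<^sub>R i)"
    using conv_continuous[OF tensor_bumps_C1_grad(2)[OF assms(1)] assms(2)]
    by (auto simp: conv_grad_inner_Basis[OF assms] intro!: continuous_intros)
  then show ?thesis
    using conv_has_derivative[OF assms] by (simp add: C1_grad_def euclidean_representation)
qed

lemma smooth_fun_conv:
  fixes f :: "'a::euclidean_space \<Rightarrow> real"
  assumes "g \<in> tensor_bumps a" "integrable lborel f"
  shows "smooth_fun (conv g f)"
proof (rule smooth_funI[of _ "{conv g f | g. g \<in> tensor_bumps a}"])
  fix k assume "k \<in> {conv g f | g. g \<in> tensor_bumps a}"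
  then obtain g where k: "k = conv g f" and g: "g \<in> tensor_bumps a" by auto
  note C1 = conv_C1_grad[OF g assms(2)]
  show "C1_grad k (sgrad k)" using C1 by (simp add: k C1_grad_sgrad[OF C1])
  fix i :: 'a assume i: "i \<in> Basis"
  have "partial k i = conv (partial g i) f"
    using conv_grad_inner_Basis[OF g assms(2) i] by (simp add: fun_eq_iff k C1_grad_partial[OF C1])
  then show "partial k i \<in> {conv g f | g. g \<in> tensor_bumps a}"
    using tensor_bumps_C1_grad(2)[OF g i] by blast
qed (use assms in auto)

lemma test_fun_reflect:
  fixes g :: "'a::euclidean_space \<Rightarrow> real"
  assumes g: "g \<in> tensor_bumps a" and "cball x a \<subseteq> U"
  shows "test_fun U (\<lambda>y. g (x - y))"
proof (rule test_funI[where C = "cball x a"])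
  show "smooth_fun (\<lambda>y. g (x - y))"
  proof (rule smooth_funI[of _ "{\<lambda>y. g (x - y) | g. g \<in> tensor_bumps a}"])
    fix k assume "k \<in> {\<lambda>y. g (x - y) | g. g \<in> tensor_bumps a}"
    then obtain g where k: "k = (\<lambda>y. g (x - y))" and g: "g \<in> tensor_bumps a" by auto
    note C1 = C1_grad_reflect[OF tensor_bumps_C1_grad(1)[OF g], of x]
    show "C1_grad k (sgrad k)" using C1 by (simp add: k C1_grad_sgrad[OF C1])
    fix i :: 'a assume i: "i \<in> Basis"
    have "partial k i = (\<lambda>y. - 1 * partial g i (x - y))"
      by (simp add: fun_eq_iff k C1_grad_partial[OF C1] sgrad_inner_Basis[OF i])
    then show "partial k i \<in> {\<lambda>y. g (x - y) | g. g \<in> tensor_bumps a}"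
      using tensor_bumps_cmult[OF tensor_bumps_C1_grad(2)[OF g i], of "- 1"] by auto
  qed (use g in auto)
  show "vanishes_outside (cball x a) (\<lambda>y. g (x - y))"
    using vanishes_outsideD[OF tensor_bumps_vanishes_outside[OF g]]
    by (auto simp: vanishes_outside_def dist_norm)
qed (use assms in auto)

lemma conv_vanishes_outside:
  fixes f :: "'a::euclidean_space \<Rightarrow> 'b::euclidean_space"
  assumes g: "g \<in> tensor_bumps a" and f: "vanishes_outside (cball x0 R) f"
  shows "vanishes_outside (cball x0 (R + a)) (conv g f)"
  unfolding vanishes_outside_def
proof (intro allI impI)
  fix x assume x: "x \<notin> cball x0 (R + a)"
  have "g (x - y) *\<^sub>R f y = 0" for y
  proof (cases "y \<in> cball x0 R")
    case True
    then have "x - y \<notin> ball 0 a"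
      using x dist_triangle[of x0 x y] by (auto simp: dist_norm norm_minus_commute)
    then show ?thesis using vanishes_outsideD[OF tensor_bumps_vanishes_outside[OF g]] by simp
  qed (use vanishes_outsideD[OF f] in simp)
  then show "conv g f x = 0" unfolding conv_def by (simp only: integral_zero)
qed

section \<open>Convergence in Lp\<close>

lemma emeasure_lborel_bounded:
  "bounded A \<Longrightarrow> emeasure lborel A = ennreal (measure lborel A)"
  using emeasure_bounded_finite[of A] by (intro emeasure_eq_ennreal_measure) auto

lemma nn_integral_lborel_shift:
  fixes f :: "'a::euclidean_space \<Rightarrow> ennreal"
  assumes [measurable]: "f \<in> borel_measurable borel"
  shows "(\<integral>\<^sup>+x. f (t + x) \<partial>lborel) = (\<integral>\<^sup>+x. f x \<partial>lborel)"
  by (subst (2) lborel_distr_plus[of t, symmetric]) (simp add: nn_integral_distr)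

lemma nn_integral_lborel_reflect:
  fixes f :: "'a::euclidean_space \<Rightarrow> ennreal"
  assumes [measurable]: "f \<in> borel_measurable borel"
  shows "(\<integral>\<^sup>+x. f (t - x) \<partial>lborel) = (\<integral>\<^sup>+x. f x \<partial>lborel)"
  by (subst (2) lborel_affine[of "-1" t])
     (simp_all add: nn_integral_density nn_integral_distr)

lemma tendsto_ennreal_0I:
  assumes "\<And>e::real. e > 0 \<Longrightarrow> \<forall>\<^sub>F x in F. X x \<le> ennreal e"
  shows "(X \<longlongrightarrow> 0) F"
proof (rule order_tendstoI)
  fix a :: ennreal assume "0 < a"
  then obtain b where b: "0 < b" "b < a" using dense by blast
  then obtain e where e: "0 < e" "ennreal e < a" by (cases b) auto
  show "\<forall>\<^sub>F x in F. X x < a"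
    using assms[OF e(1)] by eventually_elim (use e(2) in auto)
qed auto

lemma powr_add_le_two_powr:
  fixes a b p :: real
  assumes "a \<ge> 0" "b \<ge> 0" "p > 0"
  shows "(a + b) powr p \<le> 2 powr p * (a powr p + b powr p)"
proof -
  have "(a + b) powr p \<le> (2 * max a b) powr p" using assms by (intro powr_mono2) auto
  also have "\<dots> = 2 powr p * max a b powr p" using assms by (simp add: powr_mult)
  also have "max a b powr p \<le> a powr p + b powr p" by (simp add: max_def)
  finally show ?thesis by (simp add: mult_left_mono)
qed

lemma le_add_scaled_powr:
  fixes t x p :: real
  assumes "t > 0" "x \<ge> 0" "p \<ge> 1"
  shows "x \<le> t + t powr (1 - p) * x powr p"
proof (cases "x \<le> t")
  case False
  have "1 \<le> (x / t) powr (p - 1)" using False assms by (intro ge_one_powr_ge_zero) auto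
  then have "x * 1 \<le> x * (x / t) powr (p - 1)" using assms by (intro mult_left_mono) auto
  also have "\<dots> = t powr (1 - p) * x powr p"
    using False assms by (simp add: powr_divide powr_diff field_simps)
  finally show ?thesis using assms by simp
qed (use assms in \<open>simp add: add_increasing2\<close>)

text \<open>The \<open>p\<close>-th power of the norm, not the norm itself.\<close>
definition Lpn :: "real \<Rightarrow> ('a::euclidean_space \<Rightarrow> 'b::euclidean_space) \<Rightarrow> ennreal" where
  "Lpn p f = (\<integral>\<^sup>+x. ennreal (norm (f x) powr p) \<partial>lborel)"

lemma Lpn_mono:
  assumes "\<And>x. norm (f x) \<le> norm (g x)" "p > 0"
  shows "Lpn p f \<le> Lpn p g"
  unfolding Lpn_def using assms by (intro nn_integral_mono ennreal_leI powr_mono2) auto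

lemma Lpn_minus_commute: "Lpn p (\<lambda>x. f x - g x) = Lpn p (\<lambda>x. g x - f x)"
  unfolding Lpn_def by (simp add: norm_minus_commute)

lemma Lpn_shift:
  assumes [measurable]: "f \<in> borel_measurable borel"
  shows "Lpn p (\<lambda>x. f (x + v)) = Lpn p f"
  unfolding Lpn_def
  using nn_integral_lborel_shift[of "\<lambda>x. ennreal (norm (f x) powr p)" v] by (simp add: add.commute)

lemma Lpn_add:
  fixes f g :: "'a::euclidean_space \<Rightarrow> 'b::euclidean_space"
  assumes [measurable]: "f \<in> borel_measurable borel" "g \<in> borel_measurable borel" and p: "p > 0"
  shows "Lpn p (\<lambda>x. f x + g x) \<le> ennreal (2 powr p) * (Lpn p f + Lpn p g)"
proof -
  have "norm (f x + g x) powr p \<le> 2 powr p * (norm (f x) powr p + norm (g x) powr p)" for x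
  proof -
    have "norm (f x + g x) powr p \<le> (norm (f x) + norm (g x)) powr p"
      using p by (intro powr_mono2 norm_triangle_ineq) auto
    also have "\<dots> \<le> 2 powr p * (norm (f x) powr p + norm (g x) powr p)"
      using p by (intro powr_add_le_two_powr) auto
    finally show ?thesis .
  qed
  then have "ennreal (norm (f x + g x) powr p)
      \<le> ennreal (2 powr p) * (ennreal (norm (f x) powr p) + ennreal (norm (g x) powr p))" for x
    by (subst ennreal_plus[symmetric], simp, simp, subst ennreal_mult'[symmetric])
       (auto intro!: ennreal_leI)
  then have "Lpn p (\<lambda>x. f x + g x) \<le> (\<integral>\<^sup>+x. ennreal (2 powr p) *
      (ennreal (norm (f x) powr p) + ennreal (norm (g x) powr p)) \<partial>lborel)"
    unfolding Lpn_def by (intro nn_integral_mono)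
  also have "\<dots> = ennreal (2 powr p) * (Lpn p f + Lpn p g)"
    unfolding Lpn_def by (subst nn_integral_cmult) (auto simp: nn_integral_add)
  finally show ?thesis .
qed

lemma Lpn_diff_trans:
  fixes f g h :: "'a::euclidean_space \<Rightarrow> 'b::euclidean_space"
  assumes [measurable]: "f \<in> borel_measurable borel" "g \<in> borel_measurable borel"
      "h \<in> borel_measurable borel"
    and "p > 0"
  shows "Lpn p (\<lambda>x. f x - h x)
    \<le> ennreal (2 powr p) * (Lpn p (\<lambda>x. f x - g x) + Lpn p (\<lambda>x. g x - h x))"
  using Lpn_add[of "\<lambda>x. f x - g x" "\<lambda>x. g x - h x" p] assms(4) by simp

lemma Lpn_le_Lipschitz:
  assumes [measurable]: "f \<in> borel_measurable borel"
    and "\<And>x. norm (g x) \<le> M * norm (f x)" "p > 0"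
  shows "Lpn p g \<le> ennreal (\<bar>M\<bar> powr p) * Lpn p f"
proof -
  have "norm (g x) \<le> norm (M *\<^sub>R f x)" for x
    using assms(2)[of x] mult_right_mono[OF abs_ge_self, of "norm (f x)" M] by simp
  then have "Lpn p g \<le> Lpn p (\<lambda>x. M *\<^sub>R f x)" using assms(3) by (intro Lpn_mono)
  also have "\<dots> = ennreal (\<bar>M\<bar> powr p) * Lpn p f"
    unfolding Lpn_def by (subst nn_integral_cmult[symmetric]) (auto simp: powr_mult ennreal_mult)
  finally show ?thesis .
qed

lemma Lpn_le_bound_on:
  assumes "\<And>x. norm (f x) \<le> M" "vanishes_outside S f" "S \<in> sets borel" "p > 0"
  shows "Lpn p f \<le> ennreal (M powr p) * emeasure lborel S"
proof -
  have "Lpn p f \<le> (\<integral>\<^sup>+x. ennreal (M powr p) * indicator S x \<partial>lborel)"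
    unfolding Lpn_def
  proof (intro nn_integral_mono)
    fix x show "ennreal (norm (f x) powr p) \<le> ennreal (M powr p) * indicator S x"
      using assms(1)[of x] vanishes_outsideD[OF assms(2), of x] assms(4)
      by (cases "x \<in> S") (auto intro!: ennreal_leI powr_mono2)
  qed
  then show ?thesis using assms(3) by (simp add: nn_integral_cmult_indicator)
qed

lemma Lpn_finite_of_bounded:
  assumes "\<And>x. norm (f x) \<le> M" "vanishes_outside S f" "S \<in> sets borel" "bounded S" "p > 0"
  shows "Lpn p f < \<infinity>"
proof (rule le_less_trans[OF Lpn_le_bound_on[OF assms(1,2,3,5)]])
  show "ennreal (M powr p) * emeasure lborel S < \<infinity>"
    using emeasure_bounded_finite[OF assms(4)] by (simp add: ennreal_mult_less_top)
qed

lemma Lpn_finite_of_compact_support: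
  assumes "continuous_on UNIV f" "compact C" "vanishes_outside C f" "p > 0"
  shows "Lpn p f < \<infinity>"
proof -
  obtain M where "\<And>x. norm (f x) \<le> M" using compact_support_bounded[OF assms(1-3)] by blast
  then show ?thesis
    using assms by (intro Lpn_finite_of_bounded) (auto intro: borel_compact compact_imp_bounded)
qed

lemma integrable_of_Lpn_finite:
  assumes [measurable]: "f \<in> borel_measurable borel" and "Lpn p f < \<infinity>"
  shows "integrable lborel (\<lambda>x. norm (f x) powr p)"
  using assms(2) by (intro integrableI_nonneg) (auto simp: Lpn_def)

lemma Lpn_tendsto_0_dominated:
  fixes f :: "nat \<Rightarrow> 'a::euclidean_space \<Rightarrow> 'b::euclidean_space"
    and g :: "'a \<Rightarrow> 'c::euclidean_space"
  assumes [measurable]: "\<And>n. f n \<in> borel_measurable borel" "g \<in> borel_measurable borel"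
    and dominated: "\<And>n x. norm (f n x) \<le> norm (g x)" "Lpn p g < \<infinity>"
    and pointwise: "AE x in lborel. (\<lambda>n. f n x) \<longlonglongrightarrow> 0" and p: "p > 0"
  shows "(\<lambda>n. Lpn p (f n)) \<longlonglongrightarrow> 0"
proof -
  have "(\<lambda>n. \<integral>\<^sup>+x. ennreal (norm (f n x) powr p) \<partial>lborel) \<longlonglongrightarrow> (\<integral>\<^sup>+x. 0 \<partial>(lborel :: 'a measure))"
  proof (rule nn_integral_dominated_convergence[where w = "\<lambda>x. ennreal (norm (g x) powr p)"])
    show "AE x in lborel. ennreal (norm (f n x) powr p) \<le> ennreal (norm (g x) powr p)" for n
      using dominated p by (intro AE_I2 ennreal_leI powr_mono2) auto
    show "AE x in lborel. (\<lambda>n. ennreal (norm (f n x) powr p)) \<longlonglongrightarrow> 0"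
      using pointwise
    proof eventually_elim
      fix x assume "(\<lambda>n. f n x) \<longlonglongrightarrow> 0"
      then have "(\<lambda>n. norm (f n x) powr p) \<longlonglongrightarrow> 0 powr p"
        using p by (intro tendsto_powr' tendsto_const) (auto intro: tendsto_norm_zero)
      then show "(\<lambda>n. ennreal (norm (f n x) powr p)) \<longlonglongrightarrow> 0"
        by (simp add: ennreal_tendsto_0_iff)
    qed
  qed (use dominated(2) in \<open>auto simp: Lpn_def\<close>)
  then show ?thesis by (simp add: Lpn_def)
qed

definition Lp_tendsto :: "real \<Rightarrow> (nat \<Rightarrow> 'a::euclidean_space \<Rightarrow> 'b::euclidean_space) \<Rightarrow>
    ('a \<Rightarrow> 'b) \<Rightarrow> bool" where
  "Lp_tendsto p F f \<longleftrightarrow> (\<forall>n. F n \<in> borel_measurable borel) \<and> f \<in> borel_measurable borel \<and>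
     (\<lambda>n. Lpn p (\<lambda>x. F n x - f x)) \<longlonglongrightarrow> 0"

lemma Lp_tendstoI:
  assumes "\<And>n. F n \<in> borel_measurable borel" "f \<in> borel_measurable borel"
    "\<And>n. Lpn p (\<lambda>x. F n x - f x) \<le> B n" "B \<longlonglongrightarrow> 0"
  shows "Lp_tendsto p F f"
  unfolding Lp_tendsto_def using assms
  by (auto intro!: tendsto_sandwich[OF _ _ tendsto_const assms(4)] always_eventually)

lemma Lp_tendstoD:
  assumes "Lp_tendsto p F f"
  shows "F n \<in> borel_measurable borel" "f \<in> borel_measurable borel"
    "(\<lambda>n. Lpn p (\<lambda>x. F n x - f x)) \<longlonglongrightarrow> 0"
  using assms by (auto simp: Lp_tendsto_def)

lemma Lp_tendsto_bounded_support:
  fixes F :: "nat \<Rightarrow> 'a::euclidean_space \<Rightarrow> 'b::euclidean_space"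
  assumes [measurable]: "\<And>n. F n \<in> borel_measurable borel" "f \<in> borel_measurable borel"
    and S: "S \<in> sets borel" "bounded S"
    and support: "\<And>n. vanishes_outside S (F n)" "vanishes_outside S f"
    and bound: "\<And>n x. norm (F n x) \<le> M" "\<And>x. norm (f x) \<le> M"
    and lim: "AE x in lborel. (\<lambda>n. F n x) \<longlonglongrightarrow> f x" and p: "p > 0"
  shows "Lp_tendsto p F f"
  unfolding Lp_tendsto_def
proof (intro conjI allI assms(1,2))
  let ?g = "\<lambda>x. (2 * M) *\<^sub>R indicat_real S x"
  have M: "0 \<le> M" by (rule order_trans[OF norm_ge_zero bound(2)])
  show "(\<lambda>n. Lpn p (\<lambda>x. F n x - f x)) \<longlonglongrightarrow> 0"
  proof (rule Lpn_tendsto_0_dominated[where g = ?g])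
    show "norm (F n x - f x) \<le> norm (?g x)" for n x
    proof (cases "x \<in> S")
      case True
      then show ?thesis
        using norm_triangle_ineq4[of "F n x" "f x"] bound(1)[of n x] bound(2)[of x] by simp
    qed (use vanishes_outsideD[OF support(1), of x n] vanishes_outsideD[OF support(2), of x] in
      simp)
    show "Lpn p ?g < \<infinity>"
      using M S p by (intro Lpn_finite_of_bounded[of _ "2 * M" S])
        (auto simp: indicator_def vanishes_outside_def)
    show "?g \<in> borel_measurable borel"
      using S by (intro borel_measurable_scaleR borel_measurable_indicator) auto
    show "AE x in lborel. (\<lambda>n. F n x - f x) \<longlonglongrightarrow> 0"
      using lim by eventually_elim (rule LIM_zero)
  qed (use p in auto)
qed

lemma Lp_tendsto_const: "f \<in> borel_measurable borel \<Longrightarrow> Lp_tendsto p (\<lambda>n. f) f"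
  by (simp add: Lp_tendsto_def Lpn_def)

lemma Lp_tendsto_subseq: "Lp_tendsto p F f \<Longrightarrow> strict_mono r \<Longrightarrow> Lp_tendsto p (\<lambda>n. F (r n)) f"
  using LIMSEQ_subseq_LIMSEQ[of "\<lambda>n. Lpn p (\<lambda>x. F n x - f x)" 0 r]
  by (simp add: Lp_tendsto_def o_def)

lemma Lp_tendsto_Lipschitz:
  assumes "Lp_tendsto p F f" "p > 0"
    and "\<And>n. G n \<in> borel_measurable borel" "g \<in> borel_measurable borel"
    and "\<And>n x. norm (G n x - g x) \<le> M * norm (F n x - f x)"
  shows "Lp_tendsto p G g"
proof (rule Lp_tendstoI)
  note [measurable] = Lp_tendstoD(1,2)[OF assms(1)]
  show "Lpn p (\<lambda>x. G n x - g x) \<le> ennreal (\<bar>M\<bar> powr p) * Lpn p (\<lambda>x. F n x - f x)" for n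
    by (rule Lpn_le_Lipschitz[OF _ assms(5,2)]) measurable
  show "(\<lambda>n. ennreal (\<bar>M\<bar> powr p) * Lpn p (\<lambda>x. F n x - f x)) \<longlonglongrightarrow> 0"
    using ennreal_tendsto_cmult[OF _ Lp_tendstoD(3)[OF assms(1)], of "ennreal (\<bar>M\<bar> powr p)"] by simp
qed (use assms in auto)

lemma Lp_tendsto_add:
  assumes F: "Lp_tendsto p F f" and G: "Lp_tendsto p G g" and p: "p > 0"
  shows "Lp_tendsto p (\<lambda>n x. F n x + G n x) (\<lambda>x. f x + g x)"
proof (rule Lp_tendstoI)
  note [measurable] = Lp_tendstoD(1,2)[OF F] Lp_tendstoD(1,2)[OF G]
  show "(\<lambda>x. F n x + G n x) \<in> borel_measurable borel" "(\<lambda>x. f x + g x) \<in> borel_measurable borel"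
    for n by measurable
  show "Lpn p (\<lambda>x. F n x + G n x - (f x + g x)) \<le> ennreal (2 powr p) *
      (Lpn p (\<lambda>x. F n x - f x) + Lpn p (\<lambda>x. G n x - g x))" for n
    using Lpn_add[of "\<lambda>x. F n x - f x" "\<lambda>x. G n x - g x" p] p by (simp add: algebra_simps)
  show "(\<lambda>n. ennreal (2 powr p) * (Lpn p (\<lambda>x. F n x - f x) + Lpn p (\<lambda>x. G n x - g x))) \<longlonglongrightarrow> 0"
    using ennreal_tendsto_cmult[OF _ tendsto_add[OF Lp_tendstoD(3)[OF F] Lp_tendstoD(3)[OF G]],
        of "ennreal (2 powr p)"] by simp
qed

lemma Lp_tendsto_trans:
  assumes F: "Lp_tendsto p F f" and p: "p > 0" and G: "\<And>n. G n \<in> borel_measurable borel"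
    and near: "(\<lambda>n. Lpn p (\<lambda>x. G n x - F n x)) \<longlonglongrightarrow> 0"
  shows "Lp_tendsto p G f"
proof -
  have "Lp_tendsto p (\<lambda>n x. G n x - F n x) (\<lambda>x. 0)"
    using near G Lp_tendstoD(1)[OF F] by (simp add: Lp_tendsto_def)
  from Lp_tendsto_add[OF this F p] show ?thesis by simp
qed

lemma Lp_tendsto_eventually_Lpn_less:
  "Lp_tendsto p F f \<Longrightarrow> (e::real) > 0 \<Longrightarrow> \<forall>\<^sub>F n in sequentially. Lpn p (\<lambda>x. F n x - f x) < ennreal e"
  by (intro order_tendstoD(2)[OF Lp_tendstoD(3)]) auto

lemma Lp_tendsto_Lpn_less:
  assumes "Lp_tendsto p F f" "(e::real) > 0"
  obtains n where "Lpn p (\<lambda>x. F n x - f x) < ennreal e"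
  using Lp_tendsto_eventually_Lpn_less[OF assms] by (auto simp: eventually_sequentially)

lemma Lp_tendsto_Lpn_finite:
  assumes F: "Lp_tendsto p F f" and p: "p > 0" and "\<And>n. Lpn p (F n) < \<infinity>"
  shows "Lpn p f < \<infinity>"
proof -
  note [measurable] = Lp_tendstoD(1,2)[OF F]
  obtain n where n: "Lpn p (\<lambda>x. F n x - f x) < ennreal 1"
    using Lp_tendsto_Lpn_less[OF F, of 1] by auto
  have "Lpn p f \<le> ennreal (2 powr p) * (Lpn p (\<lambda>x. f x - F n x) + Lpn p (F n))"
    using Lpn_add[of "\<lambda>x. f x - F n x" "F n" p] p by simp
  also have "\<dots> < \<infinity>"
    using less_trans[OF n ennreal_less_top] assms(3)[of n] Lpn_minus_commute[of p f "F n"]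
    by (simp add: ennreal_mult_less_top)
  finally show ?thesis .
qed

lemma Lp_tendsto_AE_subseq:
  fixes F :: "nat \<Rightarrow> 'a::euclidean_space \<Rightarrow> 'b::euclidean_space"
  assumes F: "Lp_tendsto p F f" and p: "p > 0"
    and finite: "\<And>n. Lpn p (\<lambda>x. F n x - f x) < \<infinity>"
  obtains r :: "nat \<Rightarrow> nat" where "strict_mono r" "AE x in lborel. (\<lambda>n. F (r n) x) \<longlonglongrightarrow> f x"
proof -
  note [measurable] = Lp_tendstoD(1,2)[OF F]
  define error where "error n x = norm (F n x - f x) powr p" for n x
  have error_integrable: "integrable lborel (error n)" for n
    unfolding error_def[abs_def] using finite[of n] by (intro integrable_of_Lpn_finite) auto
  have "(\<integral>x. norm (error n x) \<partial>lborel) = enn2real (Lpn p (\<lambda>x. F n x - f x))" for n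
    unfolding Lpn_def error_def by (subst integral_eq_nn_integral) auto
  moreover have "(\<lambda>n. enn2real (Lpn p (\<lambda>x. F n x - f x))) \<longlonglongrightarrow> enn2real 0"
    by (rule tendsto_enn2real) (use Lp_tendstoD(3)[OF F] in auto)
  ultimately have "\<exists>r. strict_mono r \<and> (AE x in lborel. (\<lambda>n. error (r n) x) \<longlonglongrightarrow> 0)"
    using error_integrable by (intro tendsto_L1_AE_subseq) (auto simp del: real_norm_def)
  then obtain r where r: "strict_mono r" "AE x in lborel. (\<lambda>n. error (r n) x) \<longlonglongrightarrow> 0" by blast
  from r(2) have "AE x in lborel. (\<lambda>n. F (r n) x) \<longlonglongrightarrow> f x"
  proof eventually_elim
    fix x assume "(\<lambda>n. error (r n) x) \<longlonglongrightarrow> 0"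
    then have "(\<lambda>n. (norm (F (r n) x - f x) powr p) powr (1 / p)) \<longlonglongrightarrow> 0 powr (1 / p)"
      unfolding error_def using p by (intro tendsto_powr' tendsto_const) auto
    then have "(\<lambda>n. norm (F (r n) x - f x)) \<longlonglongrightarrow> 0"
      using p by (simp add: powr_powr)
    then show "(\<lambda>n. F (r n) x) \<longlonglongrightarrow> f x"
      by (rule LIM_zero_cancel[OF tendsto_norm_zero_cancel])
  qed
  with r(1) show ?thesis by (rule that)
qed

lemma Lp_tendsto_scaleR_dominated:
  fixes c :: "nat \<Rightarrow> 'a::euclidean_space \<Rightarrow> real" and f :: "'a \<Rightarrow> 'b::euclidean_space"
  assumes [measurable]: "f \<in> borel_measurable borel" and finite: "Lpn p f < \<infinity>" and p: "p > 0"
    and [measurable]: "\<And>n. c n \<in> borel_measurable borel" "d \<in> borel_measurable borel"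
    and bounded: "\<And>n x. \<bar>c n x\<bar> \<le> M" "\<And>x. \<bar>d x\<bar> \<le> M"
    and pointwise: "AE x in lborel. (\<lambda>n. c n x) \<longlonglongrightarrow> d x"
  shows "Lp_tendsto p (\<lambda>n x. c n x *\<^sub>R f x) (\<lambda>x. d x *\<^sub>R f x)"
  unfolding Lp_tendsto_def
proof (intro conjI allI)
  show "(\<lambda>n. Lpn p (\<lambda>x. c n x *\<^sub>R f x - d x *\<^sub>R f x)) \<longlonglongrightarrow> 0"
  proof (rule Lpn_tendsto_0_dominated[where g = "\<lambda>x. (2 * M) *\<^sub>R f x"])
    show "norm (c n x *\<^sub>R f x - d x *\<^sub>R f x) \<le> norm ((2 * M) *\<^sub>R f x)" for n x
    proof -
      have "\<bar>c n x - d x\<bar> \<le> \<bar>2 * M\<bar>" using bounded(1)[of n x] bounded(2)[of x] by linarith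
      then show ?thesis by (simp flip: scaleR_left_diff_distrib add: mult_right_mono)
    qed
    show "Lpn p (\<lambda>x. (2 * M) *\<^sub>R f x) < \<infinity>"
    proof (rule le_less_trans)
      show "Lpn p (\<lambda>x. (2 * M) *\<^sub>R f x) \<le> ennreal (\<bar>\<bar>2 * M\<bar>\<bar> powr p) * Lpn p f"
        using p by (intro Lpn_le_Lipschitz) auto
      show "ennreal (\<bar>\<bar>2 * M\<bar>\<bar> powr p) * Lpn p f < \<infinity>"
        using finite by (simp add: ennreal_mult_less_top)
    qed
    show "AE x in lborel. (\<lambda>n. c n x *\<^sub>R f x - d x *\<^sub>R f x) \<longlonglongrightarrow> 0"
      using pointwise
    proof eventually_elim
      case (elim x)
      then have "(\<lambda>n. c n x *\<^sub>R f x - d x *\<^sub>R f x) \<longlonglongrightarrow> d x *\<^sub>R f x - d x *\<^sub>R f x"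
        by (intro tendsto_intros)
      then show ?case by simp
    qed
  qed (use p in measurable)
qed measurable

lemma Lp_tendsto_scaleR_AE:
  fixes F :: "nat \<Rightarrow> 'a::euclidean_space \<Rightarrow> 'b::euclidean_space" and c :: "nat \<Rightarrow> 'a \<Rightarrow> real"
  assumes F: "Lp_tendsto p F f" and finite: "Lpn p f < \<infinity>" and p: "p > 0"
    and c: "\<And>n. c n \<in> borel_measurable borel" "d \<in> borel_measurable borel"
    and bounded: "\<And>n x. \<bar>c n x\<bar> \<le> M" "\<And>x. \<bar>d x\<bar> \<le> M"
    and pointwise: "AE x in lborel. (\<lambda>n. c n x) \<longlonglongrightarrow> d x"
  shows "Lp_tendsto p (\<lambda>n x. c n x *\<^sub>R F n x) (\<lambda>x. d x *\<^sub>R f x)"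
proof -
  note [measurable] = Lp_tendstoD(1,2)[OF F] c
  have "Lp_tendsto p (\<lambda>n x. c n x *\<^sub>R (F n x - f x)) (\<lambda>x. 0)"
    by (rule Lp_tendsto_Lipschitz[OF F p, where M = M])
       (auto intro!: mult_right_mono bounded(1))
  moreover have "Lp_tendsto p (\<lambda>n x. c n x *\<^sub>R f x) (\<lambda>x. d x *\<^sub>R f x)"
    by (rule Lp_tendsto_scaleR_dominated[OF Lp_tendstoD(2)[OF F] finite p c bounded pointwise])
  ultimately have "Lp_tendsto p
      (\<lambda>n x. c n x *\<^sub>R (F n x - f x) + c n x *\<^sub>R f x) (\<lambda>x. 0 + d x *\<^sub>R f x)"
    using p by (rule Lp_tendsto_add)
  then show ?thesis by (simp flip: scaleR_add_right)
qed

lemma nn_integral_norm_le_Lpn: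
  fixes f :: "'a::euclidean_space \<Rightarrow> 'b::euclidean_space"
  assumes [measurable]: "f \<in> borel_measurable borel" "S \<in> sets borel"
    and "vanishes_outside S f" "p \<ge> 1" "t > 0"
  shows "(\<integral>\<^sup>+x. ennreal (norm (f x)) \<partial>lborel)
    \<le> ennreal t * emeasure lborel S + ennreal (t powr (1 - p)) * Lpn p f"
proof -
  have "(\<integral>\<^sup>+x. ennreal (norm (f x)) \<partial>lborel) \<le> (\<integral>\<^sup>+x. ennreal t * indicator S x
      + ennreal (t powr (1 - p)) * ennreal (norm (f x) powr p) \<partial>lborel)"
  proof (rule nn_integral_mono)
    fix x
    show "ennreal (norm (f x))
      \<le> ennreal t * indicator S x + ennreal (t powr (1 - p)) * ennreal (norm (f x) powr p)"
    proof (cases "x \<in> S")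
      case True
      have "ennreal (norm (f x)) \<le> ennreal (t + t powr (1 - p) * norm (f x) powr p)"
        using assms(4,5) by (intro ennreal_leI le_add_scaled_powr) auto
      then show ?thesis using True assms(5) by (simp add: ennreal_mult')
    qed (use vanishes_outsideD[OF assms(3)] in simp)
  qed
  also have "\<dots> = ennreal t * emeasure lborel S + ennreal (t powr (1 - p)) * Lpn p f"
    by (simp add: nn_integral_add nn_integral_cmult nn_integral_cmult_indicator Lpn_def)
  finally show ?thesis .
qed

lemma integrable_of_Lpn:
  fixes f :: "'a::euclidean_space \<Rightarrow> 'b::euclidean_space"
  assumes "f \<in> borel_measurable borel" "Lpn p f < \<infinity>"
    and "vanishes_outside S f" "S \<in> sets borel" "bounded S" "p \<ge> 1"
  shows "integrable lborel f"
proof (rule integrableI_bounded)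
  have "(\<integral>\<^sup>+x. ennreal (norm (f x)) \<partial>lborel) \<le> emeasure lborel S + Lpn p f"
    using nn_integral_norm_le_Lpn[OF assms(1,4,3,6), of 1] by simp
  also have "\<dots> < \<infinity>" using assms(2) emeasure_bounded_finite[OF assms(5)] by simp
  finally show "(\<integral>\<^sup>+x. ennreal (norm (f x)) \<partial>lborel) < \<infinity>" .
qed (use assms in simp)

lemma Lp_tendsto_imp_L1_tendsto:
  fixes F :: "nat \<Rightarrow> 'a::euclidean_space \<Rightarrow> 'b::euclidean_space"
  assumes F: "Lp_tendsto p F f" and S: "S \<in> sets borel" "bounded S" and p: "p \<ge> 1"
    and support: "\<And>n. vanishes_outside S (F n)" "vanishes_outside S f"
  shows "(\<lambda>n. \<integral>\<^sup>+x. ennreal (norm (F n x - f x)) \<partial>lborel) \<longlonglongrightarrow> 0"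
proof (rule tendsto_ennreal_0I)
  fix e :: real assume e: "e > 0"
  note [measurable] = Lp_tendstoD(1,2)[OF F]
  define t where "t = e / (2 * (measure lborel S + 1))"
  define \<delta> where "\<delta> = t powr (p - 1) * (e / 2)"
  have t: "t > 0" using e by (simp add: t_def add_nonneg_pos)
  then have \<delta>_pos: "\<delta> > 0" using e by (simp add: \<delta>_def)
  then have "\<forall>\<^sub>F n in sequentially. Lpn p (\<lambda>x. F n x - f x) < ennreal \<delta>"
    by (rule Lp_tendsto_eventually_Lpn_less[OF F])
  then show "\<forall>\<^sub>F n in sequentially. (\<integral>\<^sup>+x. ennreal (norm (F n x - f x)) \<partial>lborel) \<le> ennreal e"
  proof eventually_elim
    fix n assume n: "Lpn p (\<lambda>x. F n x - f x) < ennreal \<delta>"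
    have "vanishes_outside S (\<lambda>x. F n x - f x)" using support by (simp add: vanishes_outside_def)
    then have "(\<integral>\<^sup>+x. ennreal (norm (F n x - f x)) \<partial>lborel)
        \<le> ennreal t * emeasure lborel S + ennreal (t powr (1 - p)) * Lpn p (\<lambda>x. F n x - f x)"
      using S(1) p t by (intro nn_integral_norm_le_Lpn) auto
    also have "\<dots> \<le> ennreal t * ennreal (measure lborel S) + ennreal (t powr (1 - p)) * ennreal \<delta>"
      using n emeasure_lborel_bounded[OF S(2)] by (intro add_mono mult_left_mono) auto
    also have "\<dots> = ennreal (t * measure lborel S + t powr (1 - p) * \<delta>)"
      using t \<delta>_pos by (simp add: ennreal_mult')
    also have "t powr (1 - p) * \<delta> = e / 2" using t by (simp add: \<delta>_def powr_diff field_simps)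
    also have "t * measure lborel S \<le> t * (measure lborel S + 1)"
      using t by (intro mult_left_mono) auto
    also have "\<dots> = e / 2"
      using measure_nonneg[of lborel S] by (simp add: t_def field_simps add_nonneg_eq_0_iff)
    finally show "(\<integral>\<^sup>+x. ennreal (norm (F n x - f x)) \<partial>lborel) \<le> ennreal e"
      by (simp add: ennreal_leI)
  qed
qed

lemma mult_continuous_le:
  fixes \<phi> :: "'a::euclidean_space \<Rightarrow> real"
  assumes "compact C" "continuous_on UNIV \<phi>"
  obtains M where "M > 0" "\<And>f x. vanishes_outside C f \<Longrightarrow> \<bar>f x * \<phi> x\<bar> \<le> M * \<bar>f x\<bar>"
proof -
  have "bounded (\<phi> ` C)"
    using assms
    by (intro compact_imp_bounded compact_continuous_image) (auto intro: continuous_on_subset)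
  then obtain M where M: "M > 0" "\<forall>x\<in>C. \<bar>\<phi> x\<bar> \<le> M" unfolding bounded_pos by auto
  have "\<bar>f x * \<phi> x\<bar> \<le> M * \<bar>f x\<bar>" if "vanishes_outside C f" for f x
    using M(2) vanishes_outsideD[OF that, of x]
    by (cases "x \<in> C") (auto simp: abs_mult mult.commute[of M] intro!: mult_left_mono)
  with M(1) show ?thesis by (rule that)
qed

lemma integrable_mult_continuous:
  fixes f \<phi> :: "'a::euclidean_space \<Rightarrow> real"
  assumes "integrable lborel f" "compact C" "vanishes_outside C f" "continuous_on UNIV \<phi>"
  shows "integrable lborel (\<lambda>x. f x * \<phi> x)"
proof -
  obtain M where M: "M > 0" "\<And>x. \<bar>f x * \<phi> x\<bar> \<le> M * \<bar>f x\<bar>"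
    using mult_continuous_le[OF assms(2,4)] assms(3) by metis
  show ?thesis
  proof (rule Bochner_Integration.integrable_bound[of _ "\<lambda>x. M * f x"])
    show "(\<lambda>x. f x * \<phi> x) \<in> borel_measurable lborel"
      using borel_measurable_integrable[OF assms(1)] borel_measurable_continuous_onI[OF assms(4)]
      by auto
  qed (use assms(1) M in \<open>auto simp: abs_mult\<close>)
qed

lemma Lp_tendsto_integral_mult:
  fixes F :: "nat \<Rightarrow> 'a::euclidean_space \<Rightarrow> real"
  assumes F: "Lp_tendsto p F f" and C: "compact C" and p: "p \<ge> 1"
    and support: "\<And>n. vanishes_outside C (F n)" "vanishes_outside C f"
    and integrable: "\<And>n. integrable lborel (F n)" "integrable lborel f"
    and \<phi>: "continuous_on UNIV \<phi>"
  shows "(\<lambda>n. \<integral>x. F n x * \<phi> x \<partial>lborel) \<longlonglongrightarrow> (\<integral>x. f x * \<phi> x \<partial>lborel)"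
proof -
  have C_borel: "C \<in> sets borel" "bounded C"
    using C by (auto intro: compact_imp_bounded borel_compact)
  obtain M where M: "M > 0"
    "\<And>f x. vanishes_outside C f \<Longrightarrow> \<bar>f x * \<phi> x\<bar> \<le> M * \<bar>f x\<bar>"
    using mult_continuous_le[OF C \<phi>] by blast
  have products: "integrable lborel (\<lambda>x. F n x * \<phi> x)" "integrable lborel (\<lambda>x. f x * \<phi> x)" for n
    by (intro integrable_mult_continuous[OF _ C _ \<phi>] integrable support)+
  have difference: "\<bar>(\<integral>x. F n x * \<phi> x \<partial>lborel) - (\<integral>x. f x * \<phi> x \<partial>lborel)\<bar>
      \<le> M * (\<integral>x. \<bar>F n x - f x\<bar> \<partial>lborel)" for n
  proof -
    have "(\<integral>x. F n x * \<phi> x \<partial>lborel) - (\<integral>x. f x * \<phi> x \<partial>lborel) = (\<integral>x. (F n x - f x) * \<phi> x \<partial>lborel)"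
      using products by (simp add: left_diff_distrib)
    also have "\<bar>\<dots>\<bar> \<le> (\<integral>x. \<bar>(F n x - f x) * \<phi> x\<bar> \<partial>lborel)" by (rule integral_abs_bound)
    also have "\<dots> \<le> (\<integral>x. M * \<bar>F n x - f x\<bar> \<partial>lborel)"
    proof (rule integral_mono)
      show "\<bar>(F n x - f x) * \<phi> x\<bar> \<le> M * \<bar>F n x - f x\<bar>" for x
        by (rule M(2)[of "\<lambda>x. F n x - f x"]) (use support in \<open>simp add: vanishes_outside_def\<close>)
    qed (use products integrable in \<open>auto simp: left_diff_distrib\<close>)
    finally show ?thesis by simp
  qed
  have "(\<lambda>n. enn2real (\<integral>\<^sup>+x. ennreal (norm (F n x - f x)) \<partial>lborel)) \<longlonglongrightarrow> 0"
    using Lp_tendsto_imp_L1_tendsto[OF F C_borel p support] by (intro tendsto_enn2real) auto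
  moreover have "enn2real (\<integral>\<^sup>+x. ennreal (norm (F n x - f x)) \<partial>lborel)
      = (\<integral>x. \<bar>F n x - f x\<bar> \<partial>lborel)" for n
    using integrable by (subst nn_integral_eq_integral) auto
  ultimately have null: "(\<lambda>n. M * (\<integral>x. \<bar>F n x - f x\<bar> \<partial>lborel)) \<longlonglongrightarrow> 0"
    by (intro tendsto_mult_right_zero) simp
  have "\<forall>\<^sub>F n in sequentially. norm ((\<integral>x. F n x * \<phi> x \<partial>lborel) - (\<integral>x. f x * \<phi> x \<partial>lborel))
      \<le> M * (\<integral>x. \<bar>F n x - f x\<bar> \<partial>lborel)"
    using difference by simp
  from Lim_null_comparison[OF this null] show ?thesis by (rule LIM_zero_cancel)
qed

lemma Lp_tendsto_truncation:
  assumes f: "f \<in> borel_measurable borel" and "Lpn p f < \<infinity>" "p > 0"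
  shows "Lp_tendsto p (\<lambda>n x. closest_point (cball 0 (real n)) (f x)) f"
  unfolding Lp_tendsto_def
proof (intro conjI allI f)
  let ?clamp = "\<lambda>n x. closest_point (cball 0 (real n)) (f x)"
  have "closest_point (cball (0::'b) (real n)) \<in> borel_measurable borel" for n
    by (intro borel_measurable_continuous_onI continuous_on_closest_point) auto
  from measurable_compose[OF f this] show clamp: "?clamp n \<in> borel_measurable borel" for n .
  show "(\<lambda>n. Lpn p (\<lambda>x. ?clamp n x - f x)) \<longlonglongrightarrow> 0"
  proof (rule Lpn_tendsto_0_dominated[where g = f])
    show "norm (?clamp n x - f x) \<le> norm (f x)" for n x
      using closest_point_le[of "cball 0 (real n)" 0 "f x"]
      by (simp add: dist_norm norm_minus_commute)
    show "AE x in lborel. (\<lambda>n. ?clamp n x - f x) \<longlonglongrightarrow> 0"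
    proof (rule AE_I2, rule tendsto_eventually)
      fix x
      obtain m where "norm (f x) \<le> real m" using real_arch_simple by blast
      then show "\<forall>\<^sub>F n in sequentially. ?clamp n x - f x = 0"
        by (intro eventually_sequentiallyI[of m]) (auto simp: closest_point_self)
    qed
  qed (use assms clamp in auto)
qed

lemma bounded_function_continuous_approx_AE:
  fixes f :: "'a::euclidean_space \<Rightarrow> 'b::euclidean_space"
  assumes [measurable]: "f \<in> borel_measurable borel" and M: "\<And>x. norm (f x) \<le> M"
  obtains k where "\<And>n. continuous_on UNIV (k n)" "\<And>n x. norm (k n x) \<le> M"
    "AE x in lborel. (\<lambda>n. k n x) \<longlonglongrightarrow> f x"
proof -
  have "f measurable_on UNIV"
    by (subst measurable_on_iff_borel_measurable)
      (auto simp: lebesgue_on_UNIV_eq measurable_completion)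
  then obtain N g where N: "negligible N" and g: "\<And>n. continuous_on UNIV (g n)"
    and g_tendsto: "\<And>x. x \<notin> N \<Longrightarrow> (\<lambda>n. g n x) \<longlonglongrightarrow> f x"
    unfolding measurable_on_def by auto
  define clamp where "clamp = closest_point (cball (0::'b) M)"
  have M_nonneg: "0 \<le> M" using M norm_ge_zero order_trans by blast
  have clamp: "continuous_on UNIV clamp" "clamp (f x) = f x" "norm (clamp y) \<le> M" for x y
    using M M_nonneg closest_point_in_set[of "cball 0 M" y]
    by (auto simp: clamp_def closest_point_self intro!: continuous_on_closest_point)
  have "continuous_on UNIV (\<lambda>x. clamp (g n x))" for n
    by (intro continuous_on_compose2[OF clamp(1) g]) auto
  moreover have "AE x in lborel. (\<lambda>n. clamp (g n x)) \<longlonglongrightarrow> f x"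
  proof -
    have "isCont clamp (f x)" for x using clamp(1) by (simp add: continuous_on_eq_continuous_at)
    from isCont_tendsto_compose[OF this g_tendsto]
    have tendsto: "(\<lambda>n. clamp (g n x)) \<longlonglongrightarrow> f x" if "x \<notin> N" for x
      using that unfolding clamp(2) by blast
    have "AE x in lebesgue. x \<notin> N" using N by (simp add: AE_not_in negligible_iff_null_sets)
    then have "AE x in lebesgue. (\<lambda>n. clamp (g n x)) \<longlonglongrightarrow> f x" by eventually_elim (rule tendsto)
    then show ?thesis by (simp add: AE_completion_iff)
  qed
  ultimately show ?thesis using clamp(3) by (intro that[of "\<lambda>n x. clamp (g n x)"])
qed

lemma bounded_function_Lp_continuous_approx:
  fixes f :: "'a::euclidean_space \<Rightarrow> 'b::euclidean_space"
  assumes f: "f \<in> borel_measurable borel" and M: "\<And>x. norm (f x) \<le> M"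
    and support: "vanishes_outside (cball x0 R) f" and p: "p > 0"
  obtains k where "\<And>n. continuous_on UNIV (k n)" "\<And>n. vanishes_outside (cball x0 (R + 1)) (k n)"
    "Lp_tendsto p k f"
proof -
  obtain h where h: "\<And>n. continuous_on UNIV (h n)" "\<And>n x. norm (h n x) \<le> M"
    and h_tendsto: "AE x in lborel. (\<lambda>n. h n x) \<longlonglongrightarrow> f x"
    using bounded_function_continuous_approx_AE[OF f M] by blast
  define cut where "cut x = max 0 (min 1 (R + 1 - dist x0 x))" for x
  define k where "k n x = cut x *\<^sub>R h n x" for n x
  have cut: "continuous_on UNIV cut" "0 \<le> cut x" "cut x \<le> 1" "cut x *\<^sub>R f x = f x" for x
    using vanishes_outsideD[OF support, of x]
    by (cases "x \<in> cball x0 R"; auto simp: cut_def[abs_def] intro!: continuous_intros)+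
  have k_continuous: "continuous_on UNIV (k n)" for n
    unfolding k_def[abs_def] by (intro continuous_intros cut h)
  have k_support: "vanishes_outside (cball x0 (R + 1)) (k n)" for n
    by (auto simp: vanishes_outside_def k_def cut_def)
  have k_le: "norm (k n x) \<le> M" for n x
    using mult_mono[OF cut(3) h(2)[of n x]] cut(2)[of x] by (simp add: k_def)
  have "AE x in lborel. (\<lambda>n. k n x) \<longlonglongrightarrow> f x"
    using h_tendsto
  proof eventually_elim
    case (elim x)
    then have "(\<lambda>n. k n x) \<longlonglongrightarrow> cut x *\<^sub>R f x" unfolding k_def by (intro tendsto_intros)
    then show ?case by (simp only: cut(4))
  qed
  moreover have "vanishes_outside (cball x0 (R + 1)) f"
    by (rule vanishes_outside_mono[OF support]) auto
  ultimately have "Lp_tendsto p k f"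
    using k_support k_le M p f borel_measurable_continuous_onI[OF k_continuous]
    by (intro Lp_tendsto_bounded_support[of k f "cball x0 (R + 1)" M]) auto
  with k_continuous k_support show ?thesis by (rule that)
qed

lemma Lp_continuous_approx:
  fixes f :: "'a::euclidean_space \<Rightarrow> 'b::euclidean_space"
  assumes f[measurable]: "f \<in> borel_measurable borel" and finite: "Lpn p f < \<infinity>"
    and support: "vanishes_outside (cball x0 R) f" and p: "p > 0" and e: "e > 0"
  obtains g where "continuous_on UNIV g" "vanishes_outside (cball x0 (R + 1)) g"
    "Lpn p (\<lambda>x. f x - g x) < ennreal e"
proof -
  define e' where "e' = e / (2 * 2 powr p)"
  have e': "e' > 0" using e by (simp add: e'_def)
  note truncation = Lp_tendsto_truncation[OF f finite p]
  obtain m where m: "Lpn p (\<lambda>x. closest_point (cball 0 (real m)) (f x) - f x) < ennreal e'"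
    by (rule Lp_tendsto_Lpn_less[OF truncation e'])
  define f\<^sub>m where "f\<^sub>m x = closest_point (cball 0 (real m)) (f x)" for x
  have f\<^sub>m[measurable]: "f\<^sub>m \<in> borel_measurable borel"
    unfolding f\<^sub>m_def[abs_def] by (rule Lp_tendstoD(1)[OF truncation])
  have "norm (f\<^sub>m x) \<le> real m" for x
    using closest_point_in_set[of "cball 0 (real m)" "f x"] by (simp add: f\<^sub>m_def)
  moreover have "vanishes_outside (cball x0 R) f\<^sub>m"
    using support by (simp add: vanishes_outside_def f\<^sub>m_def closest_point_self)
  ultimately obtain k where k: "\<And>n. continuous_on UNIV (k n)"
    "\<And>n. vanishes_outside (cball x0 (R + 1)) (k n)" "Lp_tendsto p k f\<^sub>m"
    using bounded_function_Lp_continuous_approx[OF f\<^sub>m _ _ p] by metis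
  obtain n where n: "Lpn p (\<lambda>x. k n x - f\<^sub>m x) < ennreal e'"
    by (rule Lp_tendsto_Lpn_less[OF k(3) e'])
  have "Lpn p (\<lambda>x. f x - k n x)
      \<le> ennreal (2 powr p) * (Lpn p (\<lambda>x. f x - f\<^sub>m x) + Lpn p (\<lambda>x. f\<^sub>m x - k n x))"
    using p Lp_tendstoD(1)[OF k(3)] by (intro Lpn_diff_trans) auto
  also have "\<dots> < ennreal (2 powr p) * (ennreal e' + ennreal e')"
    using n m unfolding Lpn_minus_commute[of p "k n"] f\<^sub>m_def[symmetric]
        Lpn_minus_commute[of p f\<^sub>m f]
    by (intro ennreal_mult_strict_left_mono add_strict_mono) auto
  also have "\<dots> = ennreal e"
    using e' by (simp add: ennreal_plus[symmetric] ennreal_mult[symmetric] e'_def del: ennreal_plus)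
  finally show ?thesis using that k(1,2) by blast
qed

lemma powr_tangent:
  fixes a m p :: real
  assumes "a \<ge> 0" "m \<ge> 0" "p > 1"
  shows "a powr p \<ge> m powr p + p * m powr (p - 1) * (a - m)"
proof -
  consider (m_zero) "m = 0" | (a_zero) "m > 0" "a = 0" | (pos) "m > 0" "a > 0"
    using assms by linarith
  then show ?thesis
  proof cases
    case a_zero
    have "m powr p = m powr (p - 1) * m" using a_zero by (simp add: powr_diff)
    then have "m powr p + p * m powr (p - 1) * (a - m) = (1 - p) * (m powr (p - 1) * m)"
      by (simp add: a_zero algebra_simps)
    also have "\<dots> \<le> 0" using assms by (intro mult_nonpos_nonneg) auto
    finally show ?thesis using a_zero by simp
  next
    case pos
    have "convex_on {0<..} (\<lambda>x. x powr p)" using assms by (intro powr_convex) auto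
    then have "a powr p - m powr p \<ge> (p * m powr (p - 1)) * (a - m)"
      using pos by (intro convex_on_imp_above_tangent[of "{0<..}"])
        (auto intro!: derivative_eq_intros simp: interior_open)
    then show ?thesis by simp
  qed (use assms in auto)
qed

lemma Jensen_powr:
  fixes F :: "'a \<Rightarrow> 'b::euclidean_space"
  assumes w: "integrable M w" "\<And>x. w x \<ge> 0" "integral\<^sup>L M w = 1"
    and F[measurable]: "F \<in> borel_measurable M" and p: "p > 1"
  shows "ennreal (norm (\<integral>x. w x *\<^sub>R F x \<partial>M) powr p) \<le> (\<integral>\<^sup>+x. ennreal (w x * norm (F x) powr p) \<partial>M)"
proof (cases "(\<integral>\<^sup>+x. ennreal (w x * norm (F x) powr p) \<partial>M) < \<infinity>")
  case True
  note [measurable] = borel_measurable_integrable[OF w(1)]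
  have powr_integrable: "integrable M (\<lambda>x. w x * norm (F x) powr p)"
    using True w by (intro integrableI_nonneg) auto
  have norm_integrable: "integrable M (\<lambda>x. w x * norm (F x))"
  proof (rule Bochner_Integration.integrable_bound)
    show "integrable M (\<lambda>x. w x + w x * norm (F x) powr p)" using w(1) powr_integrable by simp
    have "w x * norm (F x) \<le> w x * (1 + norm (F x) powr p)" for x
      using le_add_scaled_powr[of 1 "norm (F x)" p] p w(2) by (intro mult_left_mono) auto
    then show "AE x in M. norm (w x * norm (F x)) \<le> norm (w x + w x * norm (F x) powr p)"
      using w(2) by (simp add: distrib_left abs_of_nonneg)
  qed auto
  define m where "m = (\<integral>x. w x * norm (F x) \<partial>M)"
  have m_nonneg: "m \<ge> 0" unfolding m_def using w by (intro integral_nonneg_AE) auto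
  have "norm (\<integral>x. w x *\<^sub>R F x \<partial>M) \<le> m"
    using integral_norm_bound[of M "\<lambda>x. w x *\<^sub>R F x"] w(2) by (simp add: m_def)
  then have "norm (\<integral>x. w x *\<^sub>R F x \<partial>M) powr p \<le> m powr p" using p by (intro powr_mono2) auto
  also have "m powr p
      = (\<integral>x. m powr p * w x + p * m powr (p - 1) * (w x * norm (F x) - m * w x) \<partial>M)"
    using w norm_integrable by (simp add: m_def)
  also have "\<dots> \<le> (\<integral>x. w x * norm (F x) powr p \<partial>M)"
  proof (rule integral_mono)
    fix x
    have "w x * (m powr p + p * m powr (p - 1) * (norm (F x) - m)) \<le> w x * norm (F x) powr p"
      using w(2) m_nonneg p by (intro mult_left_mono powr_tangent) auto
    then show "m powr p * w x + p * m powr (p - 1) * (w x * norm (F x) - m * w x)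
        \<le> w x * norm (F x) powr p"
      by (simp add: algebra_simps)
  qed (use w norm_integrable powr_integrable in auto)
  finally show ?thesis
    using powr_integrable w by (simp add: nn_integral_eq_integral ennreal_leI)
qed (simp add: not_less top_unique)

section \<open>Convergence of mollifications\<close>

lemma mollifierD:
  assumes "mollifier a \<rho>"
  shows "\<rho> \<in> tensor_bumps a" "0 \<le> \<rho> x" "\<rho> \<in> borel_measurable borel"
  using assms tensor_bumps_measurable by (auto simp: mollifier_def)

lemma mollifier_nn_integral:
  assumes "mollifier a \<rho>"
  shows "(\<integral>\<^sup>+x. ennreal (\<rho> (x - y)) \<partial>lborel) = 1" "(\<integral>\<^sup>+y. ennreal (\<rho> (x - y)) \<partial>lborel) = 1"
proof -
  note [measurable] = mollifierD(3)[OF assms]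
  have "(\<integral>\<^sup>+x. ennreal (\<rho> x) \<partial>lborel) = 1"
    using assms tensor_bumps_integrable
    by (subst nn_integral_eq_integral) (auto simp: mollifier_def)
  then show "(\<integral>\<^sup>+x. ennreal (\<rho> (x - y)) \<partial>lborel) = 1" "(\<integral>\<^sup>+y. ennreal (\<rho> (x - y)) \<partial>lborel) = 1"
    using nn_integral_lborel_shift[of "\<lambda>x. ennreal (\<rho> x)" "- y"]
      nn_integral_lborel_reflect[of "\<lambda>x. ennreal (\<rho> x)" x] by simp_all
qed

lemma mollifier_reflect_integral:
  assumes "mollifier a \<rho>"
  shows "integrable lborel (\<lambda>y. \<rho> (x - y))" "(\<integral>y. \<rho> (x - y) \<partial>lborel) = 1"
proof -
  note [measurable] = mollifierD(3)[OF assms]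
  show "integrable lborel (\<lambda>y. \<rho> (x - y))"
    using mollifier_nn_integral(2)[OF assms] mollifierD(2)[OF assms]
    by (intro integrableI_nonneg) auto
  show "(\<integral>y. \<rho> (x - y) \<partial>lborel) = 1"
    using mollifier_nn_integral(2)[OF assms] mollifierD(2)[OF assms]
    by (subst integral_eq_nn_integral) auto
qed

lemma conv_measurable[measurable]:
  assumes [measurable]: "g \<in> borel_measurable borel" "f \<in> borel_measurable borel"
  shows "conv g f \<in> borel_measurable borel"
  unfolding conv_def[abs_def]
  by (rule lborel.borel_measurable_lebesgue_integral[of _ borel, simplified]) measurable

lemma conv_diff:
  assumes "g \<in> tensor_bumps a" "integrable lborel f" "integrable lborel k"
  shows "conv g (\<lambda>y. f y - k y) x = conv g f x - conv g k x"
  using conv_integrable[OF assms(1,2)] conv_integrable[OF assms(1,3)]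
  by (simp add: conv_def scaleR_diff_right)

lemma conv_sub_const:
  assumes "mollifier a \<rho>" "integrable lborel f"
  shows "conv \<rho> f x - c = (\<integral>y. \<rho> (x - y) *\<^sub>R (f y - c) \<partial>lborel)"
    "integrable lborel (\<lambda>y. \<rho> (x - y) *\<^sub>R (f y - c))"
  using conv_integrable[OF mollifierD(1)[OF assms(1)] assms(2), of x]
    mollifier_reflect_integral[OF assms(1), of x]
  by (simp_all add: scaleR_diff_right conv_def)

lemma conv_near:
  assumes \<rho>: "mollifier a \<rho>" and f: "integrable lborel f"
    and near: "\<And>y. dist x y < a \<Longrightarrow> norm (f y - c) \<le> t"
  shows "norm (conv \<rho> f x - c) \<le> t"
proof -
  have "norm (conv \<rho> f x - c) \<le> (\<integral>y. norm (\<rho> (x - y) *\<^sub>R (f y - c)) \<partial>lborel)"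
    unfolding conv_sub_const(1)[OF \<rho> f] by (rule integral_norm_bound)
  also have "\<dots> \<le> (\<integral>y. \<rho> (x - y) * t \<partial>lborel)"
  proof (rule integral_mono)
    fix y
    show "norm (\<rho> (x - y) *\<^sub>R (f y - c)) \<le> \<rho> (x - y) * t"
    proof (cases "dist x y < a")
      case True
      then show ?thesis using near mollifierD(2)[OF \<rho>, of "x - y"] by (simp add: mult_left_mono)
    next
      case False
      then have "\<rho> (x - y) = 0"
        by (intro vanishes_outsideD[OF tensor_bumps_vanishes_outside[OF mollifierD(1)[OF \<rho>]]])
           (use False in \<open>simp add: dist_norm norm_minus_commute[of y x]\<close>)
      then show ?thesis by simp
    qed
  qed (use integrable_norm[OF conv_sub_const(2)[OF \<rho> f]] mollifier_reflect_integral(1)[OF \<rho>] in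
    auto)
  also have "\<dots> = t" using mollifier_reflect_integral[OF \<rho>, of x] by simp
  finally show ?thesis .
qed

lemma Lpn_conv_le:
  fixes f :: "'a::euclidean_space \<Rightarrow> 'b::euclidean_space"
  assumes \<rho>: "mollifier a \<rho>" and f[measurable]: "f \<in> borel_measurable borel" and p: "p > 1"
  shows "Lpn p (conv \<rho> f) \<le> Lpn p f"
proof -
  note [measurable] = mollifierD(3)[OF \<rho>]
  have "ennreal (norm (conv \<rho> f x) powr p)
      \<le> (\<integral>\<^sup>+y. ennreal (\<rho> (x - y)) * ennreal (norm (f y) powr p) \<partial>lborel)" for x
    using Jensen_powr[OF mollifier_reflect_integral(1)[OF \<rho>] mollifierD(2)[OF \<rho>]
        mollifier_reflect_integral(2)[OF \<rho>], of f p x] p mollifierD(2)[OF \<rho>]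
    by (simp add: conv_def ennreal_mult)
  then have "Lpn p (conv \<rho> f)
      \<le> (\<integral>\<^sup>+x. \<integral>\<^sup>+y. ennreal (\<rho> (x - y)) * ennreal (norm (f y) powr p) \<partial>lborel \<partial>lborel)"
    unfolding Lpn_def by (intro nn_integral_mono)
  also have "\<dots> = (\<integral>\<^sup>+y. \<integral>\<^sup>+x. ennreal (\<rho> (x - y)) * ennreal (norm (f y) powr p) \<partial>lborel \<partial>lborel)"
    by (rule lborel_pair.Fubini') simp
  also have "\<dots> = Lpn p f"
    unfolding Lpn_def by (simp add: nn_integral_multc mollifier_nn_integral(1)[OF \<rho>])
  finally show ?thesis .
qed

lemma conv_tendsto_at_continuity:
  fixes f :: "'a::euclidean_space \<Rightarrow> 'b::euclidean_space"
  assumes \<rho>: "\<And>n. mollifier (a n) (\<rho> n)" and a: "a \<longlonglongrightarrow> 0"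
    and f: "integrable lborel f" "isCont f x"
  shows "(\<lambda>n. conv (\<rho> n) f x) \<longlonglongrightarrow> f x"
proof (rule tendstoI)
  fix e :: real assume "e > 0"
  then obtain d where d: "d > 0" "\<And>y. dist y x < d \<Longrightarrow> dist (f y) (f x) < e / 2"
    using f(2) unfolding continuous_at_eps_delta dist_norm by (metis half_gt_zero)
  have "\<forall>\<^sub>F n in sequentially. a n < d" using order_tendstoD(2)[OF a d(1)] .
  then show "\<forall>\<^sub>F n in sequentially. dist (conv (\<rho> n) f x) (f x) < e"
  proof eventually_elim
    fix n assume "a n < d"
    have "norm (conv (\<rho> n) f x - f x) \<le> e / 2"
    proof (rule conv_near[OF \<rho> f(1)])
      fix y assume "dist x y < a n"
      then have "dist (f y) (f x) < e / 2" using d(2)[of y] \<open>a n < d\<close> by (simp add: dist_commute)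
      then show "norm (f y - f x) \<le> e / 2" by (simp add: dist_norm)
    qed
    then show "dist (conv (\<rho> n) f x) (f x) < e"
      using \<open>e > 0\<close> by (simp add: dist_norm)
  qed
qed

lemma conv_tendsto_Lp_continuous:
  fixes g :: "'a::euclidean_space \<Rightarrow> 'b::euclidean_space"
  assumes \<rho>: "\<And>n. mollifier (a n) (\<rho> n)" and a: "a \<longlonglongrightarrow> 0"
    and g: "continuous_on UNIV g" "vanishes_outside (cball x0 R) g" and p: "p > 0"
  shows "Lp_tendsto p (\<lambda>n. conv (\<rho> n) g) g"
proof -
  obtain A where A: "\<And>n. a n \<le> A"
    using convergent_imp_Bseq[OF convergentI[OF a]] unfolding Bseq_def
    by (metis abs_le_D1 real_norm_def)
  obtain M where M: "\<And>x. norm (g x) \<le> M"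
    using compact_support_bounded[OF g(1) compact_cball g(2)] by blast
  have g_integrable: "integrable lborel g"
    by (rule compact_support_integrable[OF g(1) compact_cball g(2)])
  note [measurable] = borel_measurable_continuous_onI[OF g(1)] mollifierD(3)[OF \<rho>]
  let ?B = "cball x0 (R + \<bar>A\<bar>)"
  have "vanishes_outside ?B (conv (\<rho> n) g)" for n
  proof (rule vanishes_outside_mono[OF conv_vanishes_outside[OF mollifierD(1)[OF \<rho>] g(2)]])
    show "cball x0 (R + a n) \<subseteq> ?B" using A[of n] by (intro subset_cball) auto
  qed
  moreover have "vanishes_outside ?B g" by (rule vanishes_outside_mono[OF g(2)]) auto
  moreover have "norm (conv (\<rho> n) g x) \<le> M" for n x
    using conv_near[OF \<rho> g_integrable, where c = 0 and t = M] M by simp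
  moreover have "(\<lambda>n. conv (\<rho> n) g x) \<longlonglongrightarrow> g x" for x
    using g(1) by (intro conv_tendsto_at_continuity[OF \<rho> a g_integrable])
      (simp add: continuous_on_eq_continuous_at)
  ultimately show ?thesis
    using M p by (intro Lp_tendsto_bounded_support[of _ g ?B M]) auto
qed

lemma Lpn_conv_diff_self_le:
  fixes f g :: "'a::euclidean_space \<Rightarrow> 'b::euclidean_space"
  assumes \<rho>: "mollifier a \<rho>" and p: "p > 1"
    and f: "integrable lborel f" and g: "integrable lborel g"
  shows "Lpn p (\<lambda>x. conv \<rho> f x - f x) \<le> ennreal (2 powr p) * (Lpn p (\<lambda>x. f x - g x) +
    ennreal (2 powr p) * (Lpn p (\<lambda>x. conv \<rho> g x - g x) + Lpn p (\<lambda>x. f x - g x)))"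
proof -
  have [measurable]: "f \<in> borel_measurable borel" "g \<in> borel_measurable borel"
    using f g by (auto dest: borel_measurable_integrable)
  note [measurable] = mollifierD(3)[OF \<rho>]
  let ?c = "ennreal (2 powr p)"
  have "Lpn p (\<lambda>x. conv \<rho> f x - f x)
      \<le> ?c * (Lpn p (\<lambda>x. conv \<rho> f x - conv \<rho> g x) + Lpn p (\<lambda>x. conv \<rho> g x - f x))"
    using p by (intro Lpn_diff_trans) auto
  also have "\<dots> \<le> ?c * (Lpn p (\<lambda>x. f x - g x) +
      ?c * (Lpn p (\<lambda>x. conv \<rho> g x - g x) + Lpn p (\<lambda>x. g x - f x)))"
    using Lpn_conv_le[OF \<rho>, of "\<lambda>x. f x - g x" p] p
      conv_diff[OF mollifierD(1)[OF \<rho>] f g, abs_def, symmetric]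
    by (intro mult_left_mono add_mono Lpn_diff_trans) auto
  finally show ?thesis by (simp only: Lpn_minus_commute[of p g f])
qed

theorem conv_tendsto_Lp:
  fixes f :: "'a::euclidean_space \<Rightarrow> 'b::euclidean_space"
  assumes \<rho>: "\<And>n. mollifier (a n) (\<rho> n)" and a: "a \<longlonglongrightarrow> 0"
    and f[measurable]: "f \<in> borel_measurable borel" and finite: "Lpn p f < \<infinity>"
    and support: "vanishes_outside (cball x0 R) f" and p: "p > 1"
  shows "Lp_tendsto p (\<lambda>n. conv (\<rho> n) f) f"
  unfolding Lp_tendsto_def
proof (intro conjI allI f)
  note [measurable] = mollifierD(3)[OF \<rho>]
  show "conv (\<rho> n) f \<in> borel_measurable borel" for n by measurable
  have f_integrable: "integrable lborel f"
    using p by (intro integrable_of_Lpn[OF f finite support]) auto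
  show "(\<lambda>n. Lpn p (\<lambda>x. conv (\<rho> n) f x - f x)) \<longlonglongrightarrow> 0"
  proof (rule tendsto_ennreal_0I)
    fix e :: real assume e: "e > 0"
    define D :: real where "D = 2 powr p * (1 + 2 powr p * 2)"
    define e' where "e' = e / D"
    have D: "D > 0" unfolding D_def by (intro mult_pos_pos add_pos_pos) auto
    then have e': "e' > 0" using e by (simp add: e'_def)
    have "2 powr p * (e' + 2 powr p * (e' + e')) = D * e'" by (simp add: D_def algebra_simps)
    also have "\<dots> = e" using D by (simp add: e'_def)
    finally have e'_eq: "2 powr p * (e' + 2 powr p * (e' + e')) = e" .
    obtain g where g: "continuous_on UNIV g" "vanishes_outside (cball x0 (R + 1)) g"
      and fg: "Lpn p (\<lambda>x. f x - g x) < ennreal e'"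
      using Lp_continuous_approx[OF f finite support _ e'] p by auto
    have g_integrable: "integrable lborel g"
      by (rule compact_support_integrable[OF g(1) compact_cball g(2)])
    have "Lp_tendsto p (\<lambda>n. conv (\<rho> n) g) g"
      using p by (intro conv_tendsto_Lp_continuous[OF \<rho> a g]) auto
    from Lp_tendsto_eventually_Lpn_less[OF this e']
    show "\<forall>\<^sub>F n in sequentially. Lpn p (\<lambda>x. conv (\<rho> n) f x - f x) \<le> ennreal e"
    proof eventually_elim
      case (elim n)
      have "Lpn p (\<lambda>x. conv (\<rho> n) f x - f x)
          \<le> ennreal (2 powr p) * (ennreal e' + ennreal (2 powr p) * (ennreal e' + ennreal e'))"
        using elim fg
        by (intro order_trans[OF Lpn_conv_diff_self_le[OF \<rho> p f_integrable g_integrable]]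
            mult_left_mono add_mono) auto
      also have "\<dots> = ennreal (2 powr p * (e' + 2 powr p * (e' + e')))"
        using e' by (simp add: ennreal_plus[symmetric] ennreal_mult[symmetric] del: ennreal_plus)
      finally show ?case by (simp only: e'_eq)
    qed
  qed
qed

section \<open>Weak gradients\<close>

lemma lebesgue_eq_lborel:
  fixes F :: "'a::euclidean_space \<Rightarrow> 'b::euclidean_space"
  assumes "F \<in> borel_measurable borel" "vanishes_outside U F"
  shows "set_integrable lebesgue U F \<longleftrightarrow> integrable lborel F"
    "(LINT x:U|lebesgue. F x) = (\<integral>x. F x \<partial>lborel)"
    "set_borel_measurable lebesgue U F"
proof -
  have extended: "(\<lambda>x. indicator U x *\<^sub>R F x) = F"
    using vanishes_outsideD[OF assms(2)] by (auto simp: indicator_def)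
  have F: "F \<in> borel_measurable lborel" using assms by simp
  show "set_integrable lebesgue U F \<longleftrightarrow> integrable lborel F"
    unfolding set_integrable_def extended by (rule integrable_completion[OF F])
  show "(LINT x:U|lebesgue. F x) = (\<integral>x. F x \<partial>lborel)"
    unfolding set_lebesgue_integral_def extended by (rule integral_completion[OF F])
  show "set_borel_measurable lebesgue U F"
    unfolding set_borel_measurable_def extended using F by (rule measurable_completion)
qed

lemma smooth_fun_measurable:
  assumes "smooth_fun \<phi>" "i \<in> Basis"
  shows "\<phi> \<in> borel_measurable borel" "partial \<phi> i \<in> borel_measurable borel"
  using smooth_funD(1,2)[OF assms] by (auto intro: borel_measurable_continuous_onI)

lemma weak_grad_integration_by_parts:
  assumes "weak_grad U u g" "test_fun U \<phi>" "i \<in> Basis"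
    and [measurable]: "u \<in> borel_measurable borel" "g \<in> borel_measurable borel"
  shows "(\<integral>x. u x * partial \<phi> i x \<partial>lborel) = - (\<integral>x. (g x \<bullet> i) * \<phi> x \<partial>lborel)"
proof -
  have "smooth_fun \<phi>" using assms(2) by (simp add: test_fun_def)
  note [measurable] = smooth_fun_measurable[OF this assms(3)]
  have "vanishes_outside U (\<lambda>x. u x * partial \<phi> i x)" "vanishes_outside U (\<lambda>x. (g x \<bullet> i) * \<phi> x)"
    using test_fun_vanishes_outside[OF assms(2)] by (auto simp: vanishes_outside_def)
  then have "(\<integral>x. u x * partial \<phi> i x \<partial>lborel) = (LINT x:U|lebesgue. u x * partial \<phi> i x)"
    "(\<integral>x. (g x \<bullet> i) * \<phi> x \<partial>lborel) = (LINT x:U|lebesgue. (g x \<bullet> i) * \<phi> x)"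
    by (intro lebesgue_eq_lborel(2)[symmetric]; simp)+
  moreover have "(LINT x:U|lebesgue. u x * partial \<phi> i x) = - (LINT x:U|lebesgue. (g x \<bullet> i) * \<phi> x)"
    using assms(1-3) unfolding weak_grad_def by blast
  ultimately show ?thesis by simp
qed

lemma conv_grad_eq_conv_weak_grad:
  assumes weak: "weak_grad U u g" and u: "integrable lborel u" and g: "integrable lborel g"
    and \<rho>: "\<rho> \<in> tensor_bumps a" and x: "cball x a \<subseteq> U"
  shows "conv_grad (sgrad \<rho>) u x = conv \<rho> g x"
proof (rule euclidean_eqI)
  fix i :: 'a assume i: "i \<in> Basis"
  have "(\<integral>y. u y * partial (\<lambda>y. \<rho> (x - y)) i y \<partial>lborel) = - (\<integral>y. (g y \<bullet> i) * \<rho> (x - y) \<partial>lborel)"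
    using borel_measurable_integrable[OF u] borel_measurable_integrable[OF g]
    by (intro weak_grad_integration_by_parts[OF weak test_fun_reflect[OF \<rho> x] i]) simp_all
  then have "(\<integral>y. partial \<rho> i (x - y) * u y \<partial>lborel) = (\<integral>y. (\<rho> (x - y) *\<^sub>R g y) \<bullet> i \<partial>lborel)"
    by (simp add: C1_grad_partial[OF C1_grad_reflect[OF tensor_bumps_C1_grad(1)[OF \<rho>]]]
        sgrad_inner_Basis[OF i] mult.commute)
  also have "\<dots> = conv \<rho> g x \<bullet> i"
    unfolding conv_def by (rule integral_inner_left) (use conv_integrable[OF \<rho> g] in auto)
  finally show "conv_grad (sgrad \<rho>) u x \<bullet> i = conv \<rho> g x \<bullet> i"
    by (simp add: conv_grad_inner_Basis[OF \<rho> u i] conv_def[of "partial \<rho> i"])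
qed

lemma integral_lborel_shift:
  fixes F :: "'a::euclidean_space \<Rightarrow> real"
  assumes [measurable]: "F \<in> borel_measurable borel"
  shows "(\<integral>x. F (c + x) \<partial>lborel) = (\<integral>x. F x \<partial>lborel)"
  by (subst (2) lborel_distr_plus[of c, symmetric]) (simp add: integral_distr)

lemma integrable_lborel_shift:
  fixes F :: "'a::euclidean_space \<Rightarrow> real"
  assumes "integrable lborel F"
  shows "integrable lborel (\<lambda>x. F (c + x))"
proof -
  have "integrable (distr lborel borel ((+) c)) F" using assms by (simp add: lborel_distr_plus)
  then show ?thesis by (subst (asm) integrable_distr_eq) (use assms in auto)
qed

lemma line_derivative_bound:
  fixes F :: "'a::real_normed_vector \<Rightarrow> real"
  assumes derivative: "\<And>x. ((\<lambda>t. F (x + t *\<^sub>R v)) has_real_derivative P x) (at 0)"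
    and bound: "\<And>x. \<bar>P x\<bar> \<le> M" and "h > 0"
  shows "\<bar>F (x + h *\<^sub>R v) - F x\<bar> \<le> M * h"
proof -
  have "((\<lambda>t. F (x + t *\<^sub>R v)) has_real_derivative P (x + t *\<^sub>R v)) (at t)" for t
    using derivative[of "x + t *\<^sub>R v"] DERIV_shift[of "\<lambda>s. F (x + s *\<^sub>R v)" _ 0 t]
    by (simp add: scaleR_add_left algebra_simps)
  then obtain t where "F (x + h *\<^sub>R v) - F (x + 0 *\<^sub>R v) = (h - 0) * P (x + t *\<^sub>R v)"
    using MVT2[of 0 h "\<lambda>t. F (x + t *\<^sub>R v)" "\<lambda>t. P (x + t *\<^sub>R v)"] \<open>h > 0\<close> by blast
  then show ?thesis using bound[of "x + t *\<^sub>R v"] \<open>h > 0\<close> by (simp add: abs_mult mult.commute)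
qed

lemma inverse_Suc_tendsto_0: "(\<lambda>n. 1 / (real n + 1)) \<longlonglongrightarrow> 0"
  using LIMSEQ_Suc[OF lim_1_over_n[where 'a=real]] by (simp add: add.commute)

lemma difference_quotient_vanishes_outside:
  assumes F: "vanishes_outside (cball x0 R) F" and v: "norm v = 1" and h: "0 < h" "h \<le> 1"
  shows "vanishes_outside (cball x0 (R + 1)) (\<lambda>x. (F (h *\<^sub>R v + x) - F x) / h)"
  unfolding vanishes_outside_def
proof (intro allI impI)
  fix x assume x: "x \<notin> cball x0 (R + 1)"
  have "dist x0 x \<le> dist x0 (h *\<^sub>R v + x) + h"
    using dist_triangle[of x0 x "h *\<^sub>R v + x"] v h(1) by (simp add: dist_norm)
  then have "F (h *\<^sub>R v + x) = 0" "F x = 0"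
    using x h(2) by (auto intro!: vanishes_outsideD[OF F])
  then show "(F (h *\<^sub>R v + x) - F x) / h = 0" by simp
qed

lemma difference_quotient_integral:
  fixes F :: "'a::euclidean_space \<Rightarrow> real"
  assumes "integrable lborel F"
  shows "integrable lborel (\<lambda>x. (F (v + x) - F x) / h)" "(\<integral>x. (F (v + x) - F x) / h \<partial>lborel) = 0"
  using assms integrable_lborel_shift[OF assms] integral_lborel_shift[of F] by auto

lemma integral_partial_zero:
  fixes F :: "'a::euclidean_space \<Rightarrow> real"
  assumes F: "continuous_on UNIV F" "vanishes_outside (cball x0 R) F"
    and derivative: "\<And>x. ((\<lambda>t. F (x + t *\<^sub>R v)) has_real_derivative P x) (at 0)"
    and P: "continuous_on UNIV P" and v: "norm v = 1"
  shows "(\<integral>x. P x \<partial>lborel) = 0"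
proof -
  note [measurable] = borel_measurable_continuous_onI[OF F(1)] borel_measurable_continuous_onI[OF P]
  have P_support: "vanishes_outside (cball x0 R) P"
    unfolding vanishes_outside_def
    using DERIV_unique[OF derivative line_derivative_zero_outside[OF closed_cball F(2)]] by blast
  obtain M where M: "\<And>x. \<bar>P x\<bar> \<le> M"
    using compact_support_bounded[OF P compact_cball P_support] by (metis real_norm_def)
  define h where "h n = 1 / (real n + 1)" for n
  have h: "h n > 0" "h n \<le> 1" for n by (auto simp: h_def)
  have h_tendsto: "filterlim h (at 0) sequentially"
    using inverse_Suc_tendsto_0 h
    by (intro filterlim_atI) (auto simp: less_imp_neq[symmetric] h_def[abs_def])
  define Q where "Q n x = (F (h n *\<^sub>R v + x) - F x) / h n" for n x
  have Q[measurable]: "Q n \<in> borel_measurable borel" for n unfolding Q_def[abs_def] by simp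
  note Q_integral = difference_quotient_integral[OF
    compact_support_integrable[OF F(1) compact_cball F(2)],
      of "h n *\<^sub>R v" "h n" for n, folded Q_def]
  have Q_support: "vanishes_outside (cball x0 (R + 1)) (Q n)" for n
    unfolding Q_def[abs_def] by (rule difference_quotient_vanishes_outside[OF F(2) v h])
  have Q_le: "\<bar>Q n x\<bar> \<le> M" for n x
    using line_derivative_bound[OF derivative M h(1)[of n], of x] h(1)[of n]
    by (simp add: Q_def add.commute divide_le_eq)
  have P_support': "vanishes_outside (cball x0 (R + 1)) P"
    by (rule vanishes_outside_mono[OF P_support]) auto
  have "(\<lambda>n. Q n x) \<longlonglongrightarrow> P x" for x
    using filterlim_compose[OF derivative[of x, unfolded DERIV_def] h_tendsto]
    by (simp add: Q_def add.commute)
  then have "Lp_tendsto 1 Q P"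
    using Q_support P_support' M Q_le
    by (intro Lp_tendsto_bounded_support[of Q P "cball x0 (R + 1)" M]) auto
  from Lp_tendsto_integral_mult[OF this compact_cball _ Q_support P_support' Q_integral(1)
      compact_support_integrable[OF P compact_cball P_support], of "\<lambda>_. 1"]
  show ?thesis by (simp add: Q_integral LIMSEQ_const_iff)
qed

lemma C1_grad_integration_by_parts:
  fixes f :: "'a::euclidean_space \<Rightarrow> real"
  assumes f: "C1_grad f D" "vanishes_outside C f" "compact C" and \<phi>: "smooth_fun \<phi>"
      and i: "i \<in> Basis"
  shows "(\<integral>x. f x * partial \<phi> i x \<partial>lborel) = - (\<integral>x. (D x \<bullet> i) * \<phi> x \<partial>lborel)"
proof -
  note continuous = smooth_funD(1,2)[OF \<phi> i] C1_grad_continuous[OF f(1), of UNIV]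
  have D: "vanishes_outside C D"
    by (rule C1_grad_vanishes_outside[OF f(1) compact_imp_closed[OF f(3)] f(2)])
  obtain R where "\<forall>x\<in>C. norm x \<le> R"
    using compact_imp_bounded[OF f(3)] unfolding bounded_iff by blast
  then have R: "C \<subseteq> cball 0 R" by auto
  have "(\<integral>x. f x * partial \<phi> i x + (D x \<bullet> i) * \<phi> x \<partial>lborel) = 0"
  proof (rule integral_partial_zero[of "\<lambda>x. f x * \<phi> x" 0 R i])
    show "vanishes_outside (cball 0 R) (\<lambda>x. f x * \<phi> x)"
      using vanishes_outside_mono[OF f(2) R] by (simp add: vanishes_outside_def)
    show "((\<lambda>t. f (x + t *\<^sub>R i) * \<phi> (x + t *\<^sub>R i)) has_real_derivative
        f x * partial \<phi> i x + D x \<bullet> i * \<phi> x) (at 0)" for x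
      using DERIV_mult[OF C1_grad_line[OF f(1), of x i 0 UNIV] smooth_funD(3)[OF \<phi> i, of x]]
      by (simp add: algebra_simps)
  qed (use continuous i in \<open>auto intro!: continuous_intros\<close>)
  moreover have "integrable lborel (\<lambda>x. f x * partial \<phi> i x)"
    using continuous vanishes_outsideD[OF f(2)]
    by (intro compact_support_integrable[OF _ f(3)])
       (auto simp: vanishes_outside_def intro!: continuous_intros)
  moreover have "integrable lborel (\<lambda>x. (D x \<bullet> i) * \<phi> x)"
    using continuous vanishes_outsideD[OF D]
    by (intro compact_support_integrable[OF _ f(3)])
       (auto simp: vanishes_outside_def intro!: continuous_intros)
  ultimately show ?thesis by simp
qed

section \<open>Limits of compactly supported C1 functions\<close>

definition W1p_approx ::
  "real \<Rightarrow> 'a::euclidean_space set \<Rightarrow> ('a \<Rightarrow> real) \<Rightarrow> ('a \<Rightarrow> 'a) \<Rightarrow> bool" where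
  "W1p_approx p S f G \<longleftrightarrow> (\<exists>h D. (\<forall>n. C1_grad (h n) (D n) \<and> vanishes_outside S (h n)) \<and>
     Lp_tendsto p h f \<and> Lp_tendsto p D G)"

lemma W1p_approxI:
  assumes "\<And>n. C1_grad (h n) (D n)" "\<And>n. vanishes_outside S (h n)"
    "Lp_tendsto p h f" "Lp_tendsto p D G"
  shows "W1p_approx p S f G"
  using assms unfolding W1p_approx_def by blast

lemma W1p_approxE:
  assumes "W1p_approx p S f G"
  obtains h D where "\<And>n. C1_grad (h n) (D n)" "\<And>n. vanishes_outside S (h n)"
    "Lp_tendsto p h f" "Lp_tendsto p D G"
  using assms unfolding W1p_approx_def by blast

lemma W1p_approx_measurable:
  assumes "W1p_approx p S f G"
  shows "f \<in> borel_measurable borel" "G \<in> borel_measurable borel"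
  using assms by (auto elim!: W1p_approxE dest: Lp_tendstoD(2))

lemma W1p_approx_C1_grad: "C1_grad h D \<Longrightarrow> vanishes_outside S h \<Longrightarrow> W1p_approx p S h D"
  by (rule W1p_approxI[where h = "\<lambda>_. h" and D = "\<lambda>_. D"])
     (auto intro: Lp_tendsto_const C1_grad_measurable)

lemma W1p_approx_Lpn_finite:
  assumes "W1p_approx p S f G" "compact S" "p > 0"
  shows "Lpn p f < \<infinity>" "Lpn p G < \<infinity>"
proof -
  obtain h D where h: "\<And>n. C1_grad (h n) (D n)" "\<And>n. vanishes_outside S (h n)"
    "Lp_tendsto p h f" "Lp_tendsto p D G" using W1p_approxE[OF assms(1)] by metis
  have "Lpn p (h n) < \<infinity>" for n
    by (rule Lpn_finite_of_compact_support[OF C1_grad_continuous(1)[OF h(1)] assms(2) h(2)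
      assms(3)])
  from Lp_tendsto_Lpn_finite[OF h(3) assms(3) this] show "Lpn p f < \<infinity>" .
  have "vanishes_outside S (D n)" for n
    by (rule C1_grad_vanishes_outside[OF h(1) compact_imp_closed[OF assms(2)] h(2)])
  then have "Lpn p (D n) < \<infinity>" for n
    by (rule Lpn_finite_of_compact_support[OF C1_grad_continuous(2)[OF h(1)] assms(2) _ assms(3)])
  from Lp_tendsto_Lpn_finite[OF h(4) assms(3) this] show "Lpn p G < \<infinity>" .
qed

lemma ennreal_tendsto_0_less_inverse_Suc:
  assumes "\<And>n. X n < ennreal (1 / (real n + 1))"
  shows "X \<longlonglongrightarrow> 0"
proof (rule tendsto_sandwich[OF _ _ tendsto_const])
  show "\<forall>\<^sub>F n in sequentially. X n \<le> ennreal (1 / (real n + 1))"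
    using assms by (intro always_eventually) (auto intro: less_imp_le)
  show "(\<lambda>n. ennreal (1 / (real n + 1))) \<longlonglongrightarrow> 0"
    using inverse_Suc_tendsto_0 by (simp add: ennreal_tendsto_0_iff)
qed auto

lemma W1p_approx_closed:
  assumes approx: "\<And>n. W1p_approx p S (f n) (G n)" and p: "p > 0"
    and lim: "Lp_tendsto p f f'" "Lp_tendsto p G G'"
  shows "W1p_approx p S f' G'"
proof -
  define near where "near n h D \<longleftrightarrow> C1_grad h D \<and> vanishes_outside S h \<and>
      Lpn p (\<lambda>x. h x - f n x) < ennreal (1 / (real n + 1)) \<and>
      Lpn p (\<lambda>x. D x - G n x) < ennreal (1 / (real n + 1))" for n h D
  have "\<exists>h D. near n h D" for n
  proof -
    obtain h D where h: "\<And>m. C1_grad (h m) (D m)" "\<And>m. vanishes_outside S (h m)"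
      "Lp_tendsto p h (f n)" "Lp_tendsto p D (G n)" using W1p_approxE[OF approx] by metis
    have "\<forall>\<^sub>F m in sequentially. Lpn p (\<lambda>x. h m x - f n x) < ennreal (1 / (real n + 1))
      \<and> Lpn p (\<lambda>x. D m x - G n x) < ennreal (1 / (real n + 1))"
      by (intro eventually_conj Lp_tendsto_eventually_Lpn_less h) auto
    from eventually_happens'[OF sequentially_bot this] show ?thesis
      using h(1,2) unfolding near_def by blast
  qed
  then obtain h D where "\<And>n. near n (h n) (D n)" by metis
  then have h: "\<And>n. C1_grad (h n) (D n)" "\<And>n. vanishes_outside S (h n)"
    "\<And>n. Lpn p (\<lambda>x. h n x - f n x) < ennreal (1 / (real n + 1))"
    "\<And>n. Lpn p (\<lambda>x. D n x - G n x) < ennreal (1 / (real n + 1))" by (simp_all add: near_def)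
  have "Lp_tendsto p h f'" "Lp_tendsto p D G'"
    using C1_grad_measurable[OF h(1)] ennreal_tendsto_0_less_inverse_Suc[OF h(3)]
      ennreal_tendsto_0_less_inverse_Suc[OF h(4)] p
    by (auto intro!: Lp_tendsto_trans[OF lim(1)] Lp_tendsto_trans[OF lim(2)])
  then show ?thesis by (rule W1p_approxI[OF h(1,2)])
qed

lemma W1p_approx_integrable:
  assumes "W1p_approx p S f G" "compact S" "p \<ge> 1" "vanishes_outside S f" "vanishes_outside S G"
  shows "integrable lborel f" "integrable lborel G"
proof -
  have "S \<in> sets borel" "bounded S"
    using assms(2) by (auto intro: borel_compact compact_imp_bounded)
  then show "integrable lborel f" "integrable lborel G"
    using W1p_approx_Lpn_finite[OF assms(1,2)] W1p_approx_measurable[OF assms(1)] assms(3-5)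
    by (auto intro: integrable_of_Lpn)
qed

lemma W1p_approx_integration_by_parts:
  assumes approx: "W1p_approx p S f G" and S: "compact S" and p: "p \<ge> 1"
    and support: "vanishes_outside S f" "vanishes_outside S G"
    and smooth: "smooth_fun \<phi>" and i: "i \<in> Basis"
  shows "(\<integral>x. f x * partial \<phi> i x \<partial>lborel) = - (\<integral>x. (G x \<bullet> i) * \<phi> x \<partial>lborel)"
proof -
  note continuous = smooth_funD(1,2)[OF smooth i]
  note [measurable] = W1p_approx_measurable[OF approx]
  note integrable = W1p_approx_integrable[OF approx S p support]
  obtain h D where h: "\<And>n. C1_grad (h n) (D n)" "\<And>n. vanishes_outside S (h n)"
    "Lp_tendsto p h f" "Lp_tendsto p D G" using W1p_approxE[OF approx] by metis
  have D: "vanishes_outside S (D n)" for n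
    by (rule C1_grad_vanishes_outside[OF h(1) compact_imp_closed[OF S] h(2)])
  have lim_h: "(\<lambda>n. \<integral>x. h n x * partial \<phi> i x \<partial>lborel) \<longlonglongrightarrow> (\<integral>x. f x * partial \<phi> i x \<partial>lborel)"
    using p by (intro Lp_tendsto_integral_mult[OF h(3) S] h(2) support(1) integrable(1) continuous
        compact_support_integrable[OF C1_grad_continuous(1)[OF h(1)] S]) auto
  have lim_D: "(\<lambda>n. \<integral>x. (D n x \<bullet> i) * \<phi> x \<partial>lborel) \<longlonglongrightarrow> (\<integral>x. (G x \<bullet> i) * \<phi> x \<partial>lborel)"
  proof (intro Lp_tendsto_integral_mult[OF _ S] continuous)
    note [measurable] = C1_grad_measurable[OF h(1)]
    show "Lp_tendsto p (\<lambda>n x. D n x \<bullet> i) (\<lambda>x. G x \<bullet> i)"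
      using p Basis_le_norm[OF i]
      by (intro Lp_tendsto_Lipschitz[OF h(4), where M = 1]) (auto simp flip: inner_diff_left)
    show "integrable lborel (\<lambda>x. D n x \<bullet> i)" for n
      using compact_support_integrable[OF C1_grad_continuous(2)[OF h(1)] S D] by auto
    show "vanishes_outside S (\<lambda>x. D n x \<bullet> i)" "vanishes_outside S (\<lambda>x. G x \<bullet> i)" for n
      using D[of n] support(2) by (simp_all add: vanishes_outside_def)
  qed (use p integrable in auto)
  have "(\<integral>x. h n x * partial \<phi> i x \<partial>lborel) = - (\<integral>x. (D n x \<bullet> i) * \<phi> x \<partial>lborel)" for n
    by (rule C1_grad_integration_by_parts[OF h(1) h(2) S smooth i])
  then show ?thesis using LIMSEQ_unique[OF lim_h] tendsto_minus[OF lim_D] by simp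
qed

lemma W1p_approx_weak_grad:
  assumes approx: "W1p_approx p S f G" and S: "compact S" "S \<subseteq> U" and p: "p \<ge> 1"
    and support: "vanishes_outside S f" "vanishes_outside S G"
  shows "weak_grad U f G"
  unfolding weak_grad_def
proof (intro allI impI ballI)
  fix \<phi> and i :: 'a assume "test_fun U \<phi>" and i: "i \<in> Basis"
  then have smooth: "smooth_fun \<phi>" by (simp add: test_fun_def)
  note continuous = smooth_funD(1,2)[OF smooth i]
  note [measurable] = smooth_fun_measurable[OF smooth i] W1p_approx_measurable[OF approx]
  have "vanishes_outside S (\<lambda>x. G x \<bullet> i)" using support(2) by (simp add: vanishes_outside_def)
  then have "integrable lborel (\<lambda>x. f x * partial \<phi> i x)" "integrable lborel (\<lambda>x. (G x \<bullet> i) * \<phi> x)"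
    using W1p_approx_integrable[OF approx S(1) p support]
    by (auto intro!: integrable_mult_continuous[OF _ S(1)] support(1) continuous)
  moreover have "vanishes_outside U (\<lambda>x. f x * partial \<phi> i x)"
    "vanishes_outside U (\<lambda>x. (G x \<bullet> i) * \<phi> x)"
    using vanishes_outside_mono[OF support(1) S(2)] vanishes_outside_mono[OF support(2) S(2)]
    by (simp_all add: vanishes_outside_def)
  ultimately show "set_integrable lebesgue U (\<lambda>x. f x * partial \<phi> i x)
      \<and> set_integrable lebesgue U (\<lambda>x. G x \<bullet> i * \<phi> x)
      \<and> (LINT x:U|lebesgue. f x * partial \<phi> i x) = - (LINT x:U|lebesgue. G x \<bullet> i * \<phi> x)"
    using W1p_approx_integration_by_parts[OF approx S(1) p support smooth i]
      lebesgue_eq_lborel[of "\<lambda>x. f x * partial \<phi> i x" U]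
      lebesgue_eq_lborel[of "\<lambda>x. (G x \<bullet> i) * \<phi> x" U] by simp
qed

section \<open>Truncation of weakly differentiable functions\<close>

text \<open>A function in \<open>W\<^sup>1\<^sup>,\<^sup>p\<close> of the open ball, extended by zero.\<close>
definition W1p_ball ::
  "real \<Rightarrow> 'a::euclidean_space \<Rightarrow> real \<Rightarrow> ('a \<Rightarrow> real) \<Rightarrow> ('a \<Rightarrow> 'a) \<Rightarrow> bool" where
  "W1p_ball p x0 R u g \<longleftrightarrow>
     u \<in> borel_measurable borel \<and> Lpn p u < \<infinity> \<and> vanishes_outside (cball x0 R) u \<and>
     g \<in> borel_measurable borel \<and> Lpn p g < \<infinity> \<and> vanishes_outside (cball x0 R) g \<and>
     weak_grad (ball x0 R) u g"

lemma mollifier_sequence_exists: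
  assumes "d > 0"
  obtains a and \<rho> :: "nat \<Rightarrow> 'a::euclidean_space \<Rightarrow> real"
    where "\<And>n. mollifier (a n) (\<rho> n)" "\<And>n. a n < d" "a \<longlonglongrightarrow> 0"
proof -
  define a where "a n = d / 2 * (1 / (real n + 1))" for n
  have a: "0 < a n" "a n < d" for n
    using assms by (auto simp: a_def field_simps add_pos_nonneg)
  have "\<exists>\<rho>. mollifier (a n) (\<rho> :: 'a \<Rightarrow> real)" for n using mollifier_exists[OF a(1)] by metis
  then obtain \<rho> :: "nat \<Rightarrow> 'a \<Rightarrow> real" where "\<And>n. mollifier (a n) (\<rho> n)" by metis
  moreover have "a \<longlonglongrightarrow> 0"
    unfolding a_def[abs_def] by (intro tendsto_mult_right_zero inverse_Suc_tendsto_0)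
  ultimately show ?thesis using a(2) that by blast
qed

lemma conv_C1_approx:
  assumes u: "u \<in> borel_measurable borel" "Lpn p u < \<infinity>" "vanishes_outside (cball x0 R) u"
    and g: "g \<in> borel_measurable borel" "Lpn p g < \<infinity>" "vanishes_outside (cball x0 R) g"
    and weak: "weak_grad U u g" and d: "d > 0" and p: "p > 1"
  obtains a \<rho> where "\<And>n. mollifier (a n) (\<rho> n)" "\<And>n. a n < d"
    "\<And>n. C1_grad (conv (\<rho> n) u) (sgrad (conv (\<rho> n) u))"
    "\<And>n x. cball x (a n) \<subseteq> U \<Longrightarrow> sgrad (conv (\<rho> n) u) x = conv (\<rho> n) g x"
    "Lp_tendsto p (\<lambda>n. conv (\<rho> n) u) u" "Lp_tendsto p (\<lambda>n. conv (\<rho> n) g) g"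
proof -
  obtain a and \<rho> :: "nat \<Rightarrow> 'a \<Rightarrow> real" where \<rho>: "\<And>n. mollifier (a n) (\<rho> n)" "\<And>n. a n < d" "a \<longlonglongrightarrow> 0"
    using mollifier_sequence_exists[OF d, where 'a = 'a] by blast
  have integrable: "integrable lborel u" "integrable lborel g"
    using p by (auto intro!: integrable_of_Lpn[OF u] integrable_of_Lpn[OF g])
  note C1 = conv_C1_grad[OF mollifierD(1)[OF \<rho>(1)] integrable(1)]
  have "C1_grad (conv (\<rho> n) u) (sgrad (conv (\<rho> n) u))" for n
    using C1 by (simp add: C1_grad_sgrad[OF C1])
  moreover have "sgrad (conv (\<rho> n) u) x = conv (\<rho> n) g x" if "cball x (a n) \<subseteq> U" for n x
    unfolding C1_grad_sgrad[OF C1]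
    by (rule conv_grad_eq_conv_weak_grad[OF weak integrable mollifierD(1)[OF \<rho>(1)] that])
  ultimately show ?thesis
    by (rule that[OF \<rho>(1,2) _ _ conv_tendsto_Lp[OF \<rho>(1,3) u p] conv_tendsto_Lp[OF \<rho>(1,3) g p]])
qed

lemma W1p_ball_C1_approx:
  assumes ball: "W1p_ball p x0 R u g" and \<sigma>: "\<sigma> < R" and p: "p > 1"
  obtains v \<gamma> where "\<And>n. C1_grad (v n) (sgrad (v n))"
    "\<And>n x. x \<in> cball x0 \<sigma> \<Longrightarrow> sgrad (v n) x = \<gamma> n x"
    "Lp_tendsto p v u" "Lp_tendsto p \<gamma> g" "AE x in lborel. (\<lambda>n. v n x) \<longlonglongrightarrow> u x"
proof -
  have u: "u \<in> borel_measurable borel" "Lpn p u < \<infinity>" "vanishes_outside (cball x0 R) u"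
    and g: "g \<in> borel_measurable borel" "Lpn p g < \<infinity>" "vanishes_outside (cball x0 R) g"
    and weak: "weak_grad (ball x0 R) u g" using ball by (auto simp: W1p_ball_def)
  obtain a \<rho> where \<rho>: "\<And>n. mollifier (a n) (\<rho> n)" "\<And>n. a n < R - \<sigma>"
    "\<And>n. C1_grad (conv (\<rho> n) u) (sgrad (conv (\<rho> n) u))"
    "\<And>n x. cball x (a n) \<subseteq> ball x0 R \<Longrightarrow> sgrad (conv (\<rho> n) u) x = conv (\<rho> n) g x"
    "Lp_tendsto p (\<lambda>n. conv (\<rho> n) u) u" "Lp_tendsto p (\<lambda>n. conv (\<rho> n) g) g"
    by (rule conv_C1_approx[OF u g weak _ p, of "R - \<sigma>"]) (use \<sigma> in auto)
  note [measurable] = u(1) mollifierD(3)[OF \<rho>(1)]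
  have "Lpn p (\<lambda>x. conv (\<rho> n) u x - u x) < \<infinity>" for n
  proof (rule le_less_trans)
    show "Lpn p (\<lambda>x. conv (\<rho> n) u x - u x)
        \<le> ennreal (2 powr p) * (Lpn p (conv (\<rho> n) u) + Lpn p (\<lambda>x. - u x))"
      using Lpn_add[of "conv (\<rho> n) u" "\<lambda>x. - u x" p] p by simp
    show "\<dots> < \<infinity>"
      using le_less_trans[OF Lpn_conv_le[OF \<rho>(1) u(1) p] u(2)] u(2)
      by (simp add: Lpn_def ennreal_mult_less_top)
  qed
  from Lp_tendsto_AE_subseq[OF \<rho>(5) _ this]
  obtain r where r: "strict_mono r" "AE x in lborel. (\<lambda>n. conv (\<rho> (r n)) u x) \<longlonglongrightarrow> u x"
    using p by auto
  have "sgrad (conv (\<rho> n) u) x = conv (\<rho> n) g x" if "x \<in> cball x0 \<sigma>" for n x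
  proof (rule \<rho>(4), rule subsetI)
    fix y assume "y \<in> cball x (a n)"
    then show "y \<in> ball x0 R" using that \<rho>(2)[of n] dist_triangle[of x0 y x] by auto
  qed
  with \<rho>(3) show ?thesis
    by (intro that[of "\<lambda>n. conv (\<rho> (r n)) u" "\<lambda>n. conv (\<rho> (r n)) g"]
        Lp_tendsto_subseq[OF \<rho>(5) r(1)] Lp_tendsto_subseq[OF \<rho>(6) r(1)] r(2))
qed

lemma Lp_tendsto_Lipschitz_compose:
  fixes W :: "'a::euclidean_space \<Rightarrow> 'b::euclidean_space"
  assumes v: "Lp_tendsto p v u" and p: "p > 0"
    and F: "F \<in> borel_measurable borel" "\<And>s t. \<bar>F s - F t\<bar> \<le> \<bar>s - t\<bar>"
    and W: "W \<in> borel_measurable borel" "\<And>x. norm (W x) \<le> M"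
  shows "Lp_tendsto p (\<lambda>n x. F (v n x) *\<^sub>R W x) (\<lambda>x. F (u x) *\<^sub>R W x)"
proof -
  note [measurable] = Lp_tendstoD(1,2)[OF v] F(1) W(1)
  have "norm (F (v n x) *\<^sub>R W x - F (u x) *\<^sub>R W x) \<le> M * norm (v n x - u x)" for n x
    using mult_mono[OF F(2)[of "v n x" "u x"] W(2)[of x]]
    by (simp flip: scaleR_left_diff_distrib add: mult.commute)
  then show ?thesis using p by (intro Lp_tendsto_Lipschitz[OF v]) auto
qed

lemma Lp_tendsto_bounded_continuous_compose:
  fixes \<gamma> :: "nat \<Rightarrow> 'a::euclidean_space \<Rightarrow> 'b::euclidean_space" and u :: "'a \<Rightarrow> real"
  assumes \<gamma>: "Lp_tendsto p \<gamma> g" "Lpn p g < \<infinity>" and p: "p > 0"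
    and F: "continuous_on UNIV F" "\<And>t. \<bar>F t\<bar> \<le> 1"
    and \<zeta>: "\<zeta> \<in> borel_measurable borel" "\<And>x. \<bar>\<zeta> x\<bar> \<le> M"
    and v: "\<And>n. v n \<in> borel_measurable borel" "u \<in> borel_measurable borel"
    and v_tendsto: "AE x in lborel. (\<lambda>n. v n x) \<longlonglongrightarrow> u x"
  shows "Lp_tendsto p (\<lambda>n x. (F (v n x) * \<zeta> x) *\<^sub>R \<gamma> n x) (\<lambda>x. (F (u x) * \<zeta> x) *\<^sub>R g x)"
proof (rule Lp_tendsto_scaleR_AE[OF \<gamma> p])
  note [measurable] = borel_measurable_continuous_onI[OF F(1)] \<zeta>(1) v
  show "(\<lambda>x. F (v n x) * \<zeta> x) \<in> borel_measurable borel" for n by measurable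
  show "(\<lambda>x. F (u x) * \<zeta> x) \<in> borel_measurable borel" by measurable
  show "\<bar>F (v n x) * \<zeta> x\<bar> \<le> M" "\<bar>F (u x) * \<zeta> x\<bar> \<le> M" for n x
    using mult_mono[OF F(2) \<zeta>(2)[of x]] by (simp_all add: abs_mult)
  show "AE x in lborel. (\<lambda>n. F (v n x) * \<zeta> x) \<longlonglongrightarrow> F (u x) * \<zeta> x"
    using v_tendsto
  proof eventually_elim
    case (elim x)
    moreover have "isCont F (u x)" using F(1) by (simp add: continuous_on_eq_continuous_at)
    ultimately have "(\<lambda>n. F (v n x)) \<longlonglongrightarrow> F (u x)" by (rule isCont_tendsto_compose[rotated])
    then show ?case by (rule tendsto_mult_right)
  qed
qed

lemma C1_grad_compact_support_bounded:
  assumes f: "C1_grad f D" and C: "compact C" "vanishes_outside C f"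
  obtains M where "\<And>x. \<bar>f x\<bar> \<le> M" "\<And>x. norm (D x) \<le> M"
proof -
  note D_support = C1_grad_vanishes_outside[OF f compact_imp_closed[OF C(1)] C(2)]
  obtain M\<^sub>f M\<^sub>D where M: "\<And>x. norm (f x) \<le> M\<^sub>f" "\<And>x. norm (D x) \<le> M\<^sub>D"
    using compact_support_bounded[OF C1_grad_continuous(1)[OF f] C]
      compact_support_bounded[OF C1_grad_continuous(2)[OF f] C(1) D_support] by metis
  show ?thesis
    by (rule that[of "max M\<^sub>f M\<^sub>D"]) (use M in \<open>auto intro: max.coboundedI1 max.coboundedI2\<close>)
qed

lemma W1p_approx_chain:
  assumes ball: "W1p_ball p x0 R u g" and \<sigma>: "\<sigma> < R" and p: "p > 1"
    and \<zeta>: "C1_grad \<zeta> D\<zeta>" "vanishes_outside (cball x0 \<sigma>) \<zeta>"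
    and F: "\<And>t. (F has_real_derivative F' t) (at t)" "continuous_on UNIV F'" "\<And>t. \<bar>F' t\<bar> \<le> 1"
  shows "W1p_approx p (cball x0 \<sigma>) (\<lambda>x. F (u x) * \<zeta> x)
    (\<lambda>x. (F' (u x) * \<zeta> x) *\<^sub>R g x + F (u x) *\<^sub>R D\<zeta> x)"
proof -
  have p_pos: "p > 0" using p by simp
  note \<zeta>_measurable = C1_grad_measurable[OF \<zeta>(1)]
  obtain M where M: "\<And>x. \<bar>\<zeta> x\<bar> \<le> M" "\<And>x. norm (D\<zeta> x) \<le> M"
    using C1_grad_compact_support_bounded[OF \<zeta>(1) compact_cball \<zeta>(2)] by blast
  have F_C1: "C1_grad F F'" using F(1,2) by (simp add: C1_grad_def has_field_derivative_def)
  have F_Lipschitz: "\<bar>F s - F t\<bar> \<le> \<bar>s - t\<bar>" for s t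
    using C1_grad_Lipschitz[OF F_C1, of 1 s t] F(3) by (simp add: dist_real_def)
  obtain v \<gamma> where v: "\<And>n. C1_grad (v n) (sgrad (v n))"
    and \<gamma>: "\<And>n x. x \<in> cball x0 \<sigma> \<Longrightarrow> sgrad (v n) x = \<gamma> n x"
    and lim: "Lp_tendsto p v u" "Lp_tendsto p \<gamma> g" "AE x in lborel. (\<lambda>n. v n x) \<longlonglongrightarrow> u x"
    using W1p_ball_C1_approx[OF ball \<sigma> p] by blast
  have g_finite: "Lpn p g < \<infinity>" using ball by (simp add: W1p_ball_def)
  note compose = Lp_tendsto_Lipschitz_compose[OF lim(1) p_pos C1_grad_measurable(1)[OF F_C1]
    F_Lipschitz]
  have "Lp_tendsto p (\<lambda>n x. F (v n x) * \<zeta> x) (\<lambda>x. F (u x) * \<zeta> x)"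
    using compose[OF \<zeta>_measurable(1), of M] M(1) by simp
  moreover have "Lp_tendsto p
      (\<lambda>n x. (F' (v n x) * \<zeta> x) *\<^sub>R \<gamma> n x + F (v n x) *\<^sub>R D\<zeta> x)
      (\<lambda>x. (F' (u x) * \<zeta> x) *\<^sub>R g x + F (u x) *\<^sub>R D\<zeta> x)"
    by (rule Lp_tendsto_add[OF Lp_tendsto_bounded_continuous_compose[OF lim(2) g_finite p_pos F(2,3)
          \<zeta>_measurable(1) M(1) Lp_tendstoD(1,2)[OF lim(1)] lim(3)]
            compose[OF \<zeta>_measurable(2) M(2)] p_pos])
  moreover have "(\<lambda>x. (F' (v n x) * \<zeta> x) *\<^sub>R \<gamma> n x + F (v n x) *\<^sub>R D\<zeta> x)
      = (\<lambda>x. (F' (v n x) * \<zeta> x) *\<^sub>R sgrad (v n) x + F (v n x) *\<^sub>R D\<zeta> x)" for n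
  proof
    fix x show "(F' (v n x) * \<zeta> x) *\<^sub>R \<gamma> n x + F (v n x) *\<^sub>R D\<zeta> x
        = (F' (v n x) * \<zeta> x) *\<^sub>R sgrad (v n) x + F (v n x) *\<^sub>R D\<zeta> x"
      using \<gamma>[of x n] vanishes_outsideD[OF \<zeta>(2), of x] by (cases "x \<in> cball x0 \<sigma>") auto
  qed
  ultimately show ?thesis
    using vanishes_outsideD[OF \<zeta>(2)]
    by (intro W1p_approxI[OF C1_grad_chain_mult[OF v \<zeta>(1) F(1,2)]])
      (auto simp: vanishes_outside_def)
qed

lemma pos_powr_derivative:
  fixes p t :: real
  assumes "p > 1"
  shows "((\<lambda>t. max 0 t powr p) has_real_derivative p * max 0 t powr (p - 1)) (at t)"
proof -
  consider (pos) "t > 0" | (neg) "t < 0" | (zero) "t = 0" by linarith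
  then show ?thesis
  proof cases
    case pos
    have "((\<lambda>t. t powr p) has_real_derivative p * max 0 t powr (p - 1)) (at t)"
      using has_real_derivative_powr[OF pos, of p] pos by simp
    then show ?thesis
      by (rule has_field_derivative_transform_within_open[of _ _ _ "{0<..}"]) (use pos in auto)
  next
    case neg
    have "((\<lambda>t. 0) has_real_derivative p * max 0 t powr (p - 1)) (at t)" using neg assms by auto
    then show ?thesis
      by (rule has_field_derivative_transform_within_open[of _ _ _ "{..<0}"]) (use neg in auto)
  next
    case zero
    have "((\<lambda>h. (max 0 (0 + h) powr p - max 0 0 powr p) / h) \<longlongrightarrow> 0) (at 0)"
    proof (rule Lim_null_comparison[of _ "\<lambda>h. \<bar>h\<bar> powr (p - 1)"])
      have "norm ((max 0 (0 + h) powr p - max 0 0 powr p) / h) \<le> \<bar>h\<bar> powr (p - 1)" for h :: real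
      proof (cases "h > 0")
        case False
        then have "max 0 (0 + h) = 0" by simp
        then show ?thesis by simp
      qed (simp add: powr_diff)
      then show "\<forall>\<^sub>F h in at 0. norm ((max 0 (0 + h) powr p - max 0 0 powr p) / h)
          \<le> \<bar>h\<bar> powr (p - 1)"
        by simp
      have "((\<lambda>h::real. \<bar>h\<bar> powr (p - 1)) \<longlongrightarrow> \<bar>0\<bar> powr (p - 1)) (at 0)"
        using assms by (intro tendsto_powr' tendsto_intros) auto
      then show "((\<lambda>h::real. \<bar>h\<bar> powr (p - 1)) \<longlongrightarrow> 0) (at 0)" by simp
    qed
    then have "((\<lambda>t. max 0 t powr p) has_real_derivative 0) (at 0)" by (simp add: DERIV_def)
    then show ?thesis using zero assms by simp
  qed
qed

lemma pos_square_derivative: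
  "((\<lambda>t::real. (max 0 (t - k))\<^sup>2) has_real_derivative 2 * max 0 (t - k)) (at t)"
proof -
  have "((\<lambda>t. t - k) has_real_derivative 1) (at t)" by (auto intro!: derivative_eq_intros)
  with pos_powr_derivative[of 2 "t - k"]
  have "((\<lambda>t. max 0 (t - k) powr 2) has_real_derivative 2 * max 0 (t - k) powr (2 - 1) * 1) (at t)"
    by (intro DERIV_chain2[where f = "\<lambda>t. max 0 t powr 2" and g = "\<lambda>t. t - k"]) simp_all
  then show ?thesis by simp
qed

definition soft_pos :: "real \<Rightarrow> real \<Rightarrow> real" where
  "soft_pos \<epsilon> t = sqrt ((max 0 t)\<^sup>2 + \<epsilon>\<^sup>2) - \<epsilon>"

definition soft_step :: "real \<Rightarrow> real \<Rightarrow> real" where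
  "soft_step \<epsilon> t = max 0 t / sqrt ((max 0 t)\<^sup>2 + \<epsilon>\<^sup>2)"

lemma soft_pos_radicand_pos: "\<epsilon> > 0 \<Longrightarrow> (max 0 t)\<^sup>2 + \<epsilon>\<^sup>2 > (0::real)"
  by (simp add: add_nonneg_pos)

lemma soft_pos_derivative:
  assumes "\<epsilon> > 0"
  shows "((\<lambda>t. soft_pos \<epsilon> (t - k)) has_real_derivative soft_step \<epsilon> (t - k)) (at t)"
proof -
  have "((\<lambda>t. (max 0 (t - k))\<^sup>2 + \<epsilon>\<^sup>2) has_real_derivative 2 * max 0 (t - k) + 0) (at t)"
    by (intro DERIV_add DERIV_const pos_square_derivative)
  from DERIV_chain2[OF DERIV_real_sqrt[OF soft_pos_radicand_pos[OF assms]] this]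
  have "((\<lambda>t. sqrt ((max 0 (t - k))\<^sup>2 + \<epsilon>\<^sup>2) - \<epsilon>) has_real_derivative
      inverse (sqrt ((max 0 (t - k))\<^sup>2 + \<epsilon>\<^sup>2)) / 2 * (2 * max 0 (t - k) + 0) - 0) (at t)"
    by (intro DERIV_diff DERIV_const)
  then show ?thesis
    unfolding soft_pos_def soft_step_def by (rule DERIV_cong) (simp only: divide_inverse, algebra)
qed

lemma continuous_on_soft_step: "\<epsilon> > 0 \<Longrightarrow> continuous_on UNIV (\<lambda>t. soft_step \<epsilon> (t - k))"
  unfolding soft_step_def using soft_pos_radicand_pos
  by (intro continuous_intros) (auto simp: less_imp_neq[symmetric])

lemma max_0_le_soft_sqrt: "max 0 t \<le> sqrt ((max 0 t)\<^sup>2 + \<epsilon>\<^sup>2)"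
  by (rule real_le_rsqrt) simp

lemma soft_step_bounds: "\<epsilon> > 0 \<Longrightarrow> 0 \<le> soft_step \<epsilon> t \<and> soft_step \<epsilon> t \<le> 1"
  using soft_pos_radicand_pos[of \<epsilon> t] max_0_le_soft_sqrt[of t \<epsilon>] by (simp add: soft_step_def)

lemma soft_pos_near_max: "\<epsilon> > 0 \<Longrightarrow> \<bar>soft_pos \<epsilon> t - max 0 t\<bar> \<le> \<epsilon>"
proof -
  assume \<epsilon>: "\<epsilon> > 0"
  have "sqrt ((max 0 t)\<^sup>2 + \<epsilon>\<^sup>2) \<le> max 0 t + \<epsilon>"
    using \<epsilon> by (intro real_le_lsqrt) (auto simp: power2_sum)
  then show ?thesis using max_0_le_soft_sqrt[of t \<epsilon>] \<epsilon> by (auto simp: soft_pos_def)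
qed

lemma soft_step_tendsto:
  assumes "\<epsilon> \<longlonglongrightarrow> 0"
  shows "(\<lambda>n. soft_step (\<epsilon> n) t) \<longlonglongrightarrow> of_bool (t > 0)"
proof (cases "t > 0")
  case True
  have "(\<lambda>n. max 0 t / sqrt ((max 0 t)\<^sup>2 + (\<epsilon> n)\<^sup>2)) \<longlonglongrightarrow> max 0 t / sqrt ((max 0 t)\<^sup>2 + 0\<^sup>2)"
    using True by (intro tendsto_intros assms) auto
  then show ?thesis using True by (simp add: soft_step_def)
qed (simp_all add: soft_step_def)

lemma Lp_tendsto_uniform_scaleR:
  fixes c :: "nat \<Rightarrow> 'a::euclidean_space \<Rightarrow> real" and W :: "'a \<Rightarrow> 'b::euclidean_space"
  assumes [measurable]: "\<And>n. c n \<in> borel_measurable borel" "d \<in> borel_measurable borel"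
    and W: "continuous_on UNIV W" "compact S" "vanishes_outside S W"
    and near: "\<And>n x. \<bar>c n x - d x\<bar> \<le> \<epsilon> n" and \<epsilon>: "\<epsilon> \<longlonglongrightarrow> 0" and p: "p > 0"
  shows "Lp_tendsto p (\<lambda>n x. c n x *\<^sub>R W x) (\<lambda>x. d x *\<^sub>R W x)"
proof -
  note [measurable] = borel_measurable_continuous_onI[OF W(1)]
  have finite: "Lpn p W < \<infinity>" by (rule Lpn_finite_of_compact_support[OF W p])
  show ?thesis
  proof (rule Lp_tendstoI)
    show "Lpn p (\<lambda>x. c n x *\<^sub>R W x - d x *\<^sub>R W x) \<le> ennreal (\<bar>\<epsilon> n\<bar> powr p) * Lpn p W" for n
      using near p
      by (intro Lpn_le_Lipschitz) (auto simp flip: scaleR_left_diff_distrib intro!: mult_right_mono)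
    have "(\<lambda>n. \<bar>\<epsilon> n\<bar> powr p) \<longlonglongrightarrow> \<bar>0\<bar> powr p"
      using p by (intro tendsto_powr' tendsto_intros \<epsilon>) auto
    then have "(\<lambda>n. ennreal (\<bar>\<epsilon> n\<bar> powr p)) \<longlonglongrightarrow> 0" by (simp add: ennreal_tendsto_0_iff)
    then have "(\<lambda>n. Lpn p W * ennreal (\<bar>\<epsilon> n\<bar> powr p)) \<longlonglongrightarrow> Lpn p W * 0"
      using finite by (intro ennreal_tendsto_cmult) auto
    then show "(\<lambda>n. ennreal (\<bar>\<epsilon> n\<bar> powr p) * Lpn p W) \<longlonglongrightarrow> 0" by (simp add: mult.commute)
  qed measurable
qed

definition excess :: "('a \<Rightarrow> real) \<Rightarrow> real \<Rightarrow> 'a \<Rightarrow> real" where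
  "excess u k x = max 0 (u x - k)"

definition excess_grad :: "('a \<Rightarrow> real) \<Rightarrow> real \<Rightarrow> ('a \<Rightarrow> 'b) \<Rightarrow> 'a \<Rightarrow> 'b::real_vector" where
  "excess_grad u k g x = of_bool (k < u x) *\<^sub>R g x"

lemma excess_nonneg [simp]: "0 \<le> excess u k x"
  by (simp add: excess_def)

lemma excess_measurable[measurable]:
  assumes [measurable]: "u \<in> borel_measurable M"
  shows "excess u k \<in> borel_measurable M"
  unfolding excess_def[abs_def] by measurable

lemma excess_grad_measurable[measurable]:
  fixes g :: "'a \<Rightarrow> 'b::euclidean_space"
  assumes [measurable]: "u \<in> borel_measurable M" "g \<in> borel_measurable M"
  shows "excess_grad u k g \<in> borel_measurable M"
  unfolding excess_grad_def[abs_def] by measurable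

lemma Lp_tendsto_soft_step:
  fixes g :: "'a::euclidean_space \<Rightarrow> 'b::euclidean_space"
  assumes g: "g \<in> borel_measurable borel" "Lpn p g < \<infinity>" and p: "p > 0"
    and [measurable]: "u \<in> borel_measurable borel" "\<zeta> \<in> borel_measurable borel"
    and M: "\<And>x. \<bar>\<zeta> x\<bar> \<le> M" and \<epsilon>: "\<And>n. \<epsilon> n > 0" "\<epsilon> \<longlonglongrightarrow> 0"
  shows "Lp_tendsto p (\<lambda>n x. (soft_step (\<epsilon> n) (u x - k) * \<zeta> x) *\<^sub>R g x)
    (\<lambda>x. \<zeta> x *\<^sub>R excess_grad u k g x)"
proof -
  have [measurable]: "soft_step e \<in> borel_measurable borel" for e
    unfolding soft_step_def[abs_def] by measurable
  have "Lp_tendsto p (\<lambda>n x. (soft_step (\<epsilon> n) (u x - k) * \<zeta> x) *\<^sub>R g x)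
      (\<lambda>x. (of_bool (k < u x) * \<zeta> x) *\<^sub>R g x)"
  proof (rule Lp_tendsto_scaleR_dominated[OF g p])
    show "\<bar>soft_step (\<epsilon> n) (u x - k) * \<zeta> x\<bar> \<le> M" for n x
      using mult_mono[of "\<bar>soft_step (\<epsilon> n) (u x - k)\<bar>" 1 "\<bar>\<zeta> x\<bar>" M]
        soft_step_bounds[OF \<epsilon>(1), of n "u x - k"] M by (simp add: abs_mult)
    show "\<bar>of_bool (k < u x) * \<zeta> x\<bar> \<le> M" for x
      using M[of x] order_trans[OF abs_ge_zero M[of x]] by (simp add: of_bool_def)
    have "(\<lambda>n. soft_step (\<epsilon> n) (u x - k) * \<zeta> x) \<longlonglongrightarrow> of_bool (k < u x) * \<zeta> x" for x
      using tendsto_mult_right[OF soft_step_tendsto[OF \<epsilon>(2), of "u x - k"]] by simp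
    then show "AE x in lborel. (\<lambda>n. soft_step (\<epsilon> n) (u x - k) * \<zeta> x) \<longlonglongrightarrow> of_bool (k < u x) * \<zeta> x"
      by simp
  qed auto
  then show ?thesis by (simp add: excess_grad_def mult.commute)
qed

theorem W1p_approx_truncation:
  assumes ball: "W1p_ball p x0 R u g" and \<sigma>: "\<sigma> < R" and p: "p > 1"
    and \<zeta>: "C1_grad \<zeta> D\<zeta>" "vanishes_outside (cball x0 \<sigma>) \<zeta>"
  shows "W1p_approx p (cball x0 \<sigma>) (\<lambda>x. excess u k x * \<zeta> x)
     (\<lambda>x. \<zeta> x *\<^sub>R excess_grad u k g x + excess u k x *\<^sub>R D\<zeta> x)"
proof -
  define \<epsilon> where "\<epsilon> n = 1 / (real n + 1)" for n
  have \<epsilon>: "\<epsilon> n > 0" "\<epsilon> \<longlonglongrightarrow> 0" for n using inverse_Suc_tendsto_0 by (auto simp: \<epsilon>_def[abs_def])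
  have u[measurable]: "u \<in> borel_measurable borel" and g: "g \<in> borel_measurable borel" "Lpn p g < \<infinity>"
    using ball by (auto simp: W1p_ball_def)
  have [measurable]: "soft_pos e \<in> borel_measurable borel" for e
    unfolding soft_pos_def[abs_def] by measurable
  note \<zeta>_continuous = C1_grad_continuous[OF \<zeta>(1)]
  note D\<zeta>_support = C1_grad_vanishes_outside[OF \<zeta>(1) closed_cball \<zeta>(2)]
  obtain M where M: "\<And>x. \<bar>\<zeta> x\<bar> \<le> M"
    using C1_grad_compact_support_bounded[OF \<zeta>(1) compact_cball \<zeta>(2)] by metis
  have "\<bar>soft_pos (\<epsilon> n) (u x - k) - excess u k x\<bar> \<le> \<epsilon> n" for n x
    unfolding excess_def by (rule soft_pos_near_max[OF \<epsilon>(1)])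
  note soft_pos_tendsto = Lp_tendsto_uniform_scaleR[OF _ _ _ compact_cball _ this \<epsilon>(2)]
  show ?thesis
  proof (rule W1p_approx_closed)
    show "W1p_approx p (cball x0 \<sigma>) (\<lambda>x. soft_pos (\<epsilon> n) (u x - k) * \<zeta> x)
      (\<lambda>x. (soft_step (\<epsilon> n) (u x - k) * \<zeta> x) *\<^sub>R g x + soft_pos (\<epsilon> n) (u x - k) *\<^sub>R D\<zeta> x)" for n
      using soft_step_bounds[OF \<epsilon>(1)]
      by (intro W1p_approx_chain[OF ball \<sigma> p \<zeta> soft_pos_derivative[OF \<epsilon>(1)]
            continuous_on_soft_step[OF \<epsilon>(1)]]) (auto simp: abs_of_nonneg)
    show "Lp_tendsto p (\<lambda>n x. soft_pos (\<epsilon> n) (u x - k) * \<zeta> x) (\<lambda>x. excess u k x * \<zeta> x)"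
      using soft_pos_tendsto[OF _ _ \<zeta>_continuous(1) \<zeta>(2), where p = p] p by simp
    have "Lp_tendsto p (\<lambda>n x. soft_pos (\<epsilon> n) (u x - k) *\<^sub>R D\<zeta> x) (\<lambda>x. excess u k x *\<^sub>R D\<zeta> x)"
      using soft_pos_tendsto[OF _ _ \<zeta>_continuous(2) D\<zeta>_support, where p = p] p by simp
    from Lp_tendsto_add[OF Lp_tendsto_soft_step[OF g _ u C1_grad_measurable(1)[OF \<zeta>(1)] M \<epsilon>] this] p
    show "Lp_tendsto p
        (\<lambda>n x. (soft_step (\<epsilon> n) (u x - k) * \<zeta> x) *\<^sub>R g x + soft_pos (\<epsilon> n) (u x - k) *\<^sub>R D\<zeta> x)
        (\<lambda>x. \<zeta> x *\<^sub>R excess_grad u k g x + excess u k x *\<^sub>R D\<zeta> x)" by simp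
  qed (use p in simp)
qed

lemma weak_grad_subset_cong:
  assumes "weak_grad U u g" "V \<subseteq> U" "\<And>x. x \<in> V \<Longrightarrow> u' x = u x" "\<And>x. x \<in> V \<Longrightarrow> g' x = g x"
  shows "weak_grad V u' g'"
  unfolding weak_grad_def
proof (intro allI impI ballI)
  fix \<phi> and i :: 'a assume \<phi>: "test_fun V \<phi>" and i: "i \<in> Basis"
  have "test_fun U \<phi>" using \<phi> assms(2) by (auto simp: test_fun_def)
  moreover have "(\<lambda>x. indicat_real V x *\<^sub>R (u' x * partial \<phi> i x))
      = (\<lambda>x. indicat_real U x *\<^sub>R (u x * partial \<phi> i x))"
    "(\<lambda>x. indicat_real V x *\<^sub>R ((g' x \<bullet> i) * \<phi> x)) = (\<lambda>x. indicat_real U x *\<^sub>R ((g x \<bullet> i) * \<phi> x))"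
    using test_fun_vanishes_outside[OF \<phi>] assms(2-4)
    by (auto simp: fun_eq_iff indicator_def vanishes_outside_def)
  ultimately show "set_integrable lebesgue V (\<lambda>x. u' x * partial \<phi> i x)
      \<and> set_integrable lebesgue V (\<lambda>x. g' x \<bullet> i * \<phi> x)
      \<and> (LINT x:V|lebesgue. u' x * partial \<phi> i x) = - (LINT x:V|lebesgue. g' x \<bullet> i * \<phi> x)"
    using assms(1) i unfolding weak_grad_def set_integrable_def set_lebesgue_integral_def by simp
qed

lemma Lpn_restrict_finite:
  assumes [measurable]: "f \<in> borel_measurable borel" "C \<in> sets borel"
    and "set_integrable lebesgue C (\<lambda>x. norm (f x) powr p)" and p: "p > 0"
  shows "Lpn p (\<lambda>x. indicat_real C x *\<^sub>R f x) < \<infinity>"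
proof -
  have "(\<lambda>x. indicat_real C x *\<^sub>R (norm (f x) powr p))
      = (\<lambda>x. norm (indicat_real C x *\<^sub>R f x) powr p)"
    using p by (auto simp: indicator_def)
  then have "integrable lebesgue (\<lambda>x. norm (indicat_real C x *\<^sub>R f x) powr p)"
    using assms(3) by (simp only: set_integrable_def)
  then have "integrable lborel (\<lambda>x. norm (indicat_real C x *\<^sub>R f x) powr p)"
    by (subst (asm) integrable_completion) auto
  then show ?thesis by (simp add: integrable_iff_bounded Lpn_def)
qed

lemma W1p_loc_imp_W1p_ball:
  assumes W: "W1p_loc \<Omega> p u g" and p: "p > 0" and R: "cball x0 R \<subseteq> \<Omega>"
    and [measurable]: "u \<in> borel_measurable borel" "g \<in> borel_measurable borel"
  shows "W1p_ball p x0 R (\<lambda>x. indicat_real (cball x0 R) x *\<^sub>R u x)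
    (\<lambda>x. indicat_real (cball x0 R) x *\<^sub>R g x)"
  unfolding W1p_ball_def
proof (intro conjI)
  have [measurable]: "indicat_real (cball x0 R) \<in> borel_measurable borel"
    by (intro borel_measurable_indicator) auto
  show "(\<lambda>x. indicat_real (cball x0 R) x *\<^sub>R u x) \<in> borel_measurable borel"
    "(\<lambda>x. indicat_real (cball x0 R) x *\<^sub>R g x) \<in> borel_measurable borel" by measurable
  show "Lpn p (\<lambda>x. indicat_real (cball x0 R) x *\<^sub>R u x) < \<infinity>"
    "Lpn p (\<lambda>x. indicat_real (cball x0 R) x *\<^sub>R g x) < \<infinity>"
    using W R p by (intro Lpn_restrict_finite; simp add: W1p_loc_def)+
  show "weak_grad (ball x0 R) (\<lambda>x. indicat_real (cball x0 R) x *\<^sub>R u x)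
      (\<lambda>x. indicat_real (cball x0 R) x *\<^sub>R g x)"
  proof (rule weak_grad_subset_cong)
    show "weak_grad \<Omega> u g" using W by (simp add: W1p_loc_def)
    show "ball x0 R \<subseteq> \<Omega>" using ball_subset_cball R by (rule subset_trans)
  qed simp_all
qed (auto simp: vanishes_outside_def)

theorem W1p_loc_truncation:
  assumes W: "W1p_loc \<Omega> p u g" and p: "p > 1"
    and u: "u \<in> borel_measurable borel" and g: "g \<in> borel_measurable borel"
    and \<zeta>: "C1_grad \<zeta> D\<zeta>" "vanishes_outside (cball x0 \<sigma>) \<zeta>" and R: "\<sigma> < R" "cball x0 R \<subseteq> \<Omega>"
  shows "W1p_approx p (cball x0 \<sigma>) (\<lambda>x. excess u k x * \<zeta> x)
     (\<lambda>x. \<zeta> x *\<^sub>R excess_grad u k g x + excess u k x *\<^sub>R D\<zeta> x)"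
proof -
  define v where "v x = indicat_real (cball x0 R) x *\<^sub>R u x" for x
  define \<gamma> where "\<gamma> x = indicat_real (cball x0 R) x *\<^sub>R g x" for x
  have "W1p_ball p x0 R v \<gamma>"
    unfolding v_def[abs_def] \<gamma>_def[abs_def]
    using p by (intro W1p_loc_imp_W1p_ball[OF W _ R(2) u g]) simp
  from W1p_approx_truncation[OF this R(1) p \<zeta>, of k]
  have "W1p_approx p (cball x0 \<sigma>) (\<lambda>x. excess v k x * \<zeta> x)
     (\<lambda>x. \<zeta> x *\<^sub>R excess_grad v k \<gamma> x + excess v k x *\<^sub>R D\<zeta> x)" .
  moreover have "excess v k x * \<zeta> x = excess u k x * \<zeta> x"
    "\<zeta> x *\<^sub>R excess_grad v k \<gamma> x + excess v k x *\<^sub>R D\<zeta> x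
        = \<zeta> x *\<^sub>R excess_grad u k g x + excess u k x *\<^sub>R D\<zeta> x" for x
    using vanishes_outsideD[OF \<zeta>(2), of x] R(1)
      vanishes_outsideD[OF C1_grad_vanishes_outside[OF \<zeta>(1) closed_cball \<zeta>(2)], of x]
    by (cases "x \<in> cball x0 \<sigma>"; simp add: excess_def excess_grad_def v_def \<gamma>_def)+
  ultimately show ?thesis by simp
qed

section \<open>Membership in W01p\<close>

lemma C1_grad_test_fun_approx:
  assumes h: "C1_grad h D" "vanishes_outside (cball x0 \<sigma>) h" and \<sigma>: "\<sigma> < \<tau>" and p: "p > 1"
    and e: "e > 0"
  obtains \<psi> where "test_fun (ball x0 \<tau>) \<psi>" "C1_grad \<psi> (sgrad \<psi>)"
    "Lpn p (\<lambda>x. \<psi> x - h x) < ennreal e" "Lpn p (\<lambda>x. sgrad \<psi> x - D x) < ennreal e"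
proof -
  note continuous = C1_grad_continuous[OF h(1), of UNIV]
    and measurable = C1_grad_measurable[OF h(1)]
  note D = C1_grad_vanishes_outside[OF h(1) closed_cball h(2)]
  have finite: "Lpn p h < \<infinity>" "Lpn p D < \<infinity>"
    using Lpn_finite_of_compact_support[OF continuous(1) compact_cball h(2), of p]
      Lpn_finite_of_compact_support[OF continuous(2) compact_cball D, of p] p by simp_all
  have "weak_grad UNIV h D"
    using p by (intro W1p_approx_weak_grad[OF W1p_approx_C1_grad[OF h] compact_cball] h(2) D) auto
  from conv_C1_approx[OF measurable(1) finite(1) h(2) measurable(2) finite(2) D this _ p, of
    "\<tau> - \<sigma>"] \<sigma>
  obtain a \<rho> where \<rho>: "\<And>n. mollifier (a n) (\<rho> n)" "\<And>n. a n < \<tau> - \<sigma>"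
    "\<And>n. C1_grad (conv (\<rho> n) h) (sgrad (conv (\<rho> n) h))"
    "\<And>n x. cball x (a n) \<subseteq> UNIV \<Longrightarrow> sgrad (conv (\<rho> n) h) x = conv (\<rho> n) D x"
    "Lp_tendsto p (\<lambda>n. conv (\<rho> n) h) h" "Lp_tendsto p (\<lambda>n. conv (\<rho> n) D) D" by auto
  have "\<forall>\<^sub>F n in sequentially. Lpn p (\<lambda>x. conv (\<rho> n) h x - h x) < ennreal e
      \<and> Lpn p (\<lambda>x. conv (\<rho> n) D x - D x) < ennreal e"
    using e by (intro eventually_conj Lp_tendsto_eventually_Lpn_less \<rho>(5,6))
  then obtain n where n: "Lpn p (\<lambda>x. conv (\<rho> n) h x - h x) < ennreal e"
    "Lpn p (\<lambda>x. conv (\<rho> n) D x - D x) < ennreal e" by (auto simp: eventually_sequentially)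
  have "test_fun (ball x0 \<tau>) (conv (\<rho> n) h)"
  proof (rule test_funI[OF smooth_fun_conv])
    show "\<rho> n \<in> tensor_bumps (a n)" by (rule mollifierD(1)[OF \<rho>(1)])
    then show "vanishes_outside (cball x0 (\<sigma> + a n)) (conv (\<rho> n) h)"
      using h(2) by (rule conv_vanishes_outside)
    show "cball x0 (\<sigma> + a n) \<subseteq> ball x0 \<tau>" using \<rho>(2)[of n] by auto
  qed (use compact_support_integrable[OF continuous(1) compact_cball h(2)] in auto)
  then show ?thesis using n \<rho>(4) by (intro that[OF _ \<rho>(3)]) auto
qed

lemma W1p_approx_test_funs:
  assumes approx: "W1p_approx p (cball x0 \<sigma>) f G" and \<sigma>: "\<sigma> < \<tau>" and p: "p > 1"
  obtains \<psi> where "\<And>n. test_fun (ball x0 \<tau>) (\<psi> n)" "Lp_tendsto p \<psi> f"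
    "Lp_tendsto p (\<lambda>n. sgrad (\<psi> n)) G"
proof -
  obtain h D where h: "\<And>n. C1_grad (h n) (D n)" "\<And>n. vanishes_outside (cball x0 \<sigma>) (h n)"
    "Lp_tendsto p h f" "Lp_tendsto p D G" using W1p_approxE[OF approx] by metis
  define near where "near n \<psi> \<longleftrightarrow> test_fun (ball x0 \<tau>) \<psi> \<and> C1_grad \<psi> (sgrad \<psi>) \<and>
      Lpn p (\<lambda>x. \<psi> x - h n x) < ennreal (1 / (real n + 1)) \<and>
      Lpn p (\<lambda>x. sgrad \<psi> x - D n x) < ennreal (1 / (real n + 1))" for n \<psi>
  have "\<exists>\<psi>. near n \<psi>" for n
    using C1_grad_test_fun_approx[OF h(1,2) \<sigma> p, of "1 / (real n + 1)" n] unfolding near_def by auto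
  then obtain \<psi> where "\<And>n. near n (\<psi> n)" by metis
  then have \<psi>: "\<And>n. test_fun (ball x0 \<tau>) (\<psi> n)" "\<And>n. C1_grad (\<psi> n) (sgrad (\<psi> n))"
    "\<And>n. Lpn p (\<lambda>x. \<psi> n x - h n x) < ennreal (1 / (real n + 1))"
    "\<And>n. Lpn p (\<lambda>x. sgrad (\<psi> n) x - D n x) < ennreal (1 / (real n + 1))"
    by (simp_all add: near_def)
  have "Lp_tendsto p \<psi> f" "Lp_tendsto p (\<lambda>n. sgrad (\<psi> n)) G"
    using C1_grad_measurable[OF \<psi>(2)] ennreal_tendsto_0_less_inverse_Suc[OF \<psi>(3)]
      ennreal_tendsto_0_less_inverse_Suc[OF \<psi>(4)] p
    by (auto intro!: Lp_tendsto_trans[OF h(3)] Lp_tendsto_trans[OF h(4)])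
  with \<psi>(1) show ?thesis by (rule that)
qed

lemma W1p_approx_imp_W1p:
  assumes approx: "W1p_approx p S f G" and S: "compact S" "S \<subseteq> U" and p: "p \<ge> 1"
    and support: "vanishes_outside S f" "vanishes_outside S G"
  shows "W1p U p f G"
proof -
  note [measurable] = W1p_approx_measurable[OF approx]
  note U = vanishes_outside_mono[OF support(1) S(2)] vanishes_outside_mono[OF support(2) S(2)]
  have "vanishes_outside U (\<lambda>x. \<bar>f x\<bar> powr p)" "vanishes_outside U (\<lambda>x. norm (G x) powr p)"
    using U by (simp_all add: vanishes_outside_def)
  moreover have "integrable lborel (\<lambda>x. \<bar>f x\<bar> powr p)" "integrable lborel (\<lambda>x. norm (G x) powr p)"
    using integrable_of_Lpn_finite[of f p] integrable_of_Lpn_finite[of G p]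
      W1p_approx_Lpn_finite[OF approx S(1)] p by auto
  ultimately show ?thesis
    using W1p_approx_weak_grad[OF approx S p support] U unfolding W1p_def
    by (simp add: lebesgue_eq_lborel)
qed

theorem W1p_approx_imp_W01p:
  assumes approx: "W1p_approx p (cball x0 \<sigma>) f G" and \<sigma>: "\<sigma> < \<tau>" and p: "p > 1"
    and support: "vanishes_outside (cball x0 \<sigma>) f" "vanishes_outside (cball x0 \<sigma>) G"
  shows "W01p (ball x0 \<tau>) p f G"
proof -
  let ?U = "ball x0 \<tau>"
  note [measurable] = W1p_approx_measurable[OF approx]
  have "cball x0 \<sigma> \<subseteq> ?U" using \<sigma> by auto
  then have W1p: "W1p ?U p f G" and U: "vanishes_outside ?U f" "vanishes_outside ?U G"
    using p by (auto intro!: W1p_approx_imp_W1p[OF approx compact_cball] support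
        vanishes_outside_mono[OF support(1)] vanishes_outside_mono[OF support(2)])
  obtain \<psi> where \<psi>: "\<And>n. test_fun ?U (\<psi> n)" "Lp_tendsto p \<psi> f" "Lp_tendsto p (\<lambda>n. sgrad (\<psi> n)) G"
    using W1p_approx_test_funs[OF approx \<sigma> p] by blast
  note [measurable] = Lp_tendstoD(1)[OF \<psi>(2)] Lp_tendstoD(1)[OF \<psi>(3)]
  let ?error = "\<lambda>n x. \<bar>\<psi> n x - f x\<bar> powr p + norm (sgrad (\<psi> n) x - G x) powr p"
  have "(LINT x:?U|lebesgue. ?error n x)
      = enn2real (Lpn p (\<lambda>x. \<psi> n x - f x) + Lpn p (\<lambda>x. sgrad (\<psi> n) x - G x))" for n
  proof -
    have "vanishes_outside ?U (sgrad (\<psi> n))"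
      using test_fun_vanishes_outside(2)[OF \<psi>(1)] by (simp add: vanishes_outside_def sgrad_def)
    then have "vanishes_outside ?U (?error n)"
      using test_fun_vanishes_outside(1)[OF \<psi>(1), of n] U by (simp add: vanishes_outside_def)
    then have "(LINT x:?U|lebesgue. ?error n x) = (\<integral>x. ?error n x \<partial>lborel)"
      by (intro lebesgue_eq_lborel(2)) auto
    also have "\<dots> = enn2real (\<integral>\<^sup>+x. ennreal (?error n x) \<partial>lborel)"
      by (rule integral_eq_nn_integral) auto
    finally show ?thesis by (simp add: Lpn_def nn_integral_add)
  qed
  moreover have "(\<lambda>n. enn2real (Lpn p (\<lambda>x. \<psi> n x - f x) + Lpn p (\<lambda>x. sgrad (\<psi> n) x - G x))) \<longlonglongrightarrow> 0"
    using tendsto_add[OF Lp_tendstoD(3)[OF \<psi>(2)] Lp_tendstoD(3)[OF \<psi>(3)]]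
    by (intro tendsto_enn2real) auto
  ultimately have "(\<lambda>n. LINT x:?U|lebesgue. ?error n x) \<longlonglongrightarrow> 0" by simp
  then show ?thesis unfolding W01p_def using W1p \<psi>(1) vanishes_outsideD[OF U(1)] by blast
qed

section \<open>The Faber--Krahn inequality\<close>

lemma C1_grad_increment_powr_le:
  fixes h :: "'a::euclidean_space \<Rightarrow> real"
  assumes C1: "C1_grad h D" and p: "p > 1"
  shows "ennreal (norm (h (x + v) - h x) powr p)
    \<le> (\<integral>\<^sup>+t\<in>{0..1}. ennreal (norm (D (x + t *\<^sub>R v)) powr p) * ennreal (norm v powr p) \<partial>lborel)"
proof -
  let ?F = "\<lambda>t. D (x + t *\<^sub>R v) \<bullet> v"
  have F: "continuous_on UNIV ?F"
    by (intro continuous_intros continuous_on_compose2[OF C1_grad_continuous(2)[OF C1]]) auto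
  have "(\<integral>t. indicat_real {0..1::real} t *\<^sub>R ?F t \<partial>lborel) = h (x + v) - h x"
    using integral_FTC_Icc_real[of 0 1 "\<lambda>t. h (x + t *\<^sub>R v)" ?F]
        C1_grad_line[OF C1, of x v _ UNIV] F
    by (simp add: mult.commute continuous_on_eq_continuous_at)
  moreover have "ennreal (norm (\<integral>t. indicat_real {0..1::real} t *\<^sub>R ?F t \<partial>lborel) powr p)
      \<le> (\<integral>\<^sup>+t. ennreal (indicat_real {0..1::real} t * norm (?F t) powr p) \<partial>lborel)"
    by (rule Jensen_powr) (use p borel_measurable_continuous_onI[OF F] in auto)
  moreover have "\<dots> \<le> (\<integral>\<^sup>+t\<in>{0..1}. ennreal (norm (D (x + t *\<^sub>R v)) powr p)
      * ennreal (norm v powr p) \<partial>lborel)"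
  proof (rule nn_integral_mono)
    fix t
    have "norm (?F t) powr p \<le> (norm (D (x + t *\<^sub>R v)) * norm v) powr p"
      using p by (intro powr_mono2) (auto intro: Cauchy_Schwarz_ineq2)
    then show "ennreal (indicat_real {0..1::real} t * norm (?F t) powr p)
        \<le> ennreal (norm (D (x + t *\<^sub>R v)) powr p) * ennreal (norm v powr p) * indicator {0..1} t"
      by (simp add: indicator_def powr_mult ennreal_mult[symmetric] ennreal_leI)
  qed
  ultimately show ?thesis by simp
qed

lemma C1_grad_translation_Lpn_le:
  fixes h :: "'a::euclidean_space \<Rightarrow> real"
  assumes C1: "C1_grad h D" and p: "p > 1"
  shows "Lpn p (\<lambda>x. h (x + v) - h x) \<le> ennreal (norm v powr p) * Lpn p D"
proof -
  note [measurable] = C1_grad_measurable[OF C1]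
  let ?c = "ennreal (norm v powr p)"
  have "Lpn p (\<lambda>x. h (x + v) - h x)
      \<le> (\<integral>\<^sup>+x. (\<integral>\<^sup>+t\<in>{0..1}. ennreal (norm (D (x + t *\<^sub>R v)) powr p) * ?c \<partial>lborel) \<partial>lborel)"
    unfolding Lpn_def by (intro nn_integral_mono C1_grad_increment_powr_le[OF C1 p])
  also have "\<dots> = (\<integral>\<^sup>+t. \<integral>\<^sup>+x. ennreal (norm (D (x + t *\<^sub>R v)) powr p) * ?c
      * indicator {0..1::real} t
      \<partial>lborel \<partial>lborel)"
    by (rule lborel_pair.Fubini'[symmetric]) simp
  also have "\<dots> = (\<integral>\<^sup>+t\<in>{0..1::real}. ?c * Lpn p D \<partial>lborel)"
  proof (rule nn_integral_cong)
    fix t :: real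
    have "(\<integral>\<^sup>+x. ennreal (norm (D (x + t *\<^sub>R v)) powr p) \<partial>lborel) = Lpn p D"
      unfolding Lpn_def
      using nn_integral_lborel_shift[of "\<lambda>x. ennreal (norm (D x) powr p)" "t *\<^sub>R v"]
      by (simp add: add.commute)
    then show "(\<integral>\<^sup>+x. ennreal (norm (D (x + t *\<^sub>R v)) powr p) * ?c * indicator {0..1} t \<partial>lborel)
        = ?c * Lpn p D * indicator {0..1} t"
      by (subst nn_integral_multc, simp, subst nn_integral_multc, simp, simp add: mult.commute)
  qed
  also have "\<dots> = ?c * Lpn p D" by (simp add: nn_integral_cmult_indicator)
  finally show ?thesis .
qed

text \<open>The factor \<open>8\<close> comes from three uses of the quasi-triangle inequality for \<open>Lpn\<close>.\<close>
lemma W1p_approx_translation_Lpn_le: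
  fixes f :: "'a::euclidean_space \<Rightarrow> real"
  assumes approx: "W1p_approx p S f G" and p: "p > 1"
  shows "Lpn p (\<lambda>x. f (x + v) - f x) \<le> ennreal ((8 * norm v) powr p) * Lpn p G"
proof -
  obtain h D where h: "\<And>n. C1_grad (h n) (D n)" "Lp_tendsto p h f" "Lp_tendsto p D G"
    using W1p_approxE[OF approx] by metis
  note [measurable] = Lp_tendstoD(1,2)[OF h(2)] Lp_tendstoD(1,2)[OF h(3)]
  define c where "c = ennreal (2 powr p)"
  define N where "N = ennreal (norm v powr p)"
  define e\<^sub>h where "e\<^sub>h n = Lpn p (\<lambda>x. h n x - f x)" for n
  define e\<^sub>D where "e\<^sub>D n = Lpn p (\<lambda>x. D n x - G x)" for n
  have D_le: "Lpn p (D n) \<le> c * (e\<^sub>D n + Lpn p G)" for n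
    unfolding c_def e\<^sub>D_def using Lpn_add[of "\<lambda>x. D n x - G x" G p] p by simp
  have approx_le: "Lpn p (\<lambda>x. f (x + v) - f x)
      \<le> c * (e\<^sub>h n + c * (N * (c * (e\<^sub>D n + Lpn p G)) + e\<^sub>h n))" for n
  proof -
    have shifted: "Lpn p (\<lambda>x. f (x + v) - h n (x + v)) = e\<^sub>h n"
      unfolding e\<^sub>h_def Lpn_minus_commute[of p "h n"]
      using Lpn_shift[of "\<lambda>x. f x - h n x" p v] by simp
    have "Lpn p (\<lambda>x. f (x + v) - f x)
        \<le> c * (e\<^sub>h n + Lpn p (\<lambda>x. h n (x + v) - f x))"
      unfolding c_def shifted[symmetric] using p by (intro Lpn_diff_trans) auto
    also have "Lpn p (\<lambda>x. h n (x + v) - f x) \<le> c * (Lpn p (\<lambda>x. h n (x + v) - h n x) + e\<^sub>h n)"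
      unfolding c_def e\<^sub>h_def using p by (intro Lpn_diff_trans) auto
    also have "Lpn p (\<lambda>x. h n (x + v) - h n x) \<le> N * Lpn p (D n)"
      unfolding N_def by (rule C1_grad_translation_Lpn_le[OF h(1) p])
    also have "\<dots> \<le> N * (c * (e\<^sub>D n + Lpn p G))" by (intro mult_left_mono D_le) auto
    finally show ?thesis by (simp add: mult_left_mono add_mono)
  qed
  have "e\<^sub>h \<longlonglongrightarrow> 0" "e\<^sub>D \<longlonglongrightarrow> 0"
    unfolding e\<^sub>h_def[abs_def] e\<^sub>D_def[abs_def] by (intro Lp_tendstoD(3) h)+
  then have "(\<lambda>n. c * (e\<^sub>h n + c * (N * (c * (e\<^sub>D n + Lpn p G)) + e\<^sub>h n)))
      \<longlonglongrightarrow> c * (0 + c * (N * (c * (0 + Lpn p G)) + 0))"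
    by (intro ennreal_tendsto_cmult tendsto_add tendsto_const) (auto simp: c_def N_def)
  then have "Lpn p (\<lambda>x. f (x + v) - f x) \<le> c * (0 + c * (N * (c * (0 + Lpn p G)) + 0))"
    by (rule LIMSEQ_le_const) (auto intro!: exI[of _ 0] approx_le)
  also have "\<dots> = (c * c * c * N) * Lpn p G" by (simp add: mult_ac)
  also have "c * c * c * N = ennreal ((8 * norm v) powr p)"
    unfolding c_def N_def by (simp add: ennreal_mult[symmetric] powr_mult[symmetric])
  finally show ?thesis .
qed

lemma emeasure_translates_leaving_ge:
  fixes E B :: "'a::euclidean_space set"
  assumes sets: "E \<in> sets borel" "B \<in> sets borel"
    and finite: "emeasure lborel B < \<infinity>" and small: "2 * emeasure lborel E \<le> emeasure lborel B"
  shows "emeasure lborel B \<le> 2 * emeasure lborel (B - (\<lambda>v. x + v) -` E)"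
proof -
  let ?S = "B - (\<lambda>v. x + v) -` E"
  have vimage: "(\<lambda>v. x + v) -` E \<in> sets borel"
    using measurable_sets_borel[OF _ sets(1), of "\<lambda>v. x + v"] by simp
  have "emeasure lborel E = emeasure (distr lborel borel ((+) x)) E"
    by (simp add: lborel_distr_plus)
  also have "\<dots> = emeasure lborel ((\<lambda>v. x + v) -` E)" using sets by (simp add: emeasure_distr)
  finally have same: "emeasure lborel ((\<lambda>v. x + v) -` E) = emeasure lborel E" by simp
  have "emeasure lborel B \<le> emeasure lborel (?S \<union> (\<lambda>v. x + v) -` E)"
    using sets vimage by (intro emeasure_mono) auto
  also have "\<dots> \<le> emeasure lborel ?S + emeasure lborel E"
    unfolding same[symmetric] using sets vimage by (intro emeasure_subadditive) auto
  finally have "2 * emeasure lborel B \<le> 2 * (emeasure lborel ?S + emeasure lborel E)"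
    by (intro mult_left_mono) auto
  also have "\<dots> \<le> 2 * emeasure lborel ?S + emeasure lborel B"
    unfolding distrib_left by (intro add_left_mono small)
  finally have "emeasure lborel B + emeasure lborel B \<le> emeasure lborel B + 2 * emeasure lborel ?S"
    by (simp add: mult_2 add.commute)
  then show ?thesis using finite by (auto simp: ennreal_add_left_cancel_le)
qed

lemma norm_powr_le_average_increment:
  fixes f :: "'a::euclidean_space \<Rightarrow> real"
  assumes E: "E \<in> sets borel" "vanishes_outside E f"
    and B: "B \<in> sets borel" "emeasure lborel B < \<infinity>"
    and small: "2 * emeasure lborel E \<le> emeasure lborel B"
  shows "emeasure lborel B * ennreal (norm (f x) powr p)
      \<le> 2 * (\<integral>\<^sup>+v\<in>B. ennreal (norm (f (x + v) - f x) powr p) \<partial>lborel)"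
proof -
  let ?S = "B - (\<lambda>v. x + v) -` E"
  have S: "?S \<in> sets borel" using measurable_sets_borel[OF _ E(1), of "\<lambda>v. x + v"] B(1) by auto
  have "emeasure lborel B * ennreal (norm (f x) powr p)
      \<le> 2 * emeasure lborel ?S * ennreal (norm (f x) powr p)"
    by (intro mult_right_mono emeasure_translates_leaving_ge[OF E(1) B small]) auto
  also have "\<dots> = 2 * (\<integral>\<^sup>+v\<in>?S. ennreal (norm (f x) powr p) \<partial>lborel)"
    using S by (simp add: nn_integral_cmult_indicator mult_ac)
  also have "\<dots> \<le> 2 * (\<integral>\<^sup>+v\<in>B. ennreal (norm (f (x + v) - f x) powr p) \<partial>lborel)"
    using vanishes_outsideD[OF E(2)]
    by (intro mult_left_mono nn_integral_mono) (auto simp: indicator_def)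
  finally show ?thesis .
qed

theorem Faber_Krahn:
  fixes f :: "'a::euclidean_space \<Rightarrow> real"
  assumes approx: "W1p_approx p S f G" and p: "p > 1"
    and E: "E \<in> sets borel" "vanishes_outside E f"
    and r: "r > 0" and small: "2 * emeasure lborel E \<le> emeasure lborel (ball (0::'a) r)"
  shows "Lpn p f \<le> ennreal (2 * (8 * r) powr p) * Lpn p G"
proof -
  let ?B = "ball (0::'a) r"
  note [measurable] = W1p_approx_measurable[OF approx]
  have B: "?B \<in> sets borel" "emeasure lborel ?B < \<infinity>" "emeasure lborel ?B \<noteq> 0"
    using r emeasure_lborel_ball_finite[of "0::'a" r] content_ball_pos[of r "0::'a"]
    by (auto simp: measure_def)
  have [measurable]: "(indicator ?B :: 'a \<Rightarrow> ennreal) \<in> borel_measurable borel"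
    by (intro borel_measurable_indicator B(1))
  have "emeasure lborel ?B * Lpn p f
      = (\<integral>\<^sup>+x. emeasure lborel ?B * ennreal (norm (f x) powr p) \<partial>lborel)"
    unfolding Lpn_def by (rule nn_integral_cmult[symmetric]) simp
  also have "\<dots> \<le> (\<integral>\<^sup>+x. 2 * (\<integral>\<^sup>+v\<in>?B. ennreal (norm (f (x + v) - f x) powr p) \<partial>lborel) \<partial>lborel)"
    by (intro nn_integral_mono norm_powr_le_average_increment[OF E B(1,2) small])
  also have "\<dots> = 2 * (\<integral>\<^sup>+x. (\<integral>\<^sup>+v\<in>?B. ennreal (norm (f (x + v) - f x) powr p) \<partial>lborel) \<partial>lborel)"
    by (intro nn_integral_cmult lborel.borel_measurable_nn_integral) measurable
  also have "\<dots> = 2 * (\<integral>\<^sup>+v. \<integral>\<^sup>+x. ennreal (norm (f (x + v) - f x) powr p) * indicator ?B v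
      \<partial>lborel \<partial>lborel)"
    by (subst lborel_pair.Fubini') measurable
  also have "\<dots> = 2 * (\<integral>\<^sup>+v\<in>?B. Lpn p (\<lambda>x. f (x + v) - f x) \<partial>lborel)"
    unfolding Lpn_def by (simp add: nn_integral_multc)
  also have "\<dots> \<le> 2 * (\<integral>\<^sup>+v\<in>?B. ennreal ((8 * r) powr p) * Lpn p G \<partial>lborel)"
  proof (intro mult_left_mono nn_integral_mono)
    fix v :: 'a
    have "Lpn p (\<lambda>x. f (x + v) - f x) \<le> ennreal ((8 * r) powr p) * Lpn p G" if "v \<in> ?B"
      using that p by (intro order_trans[OF W1p_approx_translation_Lpn_le[OF approx p]]
          mult_right_mono ennreal_leI powr_mono2) auto
    then show "Lpn p (\<lambda>x. f (x + v) - f x) * indicator ?B v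
        \<le> ennreal ((8 * r) powr p) * Lpn p G * indicator ?B v"
      by (cases "v \<in> ?B") auto
  qed auto
  also have "\<dots> = emeasure lborel ?B * (ennreal (2 * (8 * r) powr p) * Lpn p G)"
    using B(1) by (subst nn_integral_cmult_indicator) (simp_all add: ennreal_mult mult_ac)
  finally show ?thesis using B(2,3) by (subst (asm) ennreal_mult_le_mult_iff) auto
qed

section \<open>Integrals of powers of the norm\<close>

lemma powr_le_two_powr_scaled:
  fixes t r c :: real
  assumes "r > 0" "r \<le> t" "t \<le> 2 * r"
  shows "t powr c \<le> 2 powr \<bar>c\<bar> * r powr c"
proof -
  have "t powr c = (t / r) powr c * r powr c" using powr_mult[of "t / r" r c] assms by simp
  also have "(t / r) powr c \<le> (t / r) powr \<bar>c\<bar>"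
    using assms by (intro powr_mono) (auto simp: field_simps)
  also have "\<dots> \<le> 2 powr \<bar>c\<bar>" using assms by (intro powr_mono2) (auto simp: field_simps)
  finally show ?thesis by (simp add: mult_right_mono)
qed

lemma ennreal_le_suminf: "f n \<le> (\<Sum>n. f n :: ennreal)"
  using sum_le_suminf[of f "{n}"] by simp

lemma emeasure_lborel_cball:
  assumes "r \<ge> 0"
  shows "emeasure lborel (cball (x::'a::euclidean_space) r)
    = ennreal (measure lborel (cball (0::'a) 1) * r ^ DIM('a))"
  using content_cball[OF assms, of x] content_cball[of 1 "0::'a"]
  by (simp add: emeasure_lborel_bounded)

lemma nn_integral_norm_powr_annuli_finite:
  fixes S :: "'a::euclidean_space set"
  assumes r: "\<And>n. r n > 0" and cover: "\<And>z. z \<in> S \<Longrightarrow> \<exists>n. r n \<le> norm z \<and> norm z \<le> 2 * r n"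
    and summable: "summable (\<lambda>n. r n powr (c + real DIM('a)))"
  shows "(\<integral>\<^sup>+z\<in>S. ennreal (norm z powr c) \<partial>lborel) < \<infinity>"
proof -
  define b where "b = 2 powr \<bar>c\<bar> * measure lborel (cball (0::'a) 1) * 2 ^ DIM('a)"
  let ?term = "\<lambda>n z. ennreal (2 powr \<bar>c\<bar> * r n powr c) * indicator (cball (0::'a) (2 * r n)) z"
  have "ennreal (norm z powr c) * indicator S z \<le> (\<Sum>n. ?term n z)" for z :: 'a
  proof (cases "z \<in> S")
    case True
    then obtain n where "r n \<le> norm z" "norm z \<le> 2 * r n" using cover by blast
    then have "ennreal (norm z powr c) \<le> ?term n z"
      using r[of n] powr_le_two_powr_scaled[of "r n" "norm z" c] by (auto intro!: ennreal_leI)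
    also have "\<dots> \<le> (\<Sum>n. ?term n z)" by (rule ennreal_le_suminf)
    finally show ?thesis using True by simp
  qed simp
  then have "(\<integral>\<^sup>+z\<in>S. ennreal (norm z powr c) \<partial>lborel) \<le> (\<integral>\<^sup>+z. (\<Sum>n. ?term n z) \<partial>lborel)"
    by (rule nn_integral_mono)
  also have "\<dots> = (\<Sum>n. \<integral>\<^sup>+z. ?term n z \<partial>lborel)"
    by (intro nn_integral_suminf borel_measurable_times_ennreal borel_measurable_const
        borel_measurable_indicator) simp
  also have "\<dots> = (\<Sum>n. ennreal (b * r n powr (c + real DIM('a))))"
  proof (intro suminf_cong)
    fix n
    have "(\<integral>\<^sup>+z. ?term n z \<partial>lborel) = ennreal (2 powr \<bar>c\<bar> * r n powr c *
        (measure lborel (cball (0::'a) 1) * (2 * r n) ^ DIM('a)))"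
      using r[of n] by (simp add: nn_integral_cmult_indicator emeasure_lborel_cball ennreal_mult)
    then show "(\<integral>\<^sup>+z. ?term n z \<partial>lborel) = ennreal (b * r n powr (c + real DIM('a)))"
      using r[of n] by (simp add: b_def powr_add powr_realpow power_mult_distrib mult_ac)
  qed
  also have "\<dots> = ennreal (\<Sum>n. b * r n powr (c + real DIM('a)))"
    by (intro suminf_ennreal2 summable_mult summable) (simp add: b_def)
  also have "\<dots> < \<infinity>" by simp
  finally show ?thesis .
qed

lemma dyadic_floor:
  assumes "(t::real) \<ge> 1"
  obtains n :: nat where "2 ^ n \<le> t" "t < 2 * 2 ^ n"
proof -
  define n where "n = nat \<lfloor>log 2 t\<rfloor>"
  have "log 2 t \<ge> 0" using assms by simp
  then have "real n \<le> log 2 t" "log 2 t < real n + 1" unfolding n_def by linarith+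
  then have "2 powr real n \<le> t" "t < 2 powr (real n + 1)"
    using assms by (auto simp: le_log_iff log_less_iff)
  then show ?thesis using that[of n] by (simp add: powr_add powr_realpow)
qed

lemma nn_integral_norm_powr_near_finite:
  assumes "a > 0"
  shows "(\<integral>\<^sup>+z\<in>ball (0::'a::euclidean_space) 2 - {0}.
      ennreal (norm z powr (a - real DIM('a))) \<partial>lborel) < \<infinity>"
proof (rule nn_integral_norm_powr_annuli_finite[where r = "\<lambda>n. 1 / 2 ^ n"])
  fix z :: 'a assume z: "z \<in> ball 0 2 - {0}"
  then obtain n where "2 ^ n \<le> 2 / norm z" "2 / norm z < 2 * 2 ^ n"
    using dyadic_floor[of "2 / norm z"] by auto
  then show "\<exists>n. 1 / 2 ^ n \<le> norm z \<and> norm z \<le> 2 * (1 / 2 ^ n)"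
    using z by (intro exI[of _ n]) (auto simp: field_simps)
next
  have "(1 / 2 ^ n) powr (a - real DIM('a) + real DIM('a)) = (2 powr - a) ^ n" for n :: nat
    by (simp add: powr_divide powr_realpow[symmetric] powr_powr powr_minus field_simps)
  moreover have "summable (\<lambda>n. (2 powr - a) ^ n)"
    using assms by (intro summable_geometric) (simp add: powr_minus_divide)
  ultimately show "summable (\<lambda>n. (1 / 2 ^ n) powr (a - real DIM('a) + real DIM('a)))" by simp
qed simp

lemma nn_integral_norm_powr_far_finite:
  assumes "a > 0" "\<rho> > 0"
  shows "(\<integral>\<^sup>+z\<in>- ball (0::'a::euclidean_space) \<rho>.
      ennreal (norm z powr (- (real DIM('a) + a))) \<partial>lborel) < \<infinity>"
proof (rule nn_integral_norm_powr_annuli_finite[where r = "\<lambda>n. \<rho> * 2 ^ n"])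
  fix z :: 'a assume "z \<in> - ball 0 \<rho>"
  then have "norm z / \<rho> \<ge> 1" using assms by simp
  from dyadic_floor[OF this] obtain n where "2 ^ n \<le> norm z / \<rho>" "norm z / \<rho> < 2 * 2 ^ n" .
  then show "\<exists>n. \<rho> * 2 ^ n \<le> norm z \<and> norm z \<le> 2 * (\<rho> * 2 ^ n)"
    using assms by (intro exI[of _ n]) (auto simp: field_simps)
next
  have "(\<rho> * 2 ^ n) powr (- (real DIM('a) + a) + real DIM('a)) = \<rho> powr - a * (2 powr - a) ^ n"
    for n :: nat
    using assms by (simp add: powr_mult powr_realpow[symmetric] powr_powr mult.commute)
  moreover have "summable (\<lambda>n. \<rho> powr - a * (2 powr - a) ^ n)"
    using assms by (intro summable_mult summable_geometric) (simp add: powr_minus_divide)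
  ultimately show "summable (\<lambda>n. (\<rho> * 2 ^ n) powr (- (real DIM('a) + a) + real DIM('a)))" by simp
qed (use assms in auto)

section \<open>Pointwise inequalities for the nonlocal term\<close>

lemma ppow_minus: "ppow p (- t) = - ppow p t"
  by (simp add: ppow_def)

lemma ppow_nonneg_eq: "t \<ge> 0 \<Longrightarrow> ppow p t = t powr (p - 1)"
  by (cases "t = 0") (auto simp: ppow_def powr_diff power2_eq_square field_simps)

lemma weighted_powr_diff_le:
  fixes a b t\<^sub>1 t\<^sub>2 p :: real
  assumes "0 \<le> b" "b \<le> a" "0 \<le> t\<^sub>1" "t\<^sub>1 \<le> t\<^sub>2" "p > 1"
  shows "b * (t\<^sub>2 powr p - t\<^sub>1 powr p) \<le> a * (p * t\<^sub>2 powr (p - 1) * (t\<^sub>2 - t\<^sub>1))"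
proof -
  have "t\<^sub>2 powr p - t\<^sub>1 powr p \<le> p * t\<^sub>2 powr (p - 1) * (t\<^sub>2 - t\<^sub>1)"
    using powr_tangent[of t\<^sub>1 t\<^sub>2 p] assms by (simp add: algebra_simps)
  then show ?thesis using assms by (intro mult_mono) (auto simp: powr_mono2)
qed

lemma weight_gap_le:
  fixes a b t\<^sub>1 t\<^sub>2 p :: real
  assumes ab: "0 \<le> b" "b \<le> a" and t: "t\<^sub>1 \<le> t\<^sub>2" "t\<^sub>2 \<le> 2 * t\<^sub>1" "t\<^sub>2 > 0" and p: "p > 1"
    and sign: "a * t\<^sub>1 powr p \<le> b * t\<^sub>2 powr p"
  shows "(a - b) * t\<^sub>2 \<le> (p * 2 powr p) * (a * (t\<^sub>2 - t\<^sub>1))"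
proof -
  have "(a - b) * (t\<^sub>2 powr p / 2 powr p) \<le> (a - b) * t\<^sub>1 powr p"
    using ab t p by (intro mult_left_mono) (auto simp flip: powr_divide intro!: powr_mono2)
  also have "\<dots> \<le> b * (t\<^sub>2 powr p - t\<^sub>1 powr p)" using sign by (simp add: algebra_simps)
  also have "\<dots> \<le> a * (p * t\<^sub>2 powr (p - 1) * (t\<^sub>2 - t\<^sub>1))"
    using ab t p by (intro weighted_powr_diff_le) auto
  finally have "(a - b) * t\<^sub>2 powr p \<le> 2 powr p * (a * (p * t\<^sub>2 powr (p - 1) * (t\<^sub>2 - t\<^sub>1)))"
    by (simp add: field_simps)
  moreover have "t\<^sub>2 powr p = t\<^sub>2 powr (p - 1) * t\<^sub>2" using t by (simp add: powr_diff)
  ultimately have "t\<^sub>2 powr (p - 1) * ((a - b) * t\<^sub>2)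
      \<le> t\<^sub>2 powr (p - 1) * ((p * 2 powr p) * (a * (t\<^sub>2 - t\<^sub>1)))" by (simp add: mult_ac)
  then show ?thesis using t(3) by (subst (asm) mult_le_cancel_left_pos) auto
qed

definition nonlocal_const :: "real \<Rightarrow> real" where
  "nonlocal_const p = 2 powr p + (p * 2 powr p) powr (p - 1) * p"

lemma nonlocal_const_pos: "p > 1 \<Longrightarrow> nonlocal_const p > 0"
  by (auto simp: nonlocal_const_def intro!: add_pos_nonneg)

lemma powr_minus_one_mult_self: "t \<ge> 0 \<Longrightarrow> t powr (p - 1) * t = t powr p" for t :: real
  by (cases "t = 0") (simp_all add: powr_diff)

lemma nonlocal_core_far:
  fixes a b t\<^sub>1 t\<^sub>2 d p :: real
  assumes ab: "0 \<le> b" "b \<le> a" and t: "0 \<le> t\<^sub>2" "t\<^sub>2 \<le> 2 * d" and p: "p > 1"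
    and sign: "a * t\<^sub>1 powr p \<le> b * t\<^sub>2 powr p"
  shows "(a - b) powr (p - 1) * (b * t\<^sub>2 powr p - a * t\<^sub>1 powr p)
      \<le> 2 powr p * (a powr p * d powr p)"
proof -
  have "b * t\<^sub>2 powr p \<le> a * (2 * d) powr p" using ab t p by (intro mult_mono powr_mono2) auto
  moreover have "0 \<le> a * t\<^sub>1 powr p" using ab by simp
  ultimately have "b * t\<^sub>2 powr p - a * t\<^sub>1 powr p \<le> a * (2 * d) powr p" by linarith
  then have "(a - b) powr (p - 1) * (b * t\<^sub>2 powr p - a * t\<^sub>1 powr p)
      \<le> a powr (p - 1) * (a * (2 * d) powr p)"
    using ab p sign by (intro mult_mono powr_mono2) auto
  also have "\<dots> = 2 powr p * ((a powr (p - 1) * a) * d powr p)"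
    using t by (simp add: powr_mult mult_ac)
  finally show ?thesis using powr_minus_one_mult_self[of a p] ab by simp
qed

lemma nonlocal_core_near:
  fixes a b t\<^sub>1 t\<^sub>2 p :: real
  assumes ab: "0 \<le> b" "b \<le> a" and t: "0 \<le> t\<^sub>1" "t\<^sub>1 < t\<^sub>2" "t\<^sub>2 \<le> 2 * t\<^sub>1" and p: "p > 1"
    and sign: "a * t\<^sub>1 powr p \<le> b * t\<^sub>2 powr p"
  shows "(a - b) powr (p - 1) * (b * t\<^sub>2 powr p - a * t\<^sub>1 powr p)
    \<le> (p * 2 powr p) powr (p - 1) * p * (a powr p * (t\<^sub>2 - t\<^sub>1) powr p)"
proof -
  define d where "d = t\<^sub>2 - t\<^sub>1"
  have d: "0 \<le> d" and t\<^sub>2: "0 < t\<^sub>2" using t by (auto simp: d_def)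
  have "b * t\<^sub>2 powr p - a * t\<^sub>1 powr p \<le> b * (t\<^sub>2 powr p - t\<^sub>1 powr p)"
    using ab by (simp add: algebra_simps mult_right_mono)
  also have "\<dots> \<le> a * (p * t\<^sub>2 powr (p - 1) * d)"
    unfolding d_def using ab t p by (intro weighted_powr_diff_le) auto
  finally have "(a - b) powr (p - 1) * (b * t\<^sub>2 powr p - a * t\<^sub>1 powr p)
      \<le> (a - b) powr (p - 1) * (a * (p * t\<^sub>2 powr (p - 1) * d))" by (intro mult_left_mono) auto
  also have "\<dots> = ((a - b) * t\<^sub>2) powr (p - 1) * (p * a * d)"
    using ab t by (simp add: powr_mult mult_ac)
  also have "\<dots> \<le> ((p * 2 powr p) * (a * d)) powr (p - 1) * (p * a * d)"
    using weight_gap_le[OF ab _ t(3) t\<^sub>2 p sign] ab t p d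
    by (intro mult_right_mono powr_mono2) (auto simp: d_def)
  also have "\<dots> = (p * 2 powr p) powr (p - 1) * p * ((a powr (p - 1) * a) * (d powr (p - 1) * d))"
    using ab d p by (simp add: powr_mult mult_ac)
  finally show ?thesis
    using powr_minus_one_mult_self[of a p] powr_minus_one_mult_self[of d p] ab d
    by (simp add: d_def)
qed

text \<open>If the cutoff values differ by at least half of the larger one, the bound is trivial; otherwise
  the sign condition makes \<open>a - b\<close> itself of order \<open>a (t\<^sub>2 - t\<^sub>1) / t\<^sub>2\<close>.\<close>
lemma nonlocal_core:
  fixes a b t\<^sub>1 t\<^sub>2 p :: real
  assumes ab: "0 \<le> b" "b \<le> a" and t: "0 \<le> t\<^sub>1" "0 \<le> t\<^sub>2" and p: "p > 1"
    and sign: "a * t\<^sub>1 powr p \<le> b * t\<^sub>2 powr p"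
  shows "(a - b) powr (p - 1) * (b * t\<^sub>2 powr p - a * t\<^sub>1 powr p)
    \<le> nonlocal_const p * (a powr p * \<bar>t\<^sub>1 - t\<^sub>2\<bar> powr p)"
proof -
  have const: "0 \<le> 2 powr p * (a powr p * \<bar>t\<^sub>1 - t\<^sub>2\<bar> powr p)"
    "0 \<le> (p * 2 powr p) powr (p - 1) * p * (a powr p * \<bar>t\<^sub>1 - t\<^sub>2\<bar> powr p)" using p by simp_all
  consider (far) "t\<^sub>2 \<le> 2 * \<bar>t\<^sub>1 - t\<^sub>2\<bar>" | (swapped) "t\<^sub>2 \<le> t\<^sub>1"
    | (near) "t\<^sub>1 < t\<^sub>2" "\<not> t\<^sub>2 \<le> 2 * \<bar>t\<^sub>1 - t\<^sub>2\<bar>"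
    by linarith
  then show ?thesis
  proof cases
    case far
    show ?thesis
      using nonlocal_core_far[OF ab t(2) far p sign] const
      unfolding nonlocal_const_def distrib_right by linarith
  next
    case swapped
    then have "b * t\<^sub>2 powr p \<le> a * t\<^sub>1 powr p" using ab t p by (intro mult_mono powr_mono2) auto
    then have "b * t\<^sub>2 powr p - a * t\<^sub>1 powr p = 0" using sign by simp
    then show ?thesis using nonlocal_const_pos[OF p] by simp
  next
    case near
    then have half: "t\<^sub>2 \<le> 2 * t\<^sub>1" and gap: "t\<^sub>2 - t\<^sub>1 = \<bar>t\<^sub>1 - t\<^sub>2\<bar>" by auto
    show ?thesis
      using nonlocal_core_near[OF ab t(1) near(1) half p sign] const
      unfolding gap nonlocal_const_def distrib_right by linarith
  qed
qed

lemma nonlocal_pointwise_ordered: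
  fixes U V k t\<^sub>1 t\<^sub>2 p :: real
  assumes VU: "V \<le> U" and t: "0 \<le> t\<^sub>1" "0 \<le> t\<^sub>2" and p: "p > 1"
  shows "- (ppow p (U - V) * (max 0 (U - k) * t\<^sub>1 powr p - max 0 (V - k) * t\<^sub>2 powr p))
     \<le> nonlocal_const p * ((max 0 (U - k) powr p + max 0 (V - k) powr p) * \<bar>t\<^sub>1 - t\<^sub>2\<bar> powr p)"
proof -
  define a where "a = max 0 (U - k)"
  define b where "b = max 0 (V - k)"
  have ab: "0 \<le> b" "b \<le> a" using VU by (auto simp: a_def b_def)
  have "- (ppow p (U - V) * (a * t\<^sub>1 powr p - b * t\<^sub>2 powr p))
      \<le> nonlocal_const p * ((a powr p + b powr p) * \<bar>t\<^sub>1 - t\<^sub>2\<bar> powr p)"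
  proof (cases "b > 0 \<and> a * t\<^sub>1 powr p \<le> b * t\<^sub>2 powr p")
    case True
    then have diff: "U - V = a - b" using VU by (auto simp: a_def b_def max_def split: if_splits)
    have "ppow p (U - V) = (a - b) powr (p - 1)" unfolding diff
      using ab by (intro ppow_nonneg_eq) simp
    then have "- (ppow p (U - V) * (a * t\<^sub>1 powr p - b * t\<^sub>2 powr p))
        = (a - b) powr (p - 1) * (b * t\<^sub>2 powr p - a * t\<^sub>1 powr p)"
      by (simp add: algebra_simps)
    also have "\<dots> \<le> nonlocal_const p * (a powr p * \<bar>t\<^sub>1 - t\<^sub>2\<bar> powr p)"
      using True by (intro nonlocal_core[OF ab t p]) simp
    also have "\<dots> \<le> nonlocal_const p * ((a powr p + b powr p) * \<bar>t\<^sub>1 - t\<^sub>2\<bar> powr p)"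
      using nonlocal_const_pos[OF p] by (intro mult_left_mono mult_right_mono) auto
    finally show ?thesis .
  next
    case False
    then have "b * t\<^sub>2 powr p \<le> a * t\<^sub>1 powr p" using ab by (cases "b = 0") auto
    then have "0 \<le> ppow p (U - V) * (a * t\<^sub>1 powr p - b * t\<^sub>2 powr p)"
      using VU by (simp add: ppow_nonneg_eq)
    moreover have "0 \<le> nonlocal_const p * ((a powr p + b powr p) * \<bar>t\<^sub>1 - t\<^sub>2\<bar> powr p)"
      using nonlocal_const_pos[OF p] by simp
    ultimately show ?thesis by linarith
  qed
  then show ?thesis by (simp add: a_def b_def)
qed

lemma nonlocal_pointwise:
  fixes U V k t\<^sub>1 t\<^sub>2 p :: real
  assumes "0 \<le> t\<^sub>1" "0 \<le> t\<^sub>2" "p > 1"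
  shows "- (ppow p (U - V) * (max 0 (U - k) * t\<^sub>1 powr p - max 0 (V - k) * t\<^sub>2 powr p))
     \<le> nonlocal_const p * ((max 0 (U - k) powr p + max 0 (V - k) powr p) * \<bar>t\<^sub>1 - t\<^sub>2\<bar> powr p)"
proof (cases "V \<le> U")
  case False
  have "ppow p (U - V) = - ppow p (V - U)" using ppow_minus[of p "V - U"] by simp
  then show ?thesis
    using nonlocal_pointwise_ordered[of U V t\<^sub>2 t\<^sub>1 p k] False assms
    by (simp add: algebra_simps abs_minus_commute)
qed (use nonlocal_pointwise_ordered assms in blast)

lemma nonlocal_pointwise_tail:
  fixes U V k t p :: real
  assumes "0 \<le> t" "t \<le> 1" and p: "p > 1"
  shows "- (ppow p (U - V) * (max 0 (U - k) * t powr p))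
      \<le> max 0 (U - k) * max 0 (V - k) powr (p - 1)"
proof -
  consider (nonneg) "V \<le> U" | (below) "U < V" "U \<le> k" | (above) "U < V" "k < U" by linarith
  then show ?thesis
  proof cases
    case nonneg
    then have "0 \<le> ppow p (U - V) * (max 0 (U - k) * t powr p)" by (simp add: ppow_nonneg_eq)
    moreover have "0 \<le> max 0 (U - k) * max 0 (V - k) powr (p - 1)" by simp
    ultimately show ?thesis by linarith
  next
    case above
    have "ppow p (U - V) = - ((V - U) powr (p - 1))"
      using ppow_minus[of p "V - U"] ppow_nonneg_eq[of "V - U" p] above by simp
    then have "- (ppow p (U - V) * (max 0 (U - k) * t powr p))
        = (U - k) * ((V - U) powr (p - 1) * t powr p)"
      using above by simp
    also have "\<dots> \<le> (U - k) * ((V - k) powr (p - 1) * 1)"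
      using above assms by (intro mult_left_mono mult_mono powr_mono2 powr_le1) auto
    finally show ?thesis using above by simp
  qed simp
qed

section \<open>Cutoff functions and the local term\<close>

definition smoothstep :: "real \<Rightarrow> real" where
  "smoothstep t = 2 * (max 0 (t - 0))\<^sup>2 - 4 * (max 0 (t - 1/2))\<^sup>2 + 2 * (max 0 (t - 1))\<^sup>2"

definition smoothstep' :: "real \<Rightarrow> real" where
  "smoothstep' t = 2 * (2 * max 0 (t - 0)) - 4 * (2 * max 0 (t - 1/2)) + 2 * (2 * max 0 (t - 1))"

lemma smoothstep_derivative: "(smoothstep has_real_derivative smoothstep' t) (at t)"
  unfolding smoothstep_def[abs_def] smoothstep'_def
  by (intro DERIV_add DERIV_diff DERIV_cmult pos_square_derivative)

lemma continuous_on_smoothstep': "continuous_on S smoothstep'"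
  unfolding smoothstep'_def[abs_def] by (intro continuous_intros)

lemma smoothstep_eq_0: "t \<le> 0 \<Longrightarrow> smoothstep t = 0"
  by (simp add: smoothstep_def)

lemma smoothstep_eq_1: "t \<ge> 1 \<Longrightarrow> smoothstep t = 1"
  by (simp add: smoothstep_def power2_eq_square algebra_simps)

lemma smoothstep_bounds: "0 \<le> smoothstep t \<and> smoothstep t \<le> 1 \<and> \<bar>smoothstep' t\<bar> \<le> 2"
proof -
  consider (zero) "t \<le> 0" | (left) "0 < t" "t \<le> 1/2" | (right) "1/2 < t" "t \<le> 1" | (one) "t > 1"
    by linarith
  then show ?thesis
  proof cases
    case left
    have "t\<^sup>2 \<le> (1/2)\<^sup>2" using left by (intro power_mono) auto
    then show ?thesis using left by (auto simp: smoothstep_def smoothstep'_def power2_eq_square)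
  next
    case right
    have "smoothstep t = 1 - 2 * (1 - t)\<^sup>2"
      using right by (simp add: smoothstep_def power2_eq_square algebra_simps)
    moreover have "(1 - t)\<^sup>2 \<le> (1/2)\<^sup>2" using right by (intro power_mono) auto
    ultimately show ?thesis using right by (auto simp: smoothstep'_def power2_eq_square)
  next
    case one
    then show ?thesis by (auto simp: smoothstep_eq_1 smoothstep'_def)
  qed (auto simp: smoothstep_def smoothstep'_def)
qed

lemma C1_grad_dist_square:
  "C1_grad (\<lambda>x. (dist x0 x)\<^sup>2) (\<lambda>x. 2 *\<^sub>R (x - x0))" for x0 :: "'a::euclidean_space"
  unfolding C1_grad_def
proof (intro conjI allI)
  fix x
  have "((\<lambda>x. (x - x0) \<bullet> (x - x0)) has_derivative
      (\<lambda>h. (x - x0) \<bullet> (h - 0) + (h - 0) \<bullet> (x - x0))) (at x)"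
    by (intro has_derivative_inner has_derivative_diff has_derivative_ident has_derivative_const)
  then show "((\<lambda>x. (dist x0 x)\<^sup>2) has_derivative (\<lambda>h. 2 *\<^sub>R (x - x0) \<bullet> h)) (at x)"
    by (simp add: dist_norm norm_minus_commute[of x0] power2_norm_eq_inner
      inner_commute[of _ "x - x0"])
qed (intro continuous_intros)

definition cutoff :: "'a::euclidean_space \<Rightarrow> real \<Rightarrow> real \<Rightarrow> ('a \<Rightarrow> real) \<Rightarrow> ('a \<Rightarrow> 'a) \<Rightarrow> bool" where
  "cutoff x0 \<sigma> L \<eta> D\<eta> \<longleftrightarrow> C1_grad \<eta> D\<eta> \<and> (\<forall>x. 0 \<le> \<eta> x \<and> \<eta> x \<le> 1) \<and>
     vanishes_outside (cball x0 \<sigma>) \<eta> \<and> (\<forall>x. norm (D\<eta> x) \<le> L)"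

lemma cutoffD:
  assumes "cutoff x0 \<sigma> L \<eta> D\<eta>"
  shows "C1_grad \<eta> D\<eta>" "0 \<le> \<eta> x" "\<eta> x \<le> 1" "vanishes_outside (cball x0 \<sigma>) \<eta>"
    "vanishes_outside (cball x0 \<sigma>) D\<eta>" "norm (D\<eta> x) \<le> L" "0 \<le> L"
  using assms C1_grad_vanishes_outside[of \<eta> D\<eta> "cball x0 \<sigma>"] order_trans[OF norm_ge_zero]
  by (auto simp: cutoff_def)

definition radial_cutoff :: "'a::euclidean_space \<Rightarrow> real \<Rightarrow> real \<Rightarrow> 'a \<Rightarrow> real" where
  "radial_cutoff x0 \<rho> \<sigma> x = smoothstep ((\<sigma>\<^sup>2 - (dist x0 x)\<^sup>2) / (\<sigma>\<^sup>2 - \<rho>\<^sup>2))"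

definition radial_cutoff_grad :: "'a::euclidean_space \<Rightarrow> real \<Rightarrow> real \<Rightarrow> 'a \<Rightarrow> 'a" where
  "radial_cutoff_grad x0 \<rho> \<sigma> x =
     (smoothstep' ((\<sigma>\<^sup>2 - (dist x0 x)\<^sup>2) / (\<sigma>\<^sup>2 - \<rho>\<^sup>2)) * (- 1 / (\<sigma>\<^sup>2 - \<rho>\<^sup>2))) *\<^sub>R (2 *\<^sub>R (x - x0))"

lemma square_gap_pos: "0 < \<rho> \<Longrightarrow> \<rho> < \<sigma> \<Longrightarrow> 0 < \<sigma>\<^sup>2 - \<rho>\<^sup>2" for \<rho> \<sigma> :: real
  by (simp add: power_strict_mono)

lemma radial_cutoff_C1_grad:
  fixes x0 :: "'a::euclidean_space"
  assumes "0 < \<rho>" "\<rho> < \<sigma>"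
  shows "C1_grad (radial_cutoff x0 \<rho> \<sigma>) (radial_cutoff_grad x0 \<rho> \<sigma>)"
proof -
  define m where "m = \<sigma>\<^sup>2 - \<rho>\<^sup>2"
  have m: "m > 0" using square_gap_pos[OF assms] by (simp add: m_def)
  have "((\<lambda>t. smoothstep ((\<sigma>\<^sup>2 - t) / m)) has_real_derivative smoothstep' ((\<sigma>\<^sup>2 - t) / m)
      * (- 1 / m)) (at t)" for t
    by (rule DERIV_chain2[OF smoothstep_derivative]) (use m in \<open>auto intro!: derivative_eq_intros\<close>)
  moreover have "continuous_on UNIV (\<lambda>t. smoothstep' ((\<sigma>\<^sup>2 - t) / m) * (- 1 / m))"
    using m by (intro continuous_intros
        continuous_on_compose2[OF continuous_on_smoothstep'[of UNIV]]) auto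
  ultimately show ?thesis
    unfolding radial_cutoff_def[abs_def] radial_cutoff_grad_def[abs_def] m_def[symmetric]
    by (intro C1_grad_compose[OF C1_grad_dist_square])
qed

lemma radial_cutoff_support:
  assumes "0 < \<rho>" "\<rho> < \<sigma>"
  shows "vanishes_outside (cball x0 \<sigma>) (radial_cutoff x0 \<rho> \<sigma>)"
  unfolding vanishes_outside_def
proof (intro allI impI)
  fix x assume "x \<notin> cball x0 \<sigma>"
  then have "\<sigma>\<^sup>2 \<le> (dist x0 x)\<^sup>2" using assms by (intro power_mono) auto
  then show "radial_cutoff x0 \<rho> \<sigma> x = 0"
    unfolding radial_cutoff_def
    using square_gap_pos[OF assms] by (intro smoothstep_eq_0) (simp add: divide_le_0_iff)
qed

lemma radial_cutoff_grad_le: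
  fixes x0 :: "'a::euclidean_space"
  assumes \<rho>: "0 < \<rho>" "\<rho> < \<sigma>"
  shows "norm (radial_cutoff_grad x0 \<rho> \<sigma> x) \<le> 4 / (\<sigma> - \<rho>)"
proof (cases "x \<in> cball x0 \<sigma>")
  case True
  define m where "m = \<sigma>\<^sup>2 - \<rho>\<^sup>2"
  have m: "m > 0" "m = (\<sigma> - \<rho>) * (\<sigma> + \<rho>)"
    using square_gap_pos[OF assms] by (auto simp: m_def power2_eq_square algebra_simps)
  have "norm (radial_cutoff_grad x0 \<rho> \<sigma> x)
      = \<bar>smoothstep' ((\<sigma>\<^sup>2 - (dist x0 x)\<^sup>2) / m)\<bar> * (2 / m * dist x0 x)"
    using m(1)
    by (simp add: radial_cutoff_grad_def flip: m_def)
      (simp add: dist_norm norm_minus_commute abs_mult)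
  also have "\<dots> \<le> 2 * (2 / m * \<sigma>)" using smoothstep_bounds True m(1) by (intro mult_mono) auto
  also have "\<dots> = 4 / (\<sigma> - \<rho>) * (\<sigma> / (\<sigma> + \<rho>))" by (simp add: m(2))
  also have "\<dots> \<le> 4 / (\<sigma> - \<rho>) * 1" using \<rho> by (intro mult_left_mono) auto
  finally show ?thesis by simp
next
  case False
  have "radial_cutoff_grad x0 \<rho> \<sigma> x = 0"
    by (rule vanishes_outsideD[OF
      C1_grad_vanishes_outside[OF radial_cutoff_C1_grad[OF \<rho>] closed_cball
            radial_cutoff_support[OF \<rho>]] False])
  then show ?thesis using \<rho> by simp
qed

lemma cutoff_exists:
  fixes x0 :: "'a::euclidean_space"
  assumes \<rho>: "0 < \<rho>" "\<rho> < \<sigma>"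
  obtains \<eta> D\<eta> where "cutoff x0 \<sigma> (4 / (\<sigma> - \<rho>)) \<eta> D\<eta>" "\<And>x. x \<in> ball x0 \<rho> \<Longrightarrow> \<eta> x = 1"
proof
  show "cutoff x0 \<sigma> (4 / (\<sigma> - \<rho>)) (radial_cutoff x0 \<rho> \<sigma>) (radial_cutoff_grad x0 \<rho> \<sigma>)"
    using radial_cutoff_C1_grad[OF \<rho>, of x0] radial_cutoff_support[OF \<rho>, of x0]
      radial_cutoff_grad_le[OF \<rho>, of x0] smoothstep_bounds
    by (simp add: cutoff_def radial_cutoff_def)
  fix x assume "x \<in> ball x0 \<rho>"
  then have "(dist x0 x)\<^sup>2 \<le> \<rho>\<^sup>2" by (intro power_mono) auto
  then show "radial_cutoff x0 \<rho> \<sigma> x = 1"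
    unfolding radial_cutoff_def using square_gap_pos[OF \<rho>] by (intro smoothstep_eq_1) simp
qed

lemma C1_grad_powr:
  assumes "C1_grad \<eta> D" "\<And>x. 0 \<le> \<eta> x" "p > 1"
  shows "C1_grad (\<lambda>x. \<eta> x powr p) (\<lambda>x. (p * \<eta> x powr (p - 1)) *\<^sub>R D x)"
proof -
  have "continuous_on UNIV (\<lambda>t::real. p * max 0 t powr (p - 1))"
    using assms(3) by (intro continuous_intros continuous_on_powr') auto
  from C1_grad_compose[OF assms(1) pos_powr_derivative[OF assms(3)] this]
  show ?thesis using assms(2) by (simp add: max_absorb2)
qed

definition young_const :: "real \<Rightarrow> real \<Rightarrow> real \<Rightarrow> real" where
  "young_const p C1 C2 = p * C2 * (C1 / (2 * p * C2)) powr (1 - p)"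

lemma young_const_nonneg: "p > 0 \<Longrightarrow> C2 > 0 \<Longrightarrow> 0 \<le> young_const p C1 C2"
  by (simp add: young_const_def)

lemma scaled_Young:
  fixes A E :: real
  assumes p: "p > 1" and C: "C1 > 0" "C2 > 0" and A: "A \<ge> 0" and E: "E \<ge> 0"
  shows "p * C2 * (A powr (p - 1) * E) \<le> C1 / 2 * A powr p + young_const p C1 C2 * E powr p"
proof -
  define \<epsilon> where "\<epsilon> = C1 / (2 * p * C2)"
  have \<epsilon>: "\<epsilon> > 0" using p C by (simp add: \<epsilon>_def)
  show ?thesis
  proof (cases "E \<le> \<epsilon> * A")
    case True
    have "p * C2 * (A powr (p - 1) * E) \<le> p * C2 * (A powr (p - 1) * (\<epsilon> * A))"
      using True p C by (intro mult_left_mono) auto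
    also have "\<dots> = C1 / 2 * A powr p"
      using p C A by (cases "A = 0") (auto simp: \<epsilon>_def powr_diff field_simps)
    also have "\<dots> \<le> C1 / 2 * A powr p + young_const p C1 C2 * E powr p"
      using young_const_nonneg[of p C2 C1] p C by simp
    finally show ?thesis .
  next
    case False
    then have E_pos: "E > 0" using mult_nonneg_nonneg[of \<epsilon> A] A \<epsilon> by linarith
    have "A powr (p - 1) \<le> (E / \<epsilon>) powr (p - 1)"
      using False \<epsilon> A p by (intro powr_mono2) (auto simp: field_simps)
    also have "\<dots> = E powr (p - 1) * \<epsilon> powr (1 - p)"
      using E_pos \<epsilon> by (simp add: powr_divide powr_diff field_simps)
    finally have "p * C2 * (A powr (p - 1) * E) \<le> p * C2 * (E powr (p - 1) * \<epsilon> powr (1 - p) * E)"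
      using p C E by (intro mult_left_mono mult_right_mono) auto
    also have "\<dots> = young_const p C1 C2 * E powr p"
      using E_pos by (simp add: young_const_def \<epsilon>_def[symmetric] powr_diff)
    also have "\<dots> \<le> C1 / 2 * A powr p + young_const p C1 C2 * E powr p" using C by simp
    finally show ?thesis .
  qed
qed

lemma local_Young:
  fixes b G d :: "'a::euclidean_space"
  assumes p: "p > 1" and C: "C1 > 0" "C2 > 0" and t: "0 \<le> t" and w: "0 \<le> w"
    and b: "b \<bullet> G \<ge> C1 * norm G powr p" "norm b \<le> C2 * norm G powr (p - 1)"
  shows "b \<bullet> (t powr p *\<^sub>R G + w *\<^sub>R ((p * t powr (p - 1)) *\<^sub>R d))
     \<ge> C1 / 2 * (t * norm G) powr p - young_const p C1 C2 * (w * norm d) powr p"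
proof -
  define A where "A = t * norm G"
  define E where "E = w * norm d"
  have coercive: "t powr p * (b \<bullet> G) \<ge> C1 * A powr p"
    using mult_left_mono[OF b(1), of "t powr p"] t by (simp add: A_def powr_mult mult_ac)
  have "\<bar>b \<bullet> d\<bar> \<le> C2 * norm G powr (p - 1) * norm d"
    using Cauchy_Schwarz_ineq2[of b d] mult_right_mono[OF b(2) norm_ge_zero[of d]] by linarith
  then have "\<bar>w * (p * t powr (p - 1)) * (b \<bullet> d)\<bar>
      \<le> w * (p * t powr (p - 1)) * (C2 * norm G powr (p - 1) * norm d)"
    using w p by (simp add: abs_mult mult_left_mono)
  also have "\<dots> = p * C2 * (A powr (p - 1) * E)" using t by (simp add: A_def E_def powr_mult mult_ac)
  also have "\<dots> \<le> C1 / 2 * A powr p + young_const p C1 C2 * E powr p"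
    using t w by (intro scaled_Young p C) (auto simp: A_def E_def)
  finally have cross: "\<bar>w * (p * t powr (p - 1)) * (b \<bullet> d)\<bar>
      \<le> C1 / 2 * A powr p + young_const p C1 C2 * E powr p" .
  have "b \<bullet> (t powr p *\<^sub>R G + w *\<^sub>R ((p * t powr (p - 1)) *\<^sub>R d))
      = t powr p * (b \<bullet> G) + w * (p * t powr (p - 1)) * (b \<bullet> d)"
    by (simp add: inner_add_right)
  then show ?thesis using coercive cross unfolding A_def[symmetric] E_def[symmetric] by linarith
qed

section \<open>The nonlocal energy\<close>

definition near_mass :: "'a::euclidean_space itself \<Rightarrow> real \<Rightarrow> real" where
  "near_mass _ a =
     enn2real (\<integral>\<^sup>+z\<in>ball (0::'a) 2 - {0}. ennreal (norm z powr (a - real DIM('a))) \<partial>lborel)"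

definition tail_density ::
  "real \<Rightarrow> real \<Rightarrow> ('a::euclidean_space \<Rightarrow> real) \<Rightarrow> 'a \<Rightarrow> 'a \<Rightarrow> real" where
  "tail_density p s v x0 y = v y powr (p - 1) * dist y x0 powr (- (real DIM('a) + p * s))"

definition tail_integral :: "real \<Rightarrow> real \<Rightarrow> ('a::euclidean_space \<Rightarrow> real) \<Rightarrow> 'a \<Rightarrow> real \<Rightarrow> real" where
  "tail_integral p s v x0 \<rho> =
     (LINT y:- ball x0 \<rho>|lborel. tail_density p s v x0 y)"

lemma tail_density_nonneg [simp]: "0 \<le> tail_density p s v x0 y"
  by (simp add: tail_density_def)

lemma near_mass_nonneg: "0 \<le> near_mass TYPE('a::euclidean_space) a"
  by (simp add: near_mass_def)

lemma tail_integral_nonneg: "0 \<le> tail_integral p s v x0 \<rho>"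
  unfolding tail_integral_def set_lebesgue_integral_def
  by (intro integral_nonneg_AE AE_I2) simp

lemma set_integrable_ball_bounded:
  fixes f :: "'a::euclidean_space \<Rightarrow> real"
  assumes "f \<in> borel_measurable borel" "\<And>x. \<bar>f x\<bar> \<le> M"
  shows "set_integrable lborel (ball x0 \<rho>) f"
  unfolding set_integrable_def
  using assms emeasure_lborel_ball_finite[of x0 \<rho>]
  by (intro integrableI_bounded_set_indicator[where B = M]) auto

lemma set_integral_nonneg_real: "(\<And>x. x \<in> S \<Longrightarrow> 0 \<le> f x) \<Longrightarrow> 0 \<le> (LINT x:S|M. f x :: real)"
  unfolding set_lebesgue_integral_def by (intro integral_nonneg_AE AE_I2) (simp add: indicator_def)

lemma nn_integral_near_le:
  fixes x :: "'a::euclidean_space"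
  assumes "a > 0" "\<rho> \<le> 1" "x \<in> ball x0 \<rho>"
  shows "(\<integral>\<^sup>+y. ennreal (indicat_real (ball x0 \<rho>) y * dist x y powr (a - real DIM('a))) \<partial>lborel)
    \<le> ennreal (near_mass TYPE('a) a)"
proof -
  define h where "h z = ennreal (norm z powr (a - real DIM('a)))
      * indicator (ball (0::'a) 2 - {0}) z" for z
  have [measurable]: "h \<in> borel_measurable borel"
    unfolding h_def[abs_def]
    by (intro borel_measurable_times_ennreal borel_measurable_indicator) auto
  have "ennreal (indicat_real (ball x0 \<rho>) y * dist x y powr (a - real DIM('a))) \<le> h (x - y)" for y
  proof (cases "y \<in> ball x0 \<rho> \<and> y \<noteq> x")
    case True
    then have "dist x y < 2" using assms dist_triangle[of x y x0] by (simp add: dist_commute)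
    then have "x - y \<in> ball 0 2 - {0}"
      using True by (auto simp: dist_norm norm_minus_commute[of y x])
    then show ?thesis using True by (simp add: h_def dist_norm)
  qed auto
  then have "(\<integral>\<^sup>+y. ennreal (indicat_real (ball x0 \<rho>) y * dist x y powr (a - real DIM('a))) \<partial>lborel)
      \<le> (\<integral>\<^sup>+y. h (x - y) \<partial>lborel)" by (intro nn_integral_mono)
  also have "\<dots> = (\<integral>\<^sup>+z. h z \<partial>lborel)" by (rule nn_integral_lborel_reflect) measurable
  also have "\<dots> = ennreal (near_mass TYPE('a) a)"
    using nn_integral_norm_powr_near_finite[OF assms(1), where 'a = 'a]
    by (simp add: near_mass_def h_def)
  finally show ?thesis .
qed

lemma set_integrable_powr_far:
  fixes x0 :: "'a::euclidean_space"
  assumes [measurable]: "f \<in> borel_measurable borel" and bounded: "\<And>y. \<bar>f y\<bar> \<le> M"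
    and a: "a > 0" "\<rho> > 0"
  shows "set_integrable lborel (- ball x0 \<rho>) (\<lambda>y. f y * dist y x0 powr (- (real DIM('a) + a)))"
  unfolding set_integrable_def integrable_iff_bounded
proof
  define h where "h z = ennreal (norm z powr (- (real DIM('a) + a)))
      * indicator (- ball (0::'a) \<rho>) z" for z
  have [measurable]: "h \<in> borel_measurable borel"
    unfolding h_def[abs_def]
    by (intro borel_measurable_times_ennreal borel_measurable_indicator) auto
  let ?f = "\<lambda>y. indicat_real (- ball x0 \<rho>) y *\<^sub>R (f y * dist y x0 powr (- (real DIM('a) + a)))"
  have [measurable]: "indicat_real (- ball x0 \<rho>) \<in> borel_measurable borel"
    by (intro borel_measurable_indicator) auto
  show "?f \<in> borel_measurable lborel" by measurable
  have "ennreal (norm (?f y)) \<le> ennreal M * h (- x0 + y)" for y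
  proof (cases "y \<in> ball x0 \<rho>")
    case False
    then have "- x0 + y \<in> - ball 0 \<rho>" by (simp add: dist_norm norm_minus_commute)
    moreover have "0 \<le> M" using bounded[of y] by linarith
    ultimately have "ennreal M * h (- x0 + y) = ennreal (M * dist y x0 powr (- (real DIM('a) + a)))"
      by (simp add: h_def dist_norm ennreal_mult)
    then show ?thesis
      using False bounded[of y] by (auto simp: abs_mult intro!: ennreal_leI mult_right_mono)
  qed simp
  then have "(\<integral>\<^sup>+y. ennreal (norm (?f y)) \<partial>lborel) \<le> (\<integral>\<^sup>+y. ennreal M * h (- x0 + y) \<partial>lborel)"
    by (intro nn_integral_mono)
  also have "\<dots> = ennreal M * (\<integral>\<^sup>+z. h z \<partial>lborel)"
    using nn_integral_lborel_shift[of h "- x0"] by (simp add: nn_integral_cmult)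
  also have "\<dots> < \<infinity>"
    using nn_integral_norm_powr_far_finite[OF a, where 'a = 'a]
    by (simp add: h_def ennreal_mult_less_top)
  finally show "(\<integral>\<^sup>+y. ennreal (norm (?f y)) \<partial>lborel) < \<infinity>" .
qed

lemma tail_density_measurable[measurable]:
  fixes v :: "'a::euclidean_space \<Rightarrow> real"
  assumes [measurable]: "v \<in> borel_measurable borel"
  shows "tail_density p s v x0 \<in> borel_measurable borel"
  unfolding tail_density_def[abs_def] by measurable

lemma set_integrable_tail_density:
  fixes v :: "'a::euclidean_space \<Rightarrow> real"
  assumes [measurable]: "v \<in> borel_measurable borel" and v: "\<And>y. 0 \<le> v y" "\<And>y. v y \<le> M"
    and "p > 1" "s > 0" "\<rho> > 0"
  shows "set_integrable lborel (- ball x0 \<rho>) (tail_density p s v x0)"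
proof -
  have "\<bar>v y powr (p - 1)\<bar> \<le> M powr (p - 1)" for y using v assms(4) by (auto intro: powr_mono2)
  then show ?thesis
    unfolding tail_density_def using assms(4-6) by (intro set_integrable_powr_far) auto
qed

lemma nn_integral_product_le:
  fixes f :: "'a::euclidean_space \<Rightarrow> real" and h :: "'a \<Rightarrow> 'a \<Rightarrow> real"
  assumes f: "set_integrable lborel S f" "\<And>x. x \<in> S \<Longrightarrow> 0 \<le> f x" and I: "0 \<le> I"
    and h: "\<And>x. h x \<in> borel_measurable borel" "\<And>x y. 0 \<le> h x y"
      "\<And>x. x \<in> S \<Longrightarrow> (\<integral>\<^sup>+y. ennreal (h x y) \<partial>lborel) \<le> ennreal I"
  shows "(\<integral>\<^sup>+x. \<integral>\<^sup>+y. ennreal (indicat_real S x * f x * h x y) \<partial>lborel \<partial>lborel)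
    \<le> ennreal ((LINT x:S|lborel. f x) * I)"
proof -
  have nonneg: "0 \<le> indicat_real S x * f x" for x using f(2) by (simp add: indicator_def)
  have "(\<integral>\<^sup>+y. ennreal (indicat_real S x * f x * h x y) \<partial>lborel)
      \<le> ennreal (indicat_real S x * f x * I)" for x
  proof -
    have "(\<integral>\<^sup>+y. ennreal (indicat_real S x * f x * h x y) \<partial>lborel)
        = ennreal (indicat_real S x * f x) * (\<integral>\<^sup>+y. ennreal (h x y) \<partial>lborel)"
      using h(1,2) nonneg by (simp add: ennreal_mult nn_integral_cmult)
    also have "\<dots> \<le> ennreal (indicat_real S x * f x) * ennreal I"
      using h(3)[of x] by (cases "x \<in> S") (auto intro: mult_left_mono)
    finally show ?thesis using I nonneg[of x] by (simp add: ennreal_mult)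
  qed
  then have "(\<integral>\<^sup>+x. \<integral>\<^sup>+y. ennreal (indicat_real S x * f x * h x y) \<partial>lborel \<partial>lborel)
      \<le> (\<integral>\<^sup>+x. ennreal (indicat_real S x * f x * I) \<partial>lborel)" by (intro nn_integral_mono)
  also have "\<dots> = ennreal (\<integral>x. indicat_real S x * f x * I \<partial>lborel)"
    using f(1) I nonneg by (intro nn_integral_eq_integral) (auto simp: set_integrable_def)
  finally show ?thesis by (simp add: set_lebesgue_integral_def)
qed

lemma nn_integral_lborel_swap:
  fixes m :: "'a::euclidean_space \<Rightarrow> 'b::euclidean_space \<Rightarrow> ennreal"
  assumes "(\<lambda>z. m (fst z) (snd z)) \<in> borel_measurable borel"
  shows "(\<integral>\<^sup>+z. m (fst z) (snd z) \<partial>lborel) = (\<integral>\<^sup>+x. \<integral>\<^sup>+y. m x y \<partial>lborel \<partial>lborel)"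
    "(\<integral>\<^sup>+z. m (snd z) (fst z) \<partial>lborel) = (\<integral>\<^sup>+x. \<integral>\<^sup>+y. m x y \<partial>lborel \<partial>lborel)"
proof -
  have "(\<lambda>z. m (fst z) (snd z)) \<in> borel_measurable (lborel \<Otimes>\<^sub>M lborel)"
    using assms by (simp add: lborel_prod)
  from lborel.nn_integral_fst[OF this]
  show "(\<integral>\<^sup>+z. m (fst z) (snd z) \<partial>lborel) = (\<integral>\<^sup>+x. \<integral>\<^sup>+y. m x y \<partial>lborel \<partial>lborel)"
    by (simp add: lborel_prod)
  have "(\<lambda>z. m (snd z) (fst z)) = (\<lambda>z. m (fst z) (snd z)) \<circ> (\<lambda>z. (snd z, fst z))" by auto
  moreover have "(\<lambda>z::'b \<times> 'a. (snd z, fst z)) \<in> borel_measurable borel"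
    by (simp add: borel_prod[symmetric])
  ultimately have "(\<lambda>z. m (snd z) (fst z)) \<in> borel_measurable (lborel \<Otimes>\<^sub>M lborel)"
    using measurable_comp[OF _ assms] by (simp add: lborel_prod)
  from lborel_pair.nn_integral_snd[OF this]
  show "(\<integral>\<^sup>+z. m (snd z) (fst z) \<partial>lborel) = (\<integral>\<^sup>+x. \<integral>\<^sup>+y. m x y \<partial>lborel \<partial>lborel)"
    by (simp add: lborel_prod)
qed

lemma integral_ge_of_symmetric_majorant:
  fixes F m :: "'a::euclidean_space \<Rightarrow> 'a \<Rightarrow> real"
  assumes m: "(\<lambda>z. m (fst z) (snd z)) \<in> borel_measurable borel" "\<And>x y. 0 \<le> m x y"
    and majorant: "\<And>x y. - F x y \<le> m x y + m y x"
    and S: "(\<integral>\<^sup>+x. \<integral>\<^sup>+y. ennreal (m x y) \<partial>lborel \<partial>lborel) \<le> ennreal S" "0 \<le> S"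
  shows "- (2 * S) \<le> (LINT z|lebesgue. F (fst z) (snd z))"
proof -
  have meas: "(\<lambda>z. ennreal (m (fst z) (snd z))) \<in> borel_measurable borel" using m(1) by simp
  have swapped: "(\<lambda>z. ennreal (m (snd z) (fst z))) \<in> borel_measurable borel"
    using measurable_comp[of "\<lambda>z. (snd z, fst z)" borel borel, OF _ meas]
    by (simp add: borel_prod[symmetric] comp_def)
  have "(\<integral>\<^sup>+z. ennreal (- F (fst z) (snd z)) \<partial>lebesgue)
      \<le> (\<integral>\<^sup>+z. ennreal (m (fst z) (snd z)) + ennreal (m (snd z) (fst z)) \<partial>lborel)"
    unfolding nn_integral_completion
    using majorant m(2) by (intro nn_integral_mono) (simp flip: ennreal_plus add: ennreal_leI)
  also have "\<dots> = (\<integral>\<^sup>+z. ennreal (m (fst z) (snd z)) \<partial>lborel)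
      + (\<integral>\<^sup>+z. ennreal (m (snd z) (fst z)) \<partial>lborel)"
    using meas swapped by (intro nn_integral_add) simp_all
  also have "\<dots> \<le> ennreal S + ennreal S"
    unfolding nn_integral_lborel_swap[OF meas] by (intro add_mono S(1))
  finally have "(\<integral>\<^sup>+z. ennreal (- F (fst z) (snd z)) \<partial>lebesgue) \<le> ennreal (2 * S)"
    using S(2) by (simp flip: ennreal_plus)
  from integral_real_bounded[OF _ this] show ?thesis using S(2) by simp
qed

locale fractional_kernel =
  fixes p s \<Lambda> :: real and K :: "'a::euclidean_space \<Rightarrow> 'a \<Rightarrow> real"
  assumes p: "1 < p" and s: "0 < s" "s < 1" and \<Lambda>: "1 \<le> \<Lambda>"
    and K_commute: "K x y = K y x"
    and K_lower: "x \<noteq> y \<Longrightarrow> dist x y powr (- (real DIM('a) + p * s)) / \<Lambda> \<le> K x y"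
    and K_upper: "x \<noteq> y \<Longrightarrow> K x y \<le> \<Lambda> * dist x y powr (- (real DIM('a) + p * s))"
begin

lemma K_nonneg: "x \<noteq> y \<Longrightarrow> 0 \<le> K x y"
  using K_lower[of x y] \<Lambda> order_trans[of 0 "dist x y powr (- (real DIM('a) + p * s)) / \<Lambda>"] by simp

definition interaction :: "('a \<Rightarrow> real) \<Rightarrow> ('a \<Rightarrow> real) \<Rightarrow> 'a \<Rightarrow> 'a \<Rightarrow> real" where
  "interaction u \<phi> x y = ppow p (u x - u y) * (\<phi> x - \<phi> y) * K x y"

lemma interaction_commute: "interaction u \<phi> x y = interaction u \<phi> y x"
proof -
  have "ppow p (u x - u y) = - ppow p (u y - u x)" using ppow_minus[of p "u y - u x"] by simp
  then show ?thesis unfolding interaction_def K_commute[of x y] by (simp add: algebra_simps)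
qed

definition near_const :: "real \<Rightarrow> real" where
  "near_const L = \<Lambda> * nonlocal_const p * L powr p"

definition far_const :: "real \<Rightarrow> real \<Rightarrow> real" where
  "far_const \<sigma> \<rho> = \<Lambda> * (1 - \<sigma> / \<rho>) powr (- (real DIM('a) + p * s))"

lemma near_const_nonneg: "0 \<le> near_const L" and far_const_nonneg: "0 \<le> far_const \<sigma> \<rho>"
  using \<Lambda> nonlocal_const_pos[OF p] by (simp_all add: near_const_def far_const_def)

lemma interaction_near:
  assumes cut: "cutoff x0 \<sigma> L \<eta> D\<eta>" and "x \<noteq> y"
  shows "- interaction u (\<lambda>x. excess u k x * \<eta> x powr p) x y
    \<le> near_const L * ((excess u k x powr p + excess u k y powr p) * dist x y powr
      (p * (1 - s) - real DIM('a)))"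
proof -
  let ?E = "excess u k x powr p + excess u k y powr p" and ?q = "real DIM('a) + p * s"
  have "\<bar>\<eta> x - \<eta> y\<bar> \<le> L * dist x y"
    using C1_grad_Lipschitz[OF cutoffD(1,6)[OF cut], of y x] by (simp add: abs_minus_commute)
  then have "\<bar>\<eta> x - \<eta> y\<bar> powr p \<le> (L * dist x y) powr p" using p by (intro powr_mono2) auto
  then have Lip: "\<bar>\<eta> x - \<eta> y\<bar> powr p \<le> L powr p * dist x y powr p"
    using cutoffD(7)[OF cut] by (simp add: powr_mult)
  have "- (ppow p (u x - u y) * (excess u k x * \<eta> x powr p - excess u k y * \<eta> y powr p))
      \<le> nonlocal_const p * (?E * \<bar>\<eta> x - \<eta> y\<bar> powr p)"
    unfolding excess_def by (rule nonlocal_pointwise[OF cutoffD(2)[OF cut] cutoffD(2)[OF cut] p])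
  also have "\<dots> \<le> nonlocal_const p * (?E * (L powr p * dist x y powr p))"
    using Lip nonlocal_const_pos[OF p] by (intro mult_left_mono) auto
  finally have "- (ppow p (u x - u y) * (excess u k x * \<eta> x powr p - excess u k y * \<eta> y powr p))
      \<le> nonlocal_const p * (?E * (L powr p * dist x y powr p))" .
  from mult_right_mono[OF this K_nonneg[OF assms(2)]]
  have "- interaction u (\<lambda>x. excess u k x * \<eta> x powr p) x y
      \<le> nonlocal_const p * (?E * (L powr p * dist x y powr p)) * K x y"
    by (simp add: interaction_def)
  also have "\<dots> \<le> nonlocal_const p * (?E * (L powr p * dist x y powr p))
      * (\<Lambda> * dist x y powr (- ?q))"
    using K_upper[OF assms(2)] nonlocal_const_pos[OF p] by (intro mult_left_mono) auto
  also have "\<dots> = near_const L * (?E * (dist x y powr p * dist x y powr (- ?q)))"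
    by (simp add: near_const_def mult_ac)
  also have "dist x y powr p * dist x y powr (- ?q) = dist x y powr (p * (1 - s) - real DIM('a))"
    by (simp flip: powr_add add: algebra_simps)
  finally show ?thesis .
qed

lemma K_far:
  assumes "dist x0 x \<le> \<sigma>" "0 < \<sigma>" "\<sigma> < \<rho>" "\<rho> \<le> dist x0 y"
  shows "K x y \<le> far_const \<sigma> \<rho> * dist y x0 powr (- (real DIM('a) + p * s))"
proof -
  let ?q = "real DIM('a) + p * s"
  have "(1 - \<sigma> / \<rho>) * dist y x0 = dist y x0 - \<sigma> * (dist y x0 / \<rho>)"
    using assms by (simp add: field_simps)
  also have "\<dots> \<le> dist y x0 - \<sigma> * 1"
    using assms by (intro diff_left_mono mult_left_mono) (auto simp: dist_commute)
  also have "\<dots> \<le> dist x y" using assms(1) dist_triangle[of y x0 x] by (simp add: dist_commute)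
  finally have dist_ge: "(1 - \<sigma> / \<rho>) * dist y x0 \<le> dist x y" .
  moreover have pos: "0 < (1 - \<sigma> / \<rho>) * dist y x0"
    using assms by (intro mult_pos_pos) (auto simp: dist_commute[of y])
  ultimately have "x \<noteq> y" by auto
  have "0 < p * s" using p s by simp
  then have "dist x y powr (- ?q) \<le> ((1 - \<sigma> / \<rho>) * dist y x0) powr (- ?q)"
    using dist_ge pos by (intro powr_mono2') auto
  then have "\<Lambda> * dist x y powr (- ?q) \<le> \<Lambda> * ((1 - \<sigma> / \<rho>) powr (- ?q) * dist y x0 powr (- ?q))"
    using assms \<Lambda> by (intro mult_left_mono) (auto simp: powr_mult)
  then show ?thesis using K_upper[OF \<open>x \<noteq> y\<close>] by (simp add: far_const_def mult.assoc)
qed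

lemma interaction_far:
  assumes cut: "cutoff x0 \<sigma> L \<eta> D\<eta>" and \<sigma>: "0 < \<sigma>" "\<sigma> < \<rho>" and y: "y \<notin> ball x0 \<rho>"
  shows "- interaction u (\<lambda>x. excess u k x * \<eta> x powr p) x y \<le> far_const \<sigma> \<rho> *
    (excess u k x * tail_density p s (excess u k) x0 y)"
proof -
  have "y \<notin> cball x0 \<sigma>" using y \<sigma> by auto
  then have \<eta>y: "\<eta> y = 0" by (rule vanishes_outsideD[OF cutoffD(4)[OF cut]])
  show ?thesis
  proof (cases "x \<in> cball x0 \<sigma>")
    case False
    then have "\<eta> x = 0" by (rule vanishes_outsideD[OF cutoffD(4)[OF cut]])
    then show ?thesis using \<eta>y far_const_nonneg by (simp add: interaction_def excess_def)
  next
    case True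
    then have K: "K x y \<le> far_const \<sigma> \<rho> * dist y x0 powr (- (real DIM('a) + p * s))"
      using y \<sigma> by (intro K_far) auto
    have "x \<noteq> y" using True y \<sigma> by auto
    have "- interaction u (\<lambda>x. excess u k x * \<eta> x powr p) x y
        = - (ppow p (u x - u y) * (excess u k x * \<eta> x powr p)) * K x y"
      using \<eta>y p by (simp add: interaction_def)
    also have "\<dots> \<le> excess u k x * excess u k y powr (p - 1) * K x y"
      unfolding excess_def
      by (intro mult_right_mono nonlocal_pointwise_tail K_nonneg cutoffD(2,3)[OF cut] p \<open>x \<noteq> y\<close>)
    also have "\<dots> \<le> excess u k x * excess u k y powr (p - 1) *
        (far_const \<sigma> \<rho> * dist y x0 powr (- (real DIM('a) + p * s)))"
      using K by (intro mult_left_mono) (auto simp: excess_def)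
    finally show ?thesis by (simp add: tail_density_def mult_ac)
  qed
qed

definition interaction_energy :: "'a \<Rightarrow> real \<Rightarrow> real \<Rightarrow> real \<Rightarrow> ('a \<Rightarrow> real) \<Rightarrow> real" where
  "interaction_energy x0 \<sigma> \<rho> L w =
     near_const L * ((LINT x:ball x0 \<rho>|lborel. w x powr p) * near_mass TYPE('a) (p * (1 - s))) +
     far_const \<sigma> \<rho> * ((LINT x:ball x0 \<rho>|lborel. w x) * tail_integral p s w x0 \<rho>)"

lemma interaction_energy_nonneg: "(\<And>x. 0 \<le> w x) \<Longrightarrow> 0 \<le> interaction_energy x0 \<sigma> \<rho> L w"
  unfolding interaction_energy_def
  by (intro add_nonneg_nonneg mult_nonneg_nonneg near_const_nonneg far_const_nonneg
      set_integral_nonneg_real near_mass_nonneg tail_integral_nonneg) auto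

definition interaction_majorant ::
  "'a \<Rightarrow> real \<Rightarrow> real \<Rightarrow> real \<Rightarrow> ('a \<Rightarrow> real) \<Rightarrow> 'a \<Rightarrow> 'a \<Rightarrow> real" where
  "interaction_majorant x0 \<sigma> \<rho> L w x y =
     near_const L * (indicat_real (ball x0 \<rho>) x * w x powr p *
       (indicat_real (ball x0 \<rho>) y * dist x y powr (p * (1 - s) - real DIM('a)))) +
     far_const \<sigma> \<rho> * (indicat_real (ball x0 \<rho>) x * w x *
       (indicat_real (- ball x0 \<rho>) y * tail_density p s w x0 y))"

lemma interaction_majorant_nonneg:
  "(\<And>x. 0 \<le> w x) \<Longrightarrow> 0 \<le> interaction_majorant x0 \<sigma> \<rho> L w x y"
  unfolding interaction_majorant_def using near_const_nonneg far_const_nonneg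
  by (intro add_nonneg_nonneg mult_nonneg_nonneg) auto

lemma interaction_le_majorant:
  assumes cut: "cutoff x0 \<sigma> L \<eta> D\<eta>" and \<sigma>: "0 < \<sigma>" "\<sigma> < \<rho>"
  shows "- interaction u (\<lambda>x. excess u k x * \<eta> x powr p) x y
    \<le> interaction_majorant x0 \<sigma> \<rho> L (excess u k) x y
      + interaction_majorant x0 \<sigma> \<rho> L (excess u k) y x"
proof -
  let ?F = "interaction u (\<lambda>x. excess u k x * \<eta> x powr p)"
  let ?m = "interaction_majorant x0 \<sigma> \<rho> L (excess u k)"
  have m: "0 \<le> ?m x y" for x y by (intro interaction_majorant_nonneg) (simp add: excess_def)
  have \<eta>_outside: "\<eta> x = 0" if "x \<notin> ball x0 \<rho>" for x
    using vanishes_outsideD[OF cutoffD(4)[OF cut], of x] that \<sigma> by auto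
  have far: "- ?F x y \<le> ?m x y + ?m y x" if "x \<in> ball x0 \<rho>" "y \<notin> ball x0 \<rho>" for x y
    using interaction_far[OF cut \<sigma>, of y u k x] that m[of y x]
    by (simp add: interaction_majorant_def)
  consider (same) "x = y" | (near) "x \<noteq> y" "x \<in> ball x0 \<rho>" "y \<in> ball x0 \<rho>"
    | (left) "x \<in> ball x0 \<rho>" "y \<notin> ball x0 \<rho>" | (right) "x \<notin> ball x0 \<rho>" "y \<in> ball x0 \<rho>"
    | (outside) "x \<notin> ball x0 \<rho>" "y \<notin> ball x0 \<rho>" by blast
  then show ?thesis
  proof cases
    case near
    then show ?thesis
      using interaction_near[OF cut, of x y u k]
      by (simp add: interaction_majorant_def dist_commute algebra_simps)
  next
    case right
    then show ?thesis using far[of y x] interaction_commute[of u _ x y] by simp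
  next
    case outside
    then show ?thesis using \<eta>_outside m[of x y] m[of y x] by (simp add: interaction_def)
  qed (use far m[of x y] m[of y x] in \<open>auto simp: interaction_def\<close>)
qed

lemma nn_integral_tail_density:
  assumes "w \<in> borel_measurable borel" "\<And>x. 0 \<le> w x" "\<And>x. w x \<le> M" "0 < \<rho>"
  shows "(\<integral>\<^sup>+y. ennreal (indicat_real (- ball x0 \<rho>) y * tail_density p s w x0 y) \<partial>lborel)
    = ennreal (tail_integral p s w x0 \<rho>)"
proof -
  have "set_integrable lborel (- ball x0 \<rho>) (tail_density p s w x0)"
    using assms p s by (intro set_integrable_tail_density) auto
  then show ?thesis
    using assms unfolding tail_integral_def set_lebesgue_integral_def set_integrable_def
    by (subst nn_integral_eq_integral) auto
qed

lemma interaction_majorant_integral: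
  fixes w :: "'a \<Rightarrow> real"
  assumes [measurable]: "w \<in> borel_measurable borel" and w: "\<And>x. 0 \<le> w x" "\<And>x. w x \<le> M"
    and \<rho>: "0 < \<rho>" "\<rho> \<le> 1"
  shows "(\<integral>\<^sup>+x. \<integral>\<^sup>+y. ennreal (interaction_majorant x0 \<sigma> \<rho> L w x y) \<partial>lborel \<partial>lborel)
    \<le> ennreal (interaction_energy x0 \<sigma> \<rho> L w)"
proof -
  have [measurable]: "indicat_real (ball x0 \<rho>) \<in> borel_measurable borel"
    "indicat_real (- ball x0 \<rho>) \<in> borel_measurable borel"
      by (intro borel_measurable_indicator; simp)+
  let ?near = "\<lambda>x y. indicat_real (ball x0 \<rho>) x * w x powr p *
      (indicat_real (ball x0 \<rho>) y * dist x y powr (p * (1 - s) - real DIM('a)))"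
  let ?far = "\<lambda>x y. indicat_real (ball x0 \<rho>) x * w x *
      (indicat_real (- ball x0 \<rho>) y * tail_density p s w x0 y)"
  let ?I = "(LINT x:ball x0 \<rho>|lborel. w x powr p) * near_mass TYPE('a) (p * (1 - s))"
  let ?J = "(LINT x:ball x0 \<rho>|lborel. w x) * tail_integral p s w x0 \<rho>"
  have near: "(\<integral>\<^sup>+x. \<integral>\<^sup>+y. ennreal (?near x y) \<partial>lborel \<partial>lborel) \<le> ennreal ?I"
    using w p s \<rho>
    by (intro nn_integral_product_le set_integrable_ball_bounded[where M = "M powr p"]
        nn_integral_near_le near_mass_nonneg) (auto intro: powr_mono2)
  have far: "(\<integral>\<^sup>+x. \<integral>\<^sup>+y. ennreal (?far x y) \<partial>lborel \<partial>lborel) \<le> ennreal ?J"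
    using w \<rho>
    by (intro nn_integral_product_le set_integrable_ball_bounded[where M = M]
        tail_integral_nonneg) (auto simp: nn_integral_tail_density[OF assms(1) w \<rho>(1)])
  have "(\<integral>\<^sup>+x. \<integral>\<^sup>+y. ennreal (interaction_majorant x0 \<sigma> \<rho> L w x y) \<partial>lborel \<partial>lborel)
      = ennreal (near_const L) * (\<integral>\<^sup>+x. \<integral>\<^sup>+y. ennreal (?near x y) \<partial>lborel \<partial>lborel)
        + ennreal (far_const \<sigma> \<rho>) * (\<integral>\<^sup>+x. \<integral>\<^sup>+y. ennreal (?far x y) \<partial>lborel \<partial>lborel)"
    unfolding interaction_majorant_def using near_const_nonneg far_const_nonneg w
    by (simp add: ennreal_plus ennreal_mult' nn_integral_add nn_integral_cmult)
  also have "\<dots> \<le> ennreal (near_const L) * ennreal ?I + ennreal (far_const \<sigma> \<rho>) * ennreal ?J"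
    by (intro add_mono mult_left_mono near far) auto
  also have "\<dots> = ennreal (interaction_energy x0 \<sigma> \<rho> L w)"
  proof -
    have "0 \<le> ?I" "0 \<le> ?J"
      using w by (auto intro!: mult_nonneg_nonneg set_integral_nonneg_real near_mass_nonneg
          tail_integral_nonneg)
    then show ?thesis
      using near_const_nonneg far_const_nonneg
      by (simp add: interaction_energy_def ennreal_mult ennreal_plus)
  qed
  finally show ?thesis .
qed

lemma interaction_lower_bound:
  assumes cut: "cutoff x0 \<sigma> L \<eta> D\<eta>" and \<sigma>: "0 < \<sigma>" "\<sigma> < \<rho>" "\<rho> \<le> 1"
    and u[measurable]: "u \<in> borel_measurable borel" and M: "\<And>x. \<bar>u x\<bar> \<le> M"
  shows "- (2 * interaction_energy x0 \<sigma> \<rho> L (excess u k))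
    \<le> (LINT z|lebesgue. interaction u (\<lambda>x. excess u k x * \<eta> x powr p) (fst z) (snd z))"
proof (rule integral_ge_of_symmetric_majorant)
  have [measurable]: "indicat_real (ball x0 \<rho>) \<in> borel_measurable borel"
    "indicat_real (- ball x0 \<rho>) \<in> borel_measurable borel"
      by (intro borel_measurable_indicator; simp)+
  show "(\<lambda>z. interaction_majorant x0 \<sigma> \<rho> L (excess u k) (fst z) (snd z)) \<in> borel_measurable borel"
    unfolding interaction_majorant_def borel_prod[symmetric] by measurable
  have "excess u k x \<le> M + \<bar>k\<bar>" for x using M[of x] by (auto simp: excess_def)
  then show "(\<integral>\<^sup>+x. \<integral>\<^sup>+y. ennreal (interaction_majorant x0 \<sigma> \<rho> L (excess u k) x y) \<partial>lborel \<partial>lborel)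
    \<le> ennreal (interaction_energy x0 \<sigma> \<rho> L (excess u k))"
    using \<sigma> by (intro interaction_majorant_integral[where M = "M + \<bar>k\<bar>"]) auto
qed (use \<sigma> in \<open>auto intro: interaction_majorant_nonneg interaction_le_majorant[OF cut]
      interaction_energy_nonneg\<close>)

end

section \<open>The Caccioppoli inequality\<close>

definition energy_const :: "'a::euclidean_space itself \<Rightarrow> real \<Rightarrow> real \<Rightarrow> real \<Rightarrow> real \<Rightarrow> real \<Rightarrow> real"
  where
  "energy_const _ p s \<Lambda> C1 C2 =
     2 / C1 * (young_const p C1 C2 + 2 * \<Lambda> * nonlocal_const p * near_mass TYPE('a) (p * (1 - s)))"

lemma energy_const_nonneg:
  assumes "p > 1" "\<Lambda> \<ge> 1" "C1 > 0" "C2 > 0"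
  shows "0 \<le> energy_const TYPE('a::euclidean_space) p s \<Lambda> C1 C2"
  using assms young_const_nonneg[of p C2 C1] nonlocal_const_pos[of p]
      near_mass_nonneg[where 'a = 'a]
  unfolding energy_const_def by (intro mult_nonneg_nonneg add_nonneg_nonneg) auto

text \<open>Here \<open>u\<close> and \<open>g\<close> are Borel representatives of the subsolution and of its gradient, and \<open>b x\<close> stands
  for \<open>\<B> x (u x) (g x)\<close>.\<close>
locale mixed_subsolution = fractional_kernel p s \<Lambda> K
  for p s \<Lambda> and K :: "'a::euclidean_space \<Rightarrow> 'a \<Rightarrow> real" +
  fixes \<Omega> :: "'a set" and C1 C2 M :: real and u :: "'a \<Rightarrow> real" and g b :: "'a \<Rightarrow> 'a"
  assumes C1: "0 < C1" and C2: "0 < C2"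
    and u_measurable[measurable]: "u \<in> borel_measurable borel" and u_bounded: "\<bar>u x\<bar> \<le> M"
    and g_measurable[measurable]: "g \<in> borel_measurable borel"
    and weakly_differentiable: "W1p_loc \<Omega> p u g"
    and flux: "AE x in lebesgue. x \<in> \<Omega> \<longrightarrow>
      C1 * norm (g x) powr p \<le> b x \<bullet> g x \<and> norm (b x) \<le> C2 * norm (g x) powr (p - 1)"
    and subsolution: "\<lbrakk>0 < \<tau>; cball x0 \<tau> \<subseteq> \<Omega>; W01p (ball x0 \<tau>) p \<phi> G; \<And>x. 0 \<le> \<phi> x\<rbrakk> \<Longrightarrow>
      set_integrable lebesgue (ball x0 \<tau>) (\<lambda>x. b x \<bullet> G x) \<and>
      (LINT x:ball x0 \<tau>|lebesgue. b x \<bullet> G x) + (LINT z|lebesgue. interaction u \<phi> (fst z) (snd z))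
        \<le> 0"
begin

lemma excess_le: "excess u k x \<le> M + \<bar>k\<bar>"
  using u_bounded[of x] by (auto simp: excess_def)

lemma excess_set_integrable:
  "set_integrable lborel (ball x0 \<rho>) (excess u k)"
  "q > 0 \<Longrightarrow> set_integrable lborel (ball x0 \<rho>) (\<lambda>x. excess u k x powr q)"
  "\<rho> > 0 \<Longrightarrow> set_integrable lborel (- ball x0 \<rho>) (tail_density p s (excess u k) x0)"
proof -
  show "set_integrable lborel (ball x0 \<rho>) (excess u k)"
    using excess_le by (intro set_integrable_ball_bounded[where M = "M + \<bar>k\<bar>"]) auto
  have "\<bar>excess u k x powr q\<bar> \<le> (M + \<bar>k\<bar>) powr q" if "q > 0" for x q
    using excess_le that by (auto intro: powr_mono2)
  then show "set_integrable lborel (ball x0 \<rho>) (\<lambda>x. excess u k x powr q)" if "q > 0"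
    using that by (intro set_integrable_ball_bounded[where M = "(M + \<bar>k\<bar>) powr q"]) auto
  show "set_integrable lborel (- ball x0 \<rho>) (tail_density p s (excess u k) x0)" if "\<rho> > 0"
    using excess_le that p s by (intro set_integrable_tail_density[where M = "M + \<bar>k\<bar>"]) auto
qed

definition test_grad :: "real \<Rightarrow> ('a \<Rightarrow> real) \<Rightarrow> ('a \<Rightarrow> 'a) \<Rightarrow> 'a \<Rightarrow> 'a" where
  "test_grad k \<eta> D\<eta> x =
     \<eta> x powr p *\<^sub>R excess_grad u k g x + excess u k x *\<^sub>R ((p * \<eta> x powr (p - 1)) *\<^sub>R D\<eta> x)"

lemma test_grad_outside:
  assumes "cutoff x0 \<sigma> L \<eta> D\<eta>" "x \<notin> cball x0 \<sigma>"
  shows "test_grad k \<eta> D\<eta> x = 0" "\<eta> x = 0"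
proof -
  show "\<eta> x = 0" by (rule vanishes_outsideD[OF cutoffD(4)[OF assms(1)] assms(2)])
  moreover have "D\<eta> x = 0" by (rule vanishes_outsideD[OF cutoffD(5)[OF assms(1)] assms(2)])
  ultimately show "test_grad k \<eta> D\<eta> x = 0" by (simp add: test_grad_def)
qed

lemma weak_inequality_cutoff:
  assumes cut: "cutoff x0 \<sigma> L \<eta> D\<eta>" and \<tau>: "0 < \<tau>" "\<sigma> < \<tau>" "cball x0 \<tau> \<subseteq> \<Omega>"
  shows "set_integrable lebesgue (ball x0 \<tau>) (\<lambda>x. b x \<bullet> test_grad k \<eta> D\<eta> x)"
    "(LINT x:ball x0 \<tau>|lebesgue. b x \<bullet> test_grad k \<eta> D\<eta> x)
      + (LINT z|lebesgue. interaction u (\<lambda>x. excess u k x * \<eta> x powr p) (fst z) (snd z)) \<le> 0"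
proof -
  have outside: "vanishes_outside (cball x0 \<sigma>) (\<lambda>x. \<eta> x powr p)"
    "vanishes_outside (cball x0 \<sigma>) (\<lambda>x. excess u k x * \<eta> x powr p)"
    "vanishes_outside (cball x0 \<sigma>) (test_grad k \<eta> D\<eta>)"
    using test_grad_outside[OF cut] by (auto simp: vanishes_outside_def)
  have "W1p_approx p (cball x0 \<sigma>) (\<lambda>x. excess u k x * \<eta> x powr p) (test_grad k \<eta> D\<eta>)"
    unfolding test_grad_def[abs_def]
    by (intro W1p_loc_truncation[OF weakly_differentiable p _ _ _ outside(1) \<tau>(2,3)]
        C1_grad_powr cutoffD[OF cut] p u_measurable g_measurable)
  from W1p_approx_imp_W01p[OF this \<tau>(2) p outside(2,3)] subsolution[OF \<tau>(1,3)]
  show "set_integrable lebesgue (ball x0 \<tau>) (\<lambda>x. b x \<bullet> test_grad k \<eta> D\<eta> x)"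
    "(LINT x:ball x0 \<tau>|lebesgue. b x \<bullet> test_grad k \<eta> D\<eta> x)
      + (LINT z|lebesgue. interaction u (\<lambda>x. excess u k x * \<eta> x powr p) (fst z) (snd z)) \<le> 0"
    by auto
qed

lemma cutoff_excess_grad_integrable:
  assumes cut: "cutoff x0 \<sigma> L \<eta> D\<eta>" and "cball x0 \<sigma> \<subseteq> \<Omega>"
  shows "integrable lborel (\<lambda>x. norm (\<eta> x *\<^sub>R excess_grad u k g x) powr p)"
proof -
  note [measurable] = C1_grad_measurable[OF cutoffD(1)[OF cut]]
  have "Lpn p (\<lambda>x. \<eta> x *\<^sub>R excess_grad u k g x) \<le> Lpn p (\<lambda>x. indicat_real (cball x0 \<sigma>) x *\<^sub>R g x)"
  proof (rule Lpn_mono)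
    fix x
    show "norm (\<eta> x *\<^sub>R excess_grad u k g x) \<le> norm (indicat_real (cball x0 \<sigma>) x *\<^sub>R g x)"
      using cutoffD(2,3)[OF cut, of x] test_grad_outside(2)[OF cut, of x]
      by (cases "x \<in> cball x0 \<sigma>") (auto simp: excess_grad_def mult_left_le_one_le)
  qed (use p in simp)
  also have "\<dots> < \<infinity>"
    using weakly_differentiable assms(2) p by (intro Lpn_restrict_finite) (auto simp: W1p_loc_def)
  finally show ?thesis by (intro integrableI_nonneg) (auto simp: Lpn_def)
qed

lemma flux_test_grad_ge:
  assumes cut: "cutoff x0 \<sigma> L \<eta> D\<eta>"
    and x: "C1 * norm (g x) powr p \<le> b x \<bullet> g x" "norm (b x) \<le> C2 * norm (g x) powr (p - 1)"
  shows "C1 / 2 * norm (\<eta> x *\<^sub>R excess_grad u k g x) powr p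
      - young_const p C1 C2 * L powr p * excess u k x powr p \<le> b x \<bullet> test_grad k \<eta> D\<eta> x"
proof (cases "k < u x")
  case True
  have "(excess u k x * norm (D\<eta> x)) powr p \<le> (excess u k x * L) powr p"
    using cutoffD(6)[OF cut] p by (intro powr_mono2 mult_left_mono) auto
  then have "young_const p C1 C2 * (excess u k x * norm (D\<eta> x)) powr p
      \<le> young_const p C1 C2 * (L powr p * excess u k x powr p)"
    using young_const_nonneg[of p C2 C1] p C2 cutoffD(7)[OF cut]
    by (intro mult_left_mono) (auto simp: powr_mult mult.commute)
  then show ?thesis
    using local_Young[OF p C1 C2 cutoffD(2)[OF cut, of x] excess_nonneg[of u k x] x, of "D\<eta> x"]
      cutoffD(2)[OF cut, of x] True
    by (simp add: test_grad_def excess_grad_def mult.assoc)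
qed (simp add: test_grad_def excess_grad_def excess_def)

lemma local_energy_lower_bound:
  assumes cut: "cutoff x0 \<sigma> L \<eta> D\<eta>" and \<tau>: "\<sigma> < \<tau>" "\<tau> \<le> \<rho>" "cball x0 \<tau> \<subseteq> \<Omega>"
    and integrable: "set_integrable lebesgue (ball x0 \<tau>) (\<lambda>x. b x \<bullet> test_grad k \<eta> D\<eta> x)"
  shows "C1 / 2 * (\<integral>x. norm (\<eta> x *\<^sub>R excess_grad u k g x) powr p \<partial>lborel)
      - young_const p C1 C2 * L powr p * (LINT x:ball x0 \<rho>|lborel. excess u k x powr p)
    \<le> (LINT x:ball x0 \<tau>|lebesgue. b x \<bullet> test_grad k \<eta> D\<eta> x)"
proof -
  define Y where "Y = young_const p C1 C2 * L powr p"
  have Y: "0 \<le> Y" using young_const_nonneg[of p C2 C1] p C2 by (simp add: Y_def)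
  let ?h = "\<lambda>x. C1 / 2 * norm (\<eta> x *\<^sub>R excess_grad u k g x) powr p
      - Y * (indicat_real (ball x0 \<rho>) x * excess u k x powr p)"
  have grad_int: "integrable lborel (\<lambda>x. norm (\<eta> x *\<^sub>R excess_grad u k g x) powr p)"
    using \<tau> by (intro cutoff_excess_grad_integrable[OF cut]) auto
  have excess_int: "integrable lborel (\<lambda>x. indicat_real (ball x0 \<rho>) x * excess u k x powr p)"
    using excess_set_integrable(2)[of p] p by (simp add: set_integrable_def)
  have h_int: "integrable lborel ?h" using grad_int excess_int by simp
  have h_meas: "?h \<in> borel_measurable lborel" using h_int by (rule borel_measurable_integrable)
  have "AE x in lebesgue. ?h x \<le> indicat_real (ball x0 \<tau>) x *\<^sub>R (b x \<bullet> test_grad k \<eta> D\<eta> x)"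
    using flux
  proof eventually_elim
    case (elim x)
    show ?case
    proof (cases "x \<in> cball x0 \<sigma>")
      case True
      then have "x \<in> \<Omega>" "x \<in> ball x0 \<tau>" "x \<in> ball x0 \<rho>" using \<tau> by auto
      then show ?thesis using flux_test_grad_ge[OF cut, of x k] elim by (simp add: Y_def)
    next
      case False
      then show ?thesis using test_grad_outside[OF cut False] Y p by simp
    qed
  qed
  then have "(\<integral>x. ?h x \<partial>lebesgue) \<le> (LINT x:ball x0 \<tau>|lebesgue. b x \<bullet> test_grad k \<eta> D\<eta> x)"
    unfolding set_lebesgue_integral_def
    using integrable h_int integrable_completion[OF h_meas]
    by (intro integral_mono_AE) (auto simp: set_integrable_def)
  moreover have "(\<integral>x. ?h x \<partial>lebesgue) = (\<integral>x. ?h x \<partial>lborel)" by (rule integral_completion[OF h_meas])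
  ultimately show ?thesis
    using grad_int excess_int by (simp add: set_lebesgue_integral_def Y_def)
qed

theorem Caccioppoli:
  assumes cut: "cutoff x0 \<sigma> L \<eta> D\<eta>" and \<sigma>: "0 < \<sigma>" "\<sigma> < \<rho>" "\<rho> \<le> 1" and \<Omega>: "ball x0 \<rho> \<subseteq> \<Omega>"
  shows "Lpn p (\<lambda>x. \<eta> x *\<^sub>R excess_grad u k g x) \<le> ennreal (
      energy_const TYPE('a) p s \<Lambda> C1 C2 * L powr p * (LINT x:ball x0 \<rho>|lborel. excess u k x powr p)
      + 4 / C1 * far_const \<sigma> \<rho> *
        ((LINT x:ball x0 \<rho>|lborel. excess u k x) * tail_integral p s (excess u k) x0 \<rho>))"
    (is "_ \<le> ennreal (_ * ?A + _ * ?T)")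
proof -
  define \<tau> where "\<tau> = (\<sigma> + \<rho>) / 2"
  have \<tau>: "0 < \<tau>" "\<sigma> < \<tau>" "\<tau> < \<rho>" using \<sigma> by (auto simp: \<tau>_def)
  then have sub: "cball x0 \<tau> \<subseteq> \<Omega>" "cball x0 \<sigma> \<subseteq> \<Omega>" using \<Omega> by (auto simp: subset_iff)
  let ?X = "\<integral>x. norm (\<eta> x *\<^sub>R excess_grad u k g x) powr p \<partial>lborel"
  note weak = weak_inequality_cutoff[OF cut \<tau>(1,2) sub(1), of k]
  have "C1 / 2 * ?X - young_const p C1 C2 * L powr p * ?A
      - 2 * interaction_energy x0 \<sigma> \<rho> L (excess u k) \<le> 0"
    using local_energy_lower_bound[OF cut \<tau>(2) less_imp_le[OF \<tau>(3)] sub(1) weak(1)] weak(2)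
      interaction_lower_bound[OF cut \<sigma> u_measurable u_bounded, of k] by linarith
  then have "?X \<le> 2 / C1 * (young_const p C1 C2 * L powr p * ?A
      + 2 * interaction_energy x0 \<sigma> \<rho> L (excess u k))"
    using C1 by (simp add: field_simps)
  also have "\<dots> = energy_const TYPE('a) p s \<Lambda> C1 C2 * L powr p * ?A + 4 / C1 * far_const \<sigma> \<rho> * ?T"
    unfolding energy_const_def interaction_energy_def near_const_def
    using C1 by (simp add: field_simps)
  finally have "ennreal ?X \<le> ennreal \<dots>" by (rule ennreal_leI)
  moreover have "Lpn p (\<lambda>x. \<eta> x *\<^sub>R excess_grad u k g x) = ennreal ?X"
    unfolding Lpn_def by (rule
        nn_integral_eq_integral[OF cutoff_excess_grad_integrable[OF cut sub(2)]]) auto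
  ultimately show ?thesis by simp
qed

lemma far_energy_nonneg:
  "0 \<le> 4 / C1 * far_const \<sigma> \<rho> *
    ((LINT x:ball x0 \<rho>|lborel. excess u k x) * tail_integral p s (excess u k) x0 \<rho>)"
  using C1 by (intro mult_nonneg_nonneg far_const_nonneg set_integral_nonneg_real
      tail_integral_nonneg) auto

lemma cutoff_excess_energy:
  assumes cut: "cutoff x0 \<sigma> L \<eta> D\<eta>" and \<sigma>: "0 < \<sigma>" "\<sigma> < \<rho>" "\<rho> \<le> 1" and \<Omega>: "ball x0 \<rho> \<subseteq> \<Omega>"
  shows "Lpn p (\<lambda>x. \<eta> x *\<^sub>R excess_grad u k g x + excess u k x *\<^sub>R D\<eta> x) \<le> ennreal (2 powr p * (
      L powr p * (1 + energy_const TYPE('a) p s \<Lambda> C1 C2) *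
        (LINT x:ball x0 \<rho>|lborel. excess u k x powr p)
      + 4 / C1 * far_const \<sigma> \<rho> *
        ((LINT x:ball x0 \<rho>|lborel. excess u k x) * tail_integral p s (excess u k) x0 \<rho>)))"
    (is "_ \<le> ennreal (_ * (_ * ?A + ?T))")
proof -
  note [measurable] = C1_grad_measurable[OF cutoffD(1)[OF cut]]
  let ?E = "energy_const TYPE('a) p s \<Lambda> C1 C2"
  have nonneg: "0 \<le> ?A" "0 \<le> ?E"
    using C1 C2 p \<Lambda> by (auto intro!: set_integral_nonneg_real energy_const_nonneg)
  have T: "0 \<le> ?T" by (rule far_energy_nonneg)
  have "norm (excess u k x *\<^sub>R D\<eta> x) powr p
      \<le> L powr p * (indicat_real (ball x0 \<rho>) x * excess u k x powr p)" for x
  proof (cases "x \<in> cball x0 \<sigma>")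
    case True
    have "norm (excess u k x *\<^sub>R D\<eta> x) powr p \<le> (excess u k x * L) powr p"
      using cutoffD(6)[OF cut] p by (intro powr_mono2) (auto intro: mult_left_mono)
    then show ?thesis using True \<sigma> cutoffD(7)[OF cut] by (simp add: powr_mult mult.commute)
  next
    case False
    then have "D\<eta> x = 0" by (rule vanishes_outsideD[OF cutoffD(5)[OF cut]])
    then show ?thesis using p by simp
  qed
  then have "Lpn p (\<lambda>x. excess u k x *\<^sub>R D\<eta> x)
      \<le> (\<integral>\<^sup>+x. ennreal (L powr p * (indicat_real (ball x0 \<rho>) x * excess u k x powr p)) \<partial>lborel)"
    unfolding Lpn_def by (intro nn_integral_mono ennreal_leI)
  also have "\<dots> = ennreal (L powr p * ?A)"
    using excess_set_integrable(2)[of p x0 \<rho> k] p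
    by (subst nn_integral_eq_integral) (auto simp: set_integrable_def set_lebesgue_integral_def)
  finally have "Lpn p (\<lambda>x. excess u k x *\<^sub>R D\<eta> x) \<le> ennreal (L powr p * ?A)" .
  then have "Lpn p (\<lambda>x. \<eta> x *\<^sub>R excess_grad u k g x + excess u k x *\<^sub>R D\<eta> x)
      \<le> ennreal (2 powr p) * (ennreal (?E * L powr p * ?A + ?T) + ennreal (L powr p * ?A))"
    using p Caccioppoli[OF cut \<sigma> \<Omega>]
    by (intro order_trans[OF Lpn_add] mult_left_mono add_mono) (auto simp: mult.assoc)
  also have "\<dots> = ennreal (2 powr p * (L powr p * (1 + ?E) * ?A + ?T))"
    using nonneg T by (simp flip: ennreal_plus ennreal_mult' add: algebra_simps)
  finally show ?thesis .
qed

lemma superlevel_ball: "{x \<in> ball x0 \<rho>. k < u x} \<in> sets borel" "bounded {x \<in> ball x0 \<rho>. k < u x}"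
proof -
  have "{x \<in> ball x0 \<rho>. k < u x} = ball x0 \<rho> \<inter> {x \<in> space borel. k < u x}" by auto
  moreover have "{x \<in> space borel. k < u x} \<in> sets borel" by measurable
  ultimately show "{x \<in> ball x0 \<rho>. k < u x} \<in> sets borel" by auto
  show "bounded {x \<in> ball x0 \<rho>. k < u x}" by (rule bounded_subset[OF bounded_ball]) auto
qed

lemma cutoff_excess_Faber_Krahn:
  assumes cut: "cutoff x0 \<sigma> L \<eta> D\<eta>" and \<sigma>: "\<sigma> < \<rho>" and \<Omega>: "ball x0 \<rho> \<subseteq> \<Omega>"
    and r: "r > 0" "2 * measure lborel {x \<in> ball x0 \<rho>. k < u x} \<le> measure lborel (ball (0::'a) r)"
  shows "Lpn p (\<lambda>x. excess u k x * \<eta> x) \<le> ennreal (2 * (8 * r) powr p) *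
      Lpn p (\<lambda>x. \<eta> x *\<^sub>R excess_grad u k g x + excess u k x *\<^sub>R D\<eta> x)"
proof (rule Faber_Krahn[OF _ p superlevel_ball(1)[of x0 \<rho> k] _ r(1)])
  show "W1p_approx p (cball x0 \<sigma>) (\<lambda>x. excess u k x * \<eta> x)
      (\<lambda>x. \<eta> x *\<^sub>R excess_grad u k g x + excess u k x *\<^sub>R D\<eta> x)"
    using \<sigma> \<Omega>
    by (intro W1p_loc_truncation[OF weakly_differentiable p u_measurable g_measurable
          cutoffD(1,4)[OF cut], where R = "(\<sigma> + \<rho>) / 2"]) (auto simp: subset_iff)
  show "vanishes_outside {x \<in> ball x0 \<rho>. k < u x} (\<lambda>x. excess u k x * \<eta> x)"
    unfolding vanishes_outside_def
  proof (intro allI impI)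
    fix x assume "x \<notin> {x \<in> ball x0 \<rho>. k < u x}"
    then show "excess u k x * \<eta> x = 0"
      using test_grad_outside(2)[OF cut, of x] \<sigma> by (cases "x \<in> cball x0 \<sigma>") (auto simp: excess_def)
  qed
  have "2 * emeasure lborel {x \<in> ball x0 \<rho>. k < u x}
      = ennreal (2 * measure lborel {x \<in> ball x0 \<rho>. k < u x})"
    using emeasure_lborel_bounded[OF superlevel_ball(2)] by (simp add: ennreal_mult')
  also have "\<dots> \<le> ennreal (measure lborel (ball (0::'a) r))" using r(2) by (rule ennreal_leI)
  finally show "2 * emeasure lborel {x \<in> ball x0 \<rho>. k < u x} \<le> emeasure lborel (ball (0::'a) r)"
    by (simp add: emeasure_lborel_bounded)
qed

theorem De_Giorgi_step:
  assumes \<rho>: "0 < \<rho>\<^sub>1" "\<rho>\<^sub>1 < \<rho>" "\<rho> \<le> 1" and \<Omega>: "ball x0 \<rho> \<subseteq> \<Omega>"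
    and r: "r > 0" "2 * measure lborel {x \<in> ball x0 \<rho>. k < u x} \<le> measure lborel (ball (0::'a) r)"
  shows "(LINT x:ball x0 \<rho>\<^sub>1|lborel. excess u k x powr p) \<le> 2 * (16 * r) powr p * (
      (8 / (\<rho> - \<rho>\<^sub>1)) powr p * (1 + energy_const TYPE('a) p s \<Lambda> C1 C2) *
        (LINT x:ball x0 \<rho>|lborel. excess u k x powr p)
      + 4 / C1 * far_const ((\<rho>\<^sub>1 + \<rho>) / 2) \<rho> *
        ((LINT x:ball x0 \<rho>|lborel. excess u k x) * tail_integral p s (excess u k) x0 \<rho>))"
    (is "?Y \<le> _ * ?R")
proof -
  define \<sigma> where "\<sigma> = (\<rho>\<^sub>1 + \<rho>) / 2"
  have \<sigma>: "\<rho>\<^sub>1 < \<sigma>" "\<sigma> < \<rho>" "0 < \<sigma>" "4 / (\<sigma> - \<rho>\<^sub>1) = 8 / (\<rho> - \<rho>\<^sub>1)"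
    using \<rho> by (auto simp: \<sigma>_def field_simps)
  obtain \<eta> D\<eta> where cut: "cutoff x0 \<sigma> (8 / (\<rho> - \<rho>\<^sub>1)) \<eta> D\<eta>" and \<eta>: "\<And>x. x \<in> ball x0 \<rho>\<^sub>1 \<Longrightarrow> \<eta> x = 1"
    using cutoff_exists[OF \<rho>(1) \<sigma>(1), of x0] unfolding \<sigma>(4) by blast
  have R: "0 \<le> ?R"
    using C1 C2 p \<Lambda> by (intro add_nonneg_nonneg far_energy_nonneg mult_nonneg_nonneg
        set_integral_nonneg_real energy_const_nonneg) auto
  have "ennreal ?Y = (\<integral>\<^sup>+x. ennreal (indicat_real (ball x0 \<rho>\<^sub>1) x * excess u k x powr p) \<partial>lborel)"
    using excess_set_integrable(2)[of p x0 \<rho>\<^sub>1 k] p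
    by (subst nn_integral_eq_integral) (auto simp: set_integrable_def set_lebesgue_integral_def)
  also have "\<dots> \<le> Lpn p (\<lambda>x. excess u k x * \<eta> x)"
    unfolding Lpn_def by (intro nn_integral_mono ennreal_leI) (auto simp: indicator_def \<eta>)
  also have "\<dots> \<le> ennreal (2 * (8 * r) powr p) *
      Lpn p (\<lambda>x. \<eta> x *\<^sub>R excess_grad u k g x + excess u k x *\<^sub>R D\<eta> x)"
    by (rule cutoff_excess_Faber_Krahn[OF cut \<sigma>(2) \<Omega> r])
  also have "\<dots> \<le> ennreal (2 * (8 * r) powr p) * ennreal (2 powr p * ?R)"
    using cutoff_excess_energy[OF cut \<sigma>(3,2) \<rho>(3) \<Omega>, of k] unfolding \<sigma>_def
    by (rule mult_left_mono) simp
  also have "\<dots> = ennreal (2 * (16 * r) powr p * ?R)"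
    using powr_mult[of 2 "8 * r" p] r(1) by (simp flip: ennreal_mult' add: mult_ac)
  finally show ?thesis using R by (subst (asm) ennreal_le_iff) auto
qed

end

section \<open>De Giorgi iteration\<close>

lemma fast_geometric_decay:
  fixes y :: "nat \<Rightarrow> real"
  assumes nonneg: "\<And>j. 0 \<le> y j"
    and step: "\<And>j. y j \<le> 1 \<Longrightarrow> y (Suc j) \<le> D * B ^ j * (y j * y j powr \<beta>)"
    and B: "B > 1" and D: "D \<ge> 0" and \<beta>: "\<beta> > 0"
    and start: "y 0 \<le> 1" "D * y 0 powr \<beta> \<le> B powr (- 1 / \<beta>)"
  shows "y j \<le> y 0 * (B powr (- 1 / \<beta>)) ^ j"
proof -
  define \<theta> where "\<theta> = B powr (- 1 / \<beta>)"
  have \<theta>: "0 < \<theta>" "\<theta> \<le> 1" using B \<beta> powr_mono[of "- 1 / \<beta>" 0 B] by (auto simp: \<theta>_def)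
  have \<theta>_powr: "(\<theta> ^ j) powr \<beta> = (1 / B) ^ j" for j
  proof -
    have "\<theta> powr \<beta> = B powr (- 1)" unfolding \<theta>_def powr_powr using \<beta> by simp
    then have "\<theta> powr \<beta> = 1 / B" using B by (simp add: powr_minus_divide)
    moreover have "(\<theta> ^ j) powr \<beta> = (\<theta> powr \<beta>) ^ j"
      using \<theta> by (simp add: powr_realpow[symmetric] powr_powr mult.commute)
    ultimately show ?thesis by simp
  qed
  have "y j \<le> y 0 * \<theta> ^ j"
  proof (induction j)
    case (Suc j)
    have \<theta>j: "\<theta> ^ j \<le> 1" "0 \<le> \<theta> ^ j" using \<theta> by (auto intro: power_le_one)
    then have "y 0 * \<theta> ^ j \<le> 1 * 1" using start(1) nonneg by (intro mult_mono) auto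
    then have "y (Suc j) \<le> D * B ^ j * (y j * y j powr \<beta>)" using step Suc.IH by simp
    also have "\<dots> \<le> D * B ^ j * ((y 0 * \<theta> ^ j) * (y 0 * \<theta> ^ j) powr \<beta>)"
      using Suc.IH nonneg[of j] nonneg[of 0] D B \<beta> \<theta>j
      by (intro mult_left_mono mult_mono powr_mono2) auto
    also have "\<dots> = (D * y 0 powr \<beta>) * (y 0 * \<theta> ^ j)"
      using B nonneg[of 0] \<theta>j by (simp add: powr_mult \<theta>_powr power_one_over)
    also have "\<dots> \<le> \<theta> * (y 0 * \<theta> ^ j)"
      using start(2) nonneg[of 0] \<theta>j unfolding \<theta>_def[symmetric] by (intro mult_right_mono) auto
    finally show ?case by (simp add: mult_ac)
  qed simp
  then show ?thesis by (simp add: \<theta>_def)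
qed

lemma fast_geometric_convergence:
  fixes y :: "nat \<Rightarrow> real"
  assumes nonneg: "\<And>j. 0 \<le> y j"
    and step: "\<And>j. y j \<le> 1 \<Longrightarrow> y (Suc j) \<le> D * B ^ j * (y j * y j powr \<beta>)"
    and B: "B > 1" and D: "D \<ge> 1" and \<beta>: "\<beta> > 0"
    and start: "y 0 \<le> D powr (- 1 / \<beta>) * B powr (- 1 / \<beta>\<^sup>2)"
  shows "y \<longlonglongrightarrow> 0"
proof -
  have "D powr (- 1 / \<beta>) \<le> D powr 0" "B powr (- 1 / \<beta>\<^sup>2) \<le> B powr 0"
    using B D \<beta> by (intro powr_mono; simp)+
  then have "D powr (- 1 / \<beta>) * B powr (- 1 / \<beta>\<^sup>2) \<le> 1 * 1" using B D by (intro mult_mono) auto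
  then have y0: "y 0 \<le> 1" using start by linarith
  have "y 0 powr \<beta> \<le> (D powr (- 1 / \<beta>) * B powr (- 1 / \<beta>\<^sup>2)) powr \<beta>"
    using start nonneg \<beta> by (intro powr_mono2) auto
  also have "\<dots> = D powr (- 1) * B powr (- 1 / \<beta>)"
    using \<beta> by (simp add: powr_mult powr_powr power2_eq_square)
  also have "\<dots> = B powr (- 1 / \<beta>) / D" using D by (simp add: powr_minus_divide)
  finally have "D * y 0 powr \<beta> \<le> B powr (- 1 / \<beta>)" using D by (simp add: field_simps)
  then have decay: "y j \<le> y 0 * (B powr (- 1 / \<beta>)) ^ j" for j
    using fast_geometric_decay[where y = y, OF nonneg step B _ \<beta> y0] D by simp
  have "B powr (- 1 / \<beta>) < B powr 0" using B \<beta> by (intro powr_less_mono) auto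
  then have "(\<lambda>j. y 0 * (B powr (- 1 / \<beta>)) ^ j) \<longlonglongrightarrow> y 0 * 0"
    using B by (intro tendsto_mult tendsto_const LIMSEQ_realpow_zero) auto
  then have lim: "(\<lambda>j. y 0 * (B powr (- 1 / \<beta>)) ^ j) \<longlonglongrightarrow> 0" by simp
  show ?thesis
    by (rule tendsto_sandwich[OF _ _ tendsto_const lim])
      (use nonneg decay in \<open>auto intro!: always_eventually\<close>)
qed

definition step_const :: "real \<Rightarrow> real \<Rightarrow> real \<Rightarrow> real \<Rightarrow> real \<Rightarrow> real" where
  "step_const p N q a c
      = 2 * 16 powr p * (2 * 2 powr p) powr (p / N) * (32 powr p * a + c * 8 powr q * 4 powr p)"

lemma step_const_ge_1:
  assumes "p > 1" "N > 0" "a \<ge> 1" "c \<ge> 0"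
  shows "step_const p N q a c \<ge> 1"
proof -
  have "1 \<le> (16::real) powr p" "1 \<le> (32::real) powr p" "1 \<le> (2::real) powr p"
    using assms by (auto intro!: ge_one_powr_ge_zero)
  moreover have "1 \<le> (2 * 2 powr p :: real) powr (p / N)"
    using assms \<open>1 \<le> 2 powr p\<close> by (intro ge_one_powr_ge_zero) auto
  moreover have "1 * 1 \<le> 32 powr p * a" using assms \<open>1 \<le> 32 powr p\<close> by (intro mult_mono) auto
  then have "1 \<le> 32 powr p * a + c * 8 powr q * 4 powr p" using assms by (simp add: add_increasing2)
  ultimately have "1 * 1 * 1 * 1 \<le> 2 * 16 powr p * (2 * 2 powr p) powr (p / N) *
      (32 powr p * a + c * 8 powr q * 4 powr p)" by (intro mult_mono) auto
  then show ?thesis by (simp add: step_const_def)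
qed

lemma one_le_powr_one_minus:
  fixes \<delta> p :: real
  assumes "0 < \<delta>" "\<delta> \<le> 1" "p \<ge> 1"
  shows "1 \<le> \<delta> powr (1 - p)"
  using powr_mono'[of "1 - p" 0 \<delta>] assms by simp

lemma radius_factor:
  fixes p N r t y :: real
  assumes "r > 0" "t > 0" "y > 0"
  shows "(16 * (r * (2 * (2 * t) powr p * y) powr (1 / N))) powr p
    = 16 powr p * (2 * 2 powr p) powr (p / N) * (r powr p * (t powr (p * p / N) * y powr (p / N)))"
  using assms by (simp add: powr_mult powr_powr mult_ac)

lemma near_factor_le:
  fixes p q r t \<delta> Y a :: real
  assumes "p > 1" "q \<ge> 0" "r > 0" "t \<ge> 1" "0 < \<delta>" "\<delta> \<le> 1" "Y \<ge> 0" "a \<ge> 0"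
  shows "(32 * t / r) powr p * a * Y
      \<le> 32 powr p * a * (t powr (p + q) * \<delta> powr (1 - p) * Y / r powr p)"
proof -
  have "t powr p * 1 \<le> t powr (p + q) * \<delta> powr (1 - p)"
    using assms one_le_powr_one_minus[of \<delta> p] by (intro mult_mono powr_mono) auto
  then have "32 powr p * a * (t powr p * 1 * (Y / r powr p))
      \<le> 32 powr p * a * (t powr (p + q) * \<delta> powr (1 - p) * (Y / r powr p))"
    using assms by (intro mult_left_mono mult_right_mono) auto
  then show ?thesis using assms by (simp add: powr_divide powr_mult mult_ac)
qed

lemma far_factor_le:
  fixes p q r t k \<delta> Y c :: real
  assumes "p > 1" "r > 0" "t \<ge> 1" "k > 0" "\<delta> > 0" "Y \<ge> 0" "c \<ge> 0"
  shows "c * (8 * t) powr q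
      * ((2 * t / k) powr (p - 1) * Y * ((2 / r) powr p * (k / \<delta>) powr (p - 1)))
    \<le> c * 8 powr q * 4 powr p * (t powr (p + q) * \<delta> powr (1 - p) * Y / r powr p)"
proof -
  have "(2 * t / k) powr (p - 1) * (k / \<delta>) powr (p - 1) = (2 * t) powr (p - 1) * \<delta> powr (1 - p)"
    using assms by (simp add: powr_divide powr_diff field_simps)
  then have "c * (8 * t) powr q
      * ((2 * t / k) powr (p - 1) * Y * ((2 / r) powr p * (k / \<delta>) powr (p - 1)))
      = c * (8 * t) powr q * ((2 * t) powr (p - 1) * \<delta> powr (1 - p) * ((2 / r) powr p * Y))"
    by (simp add: mult_ac)
  also have "\<dots> \<le> c * (8 * t) powr q * ((2 * t) powr p * \<delta> powr (1 - p) * ((2 / r) powr p * Y))"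
    using assms by (intro mult_left_mono mult_right_mono powr_mono) auto
  also have "\<dots> = c * 8 powr q * (2 powr p * 2 powr p)
      * (t powr p * t powr q * \<delta> powr (1 - p) * Y / r powr p)"
    using assms by (simp add: powr_mult powr_divide mult_ac)
  also have "2 powr p * 2 powr p = (4::real) powr p" by (simp flip: powr_mult)
  also have "t powr p * t powr q = t powr (p + q)" by (simp add: powr_add)
  finally show ?thesis .
qed

lemma step_const_bound:
  fixes p N q r t k y Y \<delta> a c \<beta> :: real
  assumes "p > 1" "N > 0" "q \<ge> 0" "r > 0" "t \<ge> 1" "k > 0" "0 < y" "y \<le> 1" "Y \<ge> 0" "0 < \<delta>" "\<delta> \<le> 1"
    and "a \<ge> 0" "c \<ge> 0" "\<beta> \<le> p / N"
  shows "2 * (16 * (r * (2 * (2 * t) powr p * y) powr (1 / N))) powr p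
      * ((32 * t / r) powr p * a * Y +
      c * (8 * t) powr q * ((2 * t / k) powr (p - 1) * Y * ((2 / r) powr p * (k / \<delta>) powr (p - 1))))
    \<le> step_const p N q a c * \<delta> powr (1 - p) * t powr (p * p / N + p + q) * (y powr \<beta> * Y)"
proof -
  define Z where "Z = t powr (p + q) * \<delta> powr (1 - p) * Y"
  define P where "P = 16 powr p * (2 * 2 powr p) powr (p / N)"
  define S where "S = 32 powr p * a + c * 8 powr q * 4 powr p"
  have t_pos: "0 < t" using assms by simp
  have nonneg: "0 \<le> Z" "0 \<le> P" "0 \<le> S" using assms by (auto simp: Z_def P_def S_def)
  have "2 * (16 * (r * (2 * (2 * t) powr p * y) powr (1 / N))) powr p
      * ((32 * t / r) powr p * a * Y +
      c * (8 * t) powr q * ((2 * t / k) powr (p - 1) * Y * ((2 / r) powr p * (k / \<delta>) powr (p - 1))))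
    \<le> 2 * (P * (r powr p * (t powr (p * p / N) * y powr (p / N)))) *
      (32 powr p * a * (Z / r powr p) + c * 8 powr q * 4 powr p * (Z / r powr p))"
    unfolding radius_factor[OF assms(4) t_pos assms(7)] Z_def P_def
    using assms near_factor_le[of p q r t \<delta> Y a] far_factor_le[of p r t k \<delta> Y c q]
    by (intro mult_left_mono add_mono) auto
  also have "\<dots> = 2 * P * S * t powr (p * p / N) * Z * y powr (p / N)"
    using assms by (simp add: S_def field_simps)
  also have "\<dots> \<le> 2 * P * S * t powr (p * p / N) * Z * y powr \<beta>"
    using assms nonneg powr_mono'[of \<beta> "p / N" y] by (intro mult_left_mono) auto
  also have "\<dots> = step_const p N q a c * \<delta> powr (1 - p) * (t powr (p * p / N) * t powr (p + q))
      * (y powr \<beta> * Y)"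
    by (simp add: step_const_def P_def S_def Z_def mult_ac)
  also have "t powr (p * p / N) * t powr (p + q) = t powr (p * p / N + p + q)"
    by (simp flip: powr_add add: add.assoc)
  finally show ?thesis .
qed

lemma excess_antimono: "l \<le> m \<Longrightarrow> excess u m x \<le> excess u l x"
  by (simp add: excess_def)

lemma one_le_scaled_excess:
  assumes "l < m" "m < u x"
  shows "1 \<le> 1 / (m - l) * excess u l x"
  using assms by (simp add: excess_def field_simps)

lemma excess_Chebyshev:
  assumes l: "l < m" and p: "p > 1"
  shows "m < u x \<Longrightarrow> 1 \<le> (1 / (m - l)) powr p * excess u l x powr p"
    and "excess u m x \<le> (1 / (m - l)) powr (p - 1) * excess u l x powr p"
proof -
  show "1 \<le> (1 / (m - l)) powr p * excess u l x powr p" if "m < u x"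
    using ge_one_powr_ge_zero[OF one_le_scaled_excess[of l m u x], of p] l that p
    by (simp add: powr_divide)
  show "excess u m x \<le> (1 / (m - l)) powr (p - 1) * excess u l x powr p"
  proof (cases "m < u x")
    case True
    then have pos: "0 < excess u l x" using l by (simp add: excess_def)
    have "1 \<le> (1 / (m - l)) powr (p - 1) * excess u l x powr (p - 1)"
      using ge_one_powr_ge_zero[OF one_le_scaled_excess[of l m u x], of "p - 1"] l True p
      by (simp add: powr_divide)
    from mult_left_mono[OF this less_imp_le[OF pos]]
    have "excess u l x \<le> (1 / (m - l)) powr (p - 1) * (excess u l x powr (p - 1) * excess u l x)"
      by (simp add: mult_ac)
    also have "excess u l x powr (p - 1) * excess u l x = excess u l x powr p"
      using pos by (simp add: powr_diff)
    finally show ?thesis using excess_antimono[of l m u x] l by simp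
  qed (simp add: excess_def)
qed

lemma measure_ball_scaled:
  fixes x0 :: "'a::euclidean_space"
  assumes "r > 0" "c > 0"
  shows "measure lborel (ball (0::'a) (r * c powr (1 / real DIM('a))))
      = c * measure lborel (ball x0 r)"
proof -
  have "(c powr (1 / real DIM('a))) ^ DIM('a) = c"
    using assms by (simp add: powr_realpow[symmetric] powr_powr)
  then show ?thesis using assms by (simp add: content_ball power_mult_distrib)
qed

context mixed_subsolution
begin

lemma excess_energy_mono:
  assumes "l \<le> m" "\<rho>\<^sub>1 \<le> \<rho>"
  shows "(LINT x:ball x0 \<rho>\<^sub>1|lborel. excess u m x powr p)
      \<le> (LINT x:ball x0 \<rho>|lborel. excess u l x powr p)"
  unfolding set_lebesgue_integral_def
proof (rule integral_mono)
  show "indicat_real (ball x0 \<rho>\<^sub>1) x *\<^sub>R excess u m x powr p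
    \<le> indicat_real (ball x0 \<rho>) x *\<^sub>R excess u l x powr p" for x
    using excess_antimono[OF assms(1), of u x] assms(2) p
    by (auto simp: indicator_def intro!: powr_mono2)
qed (use excess_set_integrable(2) p in \<open>auto simp: set_integrable_def\<close>)

lemma excess_integral_le:
  assumes "l < m"
  shows "(LINT x:ball x0 \<rho>|lborel. excess u m x)
    \<le> (1 / (m - l)) powr (p - 1) * (LINT x:ball x0 \<rho>|lborel. excess u l x powr p)"
  unfolding set_integral_mult_right[symmetric]
  using assms p excess_set_integrable
  by (intro set_integral_mono excess_Chebyshev(2) set_integrable_mult_right) auto

lemma superlevel_measure_le:
  assumes "l < m"
  shows "measure lborel {x \<in> ball x0 \<rho>. m < u x}
    \<le> (1 / (m - l)) powr p * (LINT x:ball x0 \<rho>|lborel. excess u l x powr p)"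
proof -
  let ?E = "{x \<in> ball x0 \<rho>. m < u x}"
  have "measure lborel ?E = (\<integral>x. indicat_real ?E x \<partial>lborel)"
    using superlevel_ball(1)[of x0 \<rho> m] by simp
  also have "\<dots> \<le> (\<integral>x. indicat_real (ball x0 \<rho>) x *\<^sub>R ((1 / (m - l)) powr p
      * excess u l x powr p) \<partial>lborel)"
  proof (rule integral_mono)
    show "integrable lborel (indicat_real ?E)"
      using superlevel_ball[of x0 \<rho> m] emeasure_bounded_finite
      by (intro integrable_real_indicator) auto
    show "integrable lborel (\<lambda>x.
        indicat_real (ball x0 \<rho>) x *\<^sub>R ((1 / (m - l)) powr p * excess u l x powr p))"
      using set_integrable_mult_right[OF excess_set_integrable(2)] p
      by (simp add: set_integrable_def)
    show "indicat_real ?E x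
        \<le> indicat_real (ball x0 \<rho>) x *\<^sub>R ((1 / (m - l)) powr p * excess u l x powr p)" for x
      using excess_Chebyshev(1)[OF assms p, of u x] by (auto simp: indicator_def)
  qed
  also have "\<dots> = (1 / (m - l)) powr p * (LINT x:ball x0 \<rho>|lborel. excess u l x powr p)"
    unfolding set_lebesgue_integral_def[symmetric] by simp
  finally show ?thesis .
qed

lemma tail_integral_excess_mono:
  assumes "l \<le> m" "0 < \<rho>\<^sub>1" "\<rho>\<^sub>1 \<le> \<rho>"
  shows "tail_integral p s (excess u m) x0 \<rho> \<le> tail_integral p s (excess u l) x0 \<rho>\<^sub>1"
  unfolding tail_integral_def set_lebesgue_integral_def
proof (rule integral_mono)
  fix y
  have "excess u m y powr (p - 1) \<le> excess u l y powr (p - 1)"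
    using excess_antimono[OF assms(1)] p by (intro powr_mono2) auto
  then have "tail_density p s (excess u m) x0 y \<le> tail_density p s (excess u l) x0 y"
    unfolding tail_density_def by (rule mult_right_mono) simp
  then show "indicat_real (- ball x0 \<rho>) y *\<^sub>R tail_density p s (excess u m) x0 y
    \<le> indicat_real (- ball x0 \<rho>\<^sub>1) y *\<^sub>R tail_density p s (excess u l) x0 y"
    using assms(3) by (auto simp: indicator_def)
qed (use excess_set_integrable(3) assms in \<open>auto simp: set_integrable_def\<close>)

end

definition iteration_const :: "'a::euclidean_space itself \<Rightarrow> real \<Rightarrow> real \<Rightarrow> real \<Rightarrow> real \<Rightarrow> real
    \<Rightarrow> real" where
  "iteration_const _ p s \<Lambda> C1 C2 = step_const p (real DIM('a)) (real DIM('a) + p * s)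
     (1 + energy_const TYPE('a) p s \<Lambda> C1 C2) (4 * \<Lambda> / C1)"

definition growth_const :: "'a::euclidean_space itself \<Rightarrow> real \<Rightarrow> real \<Rightarrow> real" where
  "growth_const _ p s = 2 powr (p * p / real DIM('a) + p + (real DIM('a) + p * s))"

lemma iteration_const_ge_1:
  assumes "p > 1" "\<Lambda> \<ge> 1" "C1 > 0" "C2 > 0"
  shows "1 \<le> iteration_const TYPE('a::euclidean_space) p s \<Lambda> C1 C2"
  unfolding iteration_const_def
  using assms energy_const_nonneg[of p \<Lambda> C1 C2] by (intro step_const_ge_1) auto

lemma growth_const_gt_1:
  assumes "p > 1" "s > 0"
  shows "1 < growth_const TYPE('a::euclidean_space) p s"
  unfolding growth_const_def
  using assms by (intro gr_one_powr) (auto intro!: add_nonneg_pos add_pos_pos)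

locale level_iteration = mixed_subsolution p s \<Lambda> K \<Omega> C1 C2 M u g b
  for p s \<Lambda> and K :: "'a::euclidean_space \<Rightarrow> 'a \<Rightarrow> real" and \<Omega> C1 C2 M u g b +
  fixes x0 :: 'a and r k \<delta> :: real
  assumes r: "0 < r" "r \<le> 1" and ball_subset: "ball x0 r \<subseteq> \<Omega>" and k: "0 < k" and \<delta>: "0 < \<delta>" "\<delta> \<le> 1"
    and tail: "tail_integral p s (excess u 0) x0 (r / 2) \<le> (2 / r) powr p * (k / \<delta>) powr (p - 1)"
begin

definition level :: "nat \<Rightarrow> real" where
  "level j = k * (1 - 1 / 2 ^ j)"

definition radius :: "nat \<Rightarrow> real" where
  "radius j = r / 2 * (1 + 1 / 2 ^ j)"

definition energy :: "nat \<Rightarrow> real" where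
  "energy j = (LINT x:ball x0 (radius j)|lborel. excess u (level j) x powr p)"

definition normalized_energy :: "nat \<Rightarrow> real" where
  "normalized_energy j = energy j / (k powr p * measure lborel (ball x0 r))"

definition comparison_radius :: "nat \<Rightarrow> real" where
  "comparison_radius j = r * (2 * (2 * 2 ^ j) powr p * normalized_energy j) powr (1 / real DIM('a))"

lemma level_bounds: "0 \<le> level j" "level j \<le> k"
  using k by (auto simp: level_def)

lemma level_diff: "level (Suc j) - level j = k / (2 * 2 ^ j)"
  by (simp add: level_def field_simps)

lemma level_less: "level j < level (Suc j)"
proof -
  have "0 < level (Suc j) - level j" unfolding level_diff using k by simp
  then show ?thesis by simp
qed

lemma radius_diff: "radius j - radius (Suc j) = r / (4 * 2 ^ j)"
  by (simp add: radius_def field_simps)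

lemma radius_bounds: "r / 2 < radius j" "radius j \<le> r" "radius (Suc j) < radius j"
proof -
  show "r / 2 < radius j" "radius j \<le> r"
    using r mult_strict_left_mono[of 1 "1 + 1 / 2 ^ j" "r / 2"]
        mult_left_mono[of "1 + 1 / 2 ^ j" 2 "r / 2"]
    by (auto simp: radius_def)
  have "0 < radius j - radius (Suc j)" unfolding radius_diff using r by simp
  then show "radius (Suc j) < radius j" by simp
qed

lemma radius_pos: "0 < radius j"
  using radius_bounds(1)[of j] r by linarith

lemma energy_nonneg: "0 \<le> energy j"
  unfolding energy_def by (intro set_integral_nonneg_real) simp

lemma scale_pos: "0 < k powr p * measure lborel (ball x0 r)"
  using k r by (simp add: content_ball_pos)

lemma normalized_energy_nonneg: "0 \<le> normalized_energy j"
  using energy_nonneg scale_pos by (simp add: normalized_energy_def)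

lemma normalized_energy_pos: "0 < energy j \<Longrightarrow> 0 < normalized_energy j"
  using scale_pos by (simp add: normalized_energy_def)

lemma energy_antimono: "energy (Suc j) \<le> energy j"
  unfolding energy_def using level_less radius_bounds(3) by (intro excess_energy_mono less_imp_le)

lemma far_const_le: "far_const ((radius (Suc j) + radius j) / 2) (radius j)
  \<le> \<Lambda> * (8 * 2 ^ j) powr (real DIM('a) + p * s)"
proof -
  let ?q = "real DIM('a) + p * s"
  have "1 - (radius (Suc j) + radius j) / 2 / radius j = r / (4 * 2 ^ j) / (2 * radius j)"
    unfolding radius_diff[of j, symmetric] using radius_pos[of j] by (simp add: field_simps)
  moreover have "1 / (8 * 2 ^ j) \<le> r / (4 * 2 ^ j) / (2 * radius j)"
    using radius_pos[of j] radius_bounds(2)[of j] r by (simp add: field_simps)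
  moreover have "0 < p * s" using p s by simp
  ultimately have "(1 - (radius (Suc j) + radius j) / 2 / radius j) powr (- ?q)
      \<le> (1 / (8 * 2 ^ j)) powr (- ?q)"
    by (intro powr_mono2') auto
  also have "\<dots> = (8 * 2 ^ j) powr ?q" by (simp only: powr_divide powr_minus_divide) simp
  finally show ?thesis unfolding far_const_def using \<Lambda> by (intro mult_left_mono) auto
qed

lemma far_product_le:
  "(LINT x:ball x0 (radius j)|lborel. excess u (level (Suc j)) x)
      * tail_integral p s (excess u (level (Suc j))) x0 (radius j)
    \<le> (2 * 2 ^ j / k) powr (p - 1) * energy j * ((2 / r) powr p * (k / \<delta>) powr (p - 1))"
proof (rule mult_mono)
  show "(LINT x:ball x0 (radius j)|lborel. excess u (level (Suc j)) x)
    \<le> (2 * 2 ^ j / k) powr (p - 1) * energy j"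
    using excess_integral_le[OF level_less, of x0 "radius j" j] unfolding level_diff energy_def
    by simp
  show "tail_integral p s (excess u (level (Suc j))) x0 (radius j)
      \<le> (2 / r) powr p * (k / \<delta>) powr (p - 1)"
    using tail_integral_excess_mono[of 0 "level (Suc j)" "r / 2" "radius j" x0] tail
      level_bounds(1)[of "Suc j"] radius_bounds(1)[of j] r by simp
qed (auto intro: tail_integral_nonneg mult_nonneg_nonneg energy_nonneg)

lemma superlevel_measure_le_ball:
  assumes "0 < energy j"
  shows "2 * measure lborel {x \<in> ball x0 (radius j). level (Suc j) < u x}
    \<le> measure lborel (ball (0::'a) (comparison_radius j))"
proof -
  have "measure lborel (ball (0::'a) (comparison_radius j))
      = 2 * (2 * 2 ^ j) powr p * normalized_energy j * measure lborel (ball x0 r)"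
    unfolding comparison_radius_def
    using normalized_energy_pos[OF assms] r by (intro measure_ball_scaled) auto
  also have "\<dots> = 2 * ((2 * 2 ^ j) powr p * (energy j / k powr p))"
    using content_ball_pos[of r x0] r by (simp add: normalized_energy_def)
  also have "(2 * 2 ^ j) powr p * (energy j / k powr p) = (2 * 2 ^ j / k) powr p * energy j"
    using k by (simp add: powr_divide)
  finally show ?thesis
    using superlevel_measure_le[OF level_less, of x0 "radius j" j] unfolding level_diff energy_def
    by simp
qed

lemma energy_step:
  assumes "0 < energy j"
  shows "energy (Suc j) \<le> 2 * (16 * comparison_radius j) powr p *
      ((32 * 2 ^ j / r) powr p * (1 + energy_const TYPE('a) p s \<Lambda> C1 C2) * energy j +
       4 * \<Lambda> / C1 * (8 * 2 ^ j) powr (real DIM('a) + p * s) *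
         ((2 * 2 ^ j / k) powr (p - 1) * energy j * ((2 / r) powr p * (k / \<delta>) powr (p - 1))))"
    (is "_ \<le> _ * (?near * energy j + ?far)")
proof -
  have comparison_radius: "0 < comparison_radius j"
    using normalized_energy_pos[OF assms] r by (simp add: comparison_radius_def)
  have "ball x0 (radius j) \<subseteq> \<Omega>" using radius_bounds(2)[of j] ball_subset by auto
  moreover have "radius j \<le> 1" using radius_bounds(2)[of j] r by simp
  ultimately have "energy (Suc j) \<le> 2 * (16 * comparison_radius j) powr p * (
      ?near * (LINT x:ball x0 (radius j)|lborel. excess u (level (Suc j)) x powr p)
      + 4 / C1 * far_const ((radius (Suc j) + radius j) / 2) (radius j) *
        ((LINT x:ball x0 (radius j)|lborel. excess u (level (Suc j)) x)
          * tail_integral p s (excess u (level (Suc j))) x0 (radius j)))"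
    using De_Giorgi_step[OF radius_pos radius_bounds(3) _ _ comparison_radius
        superlevel_measure_le_ball[OF assms]]
    unfolding energy_def radius_diff by simp
  also have "\<dots> \<le> 2 * (16 * comparison_radius j) powr p
      * (?near * energy j + 4 / C1 * (\<Lambda> * (8 * 2 ^ j) powr (real DIM('a) + p * s)) *
      ((2 * 2 ^ j / k) powr (p - 1) * energy j * ((2 / r) powr p * (k / \<delta>) powr (p - 1))))"
  proof (intro mult_left_mono add_mono)
    show "(LINT x:ball x0 (radius j)|lborel. excess u (level (Suc j)) x powr p) \<le> energy j"
      unfolding energy_def by (intro excess_energy_mono less_imp_le[OF level_less] order_refl)
    show "4 / C1 * far_const ((radius (Suc j) + radius j) / 2) (radius j) *
        ((LINT x:ball x0 (radius j)|lborel. excess u (level (Suc j)) x)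
          * tail_integral p s (excess u (level (Suc j))) x0 (radius j))
      \<le> 4 / C1 * (\<Lambda> * (8 * 2 ^ j) powr (real DIM('a) + p * s)) *
        ((2 * 2 ^ j / k) powr (p - 1) * energy j * ((2 / r) powr p * (k / \<delta>) powr (p - 1)))"
      using C1 \<Lambda> by (intro mult_mono[OF mult_left_mono[OF far_const_le] far_product_le])
        (auto intro!: mult_nonneg_nonneg set_integral_nonneg_real tail_integral_nonneg)
  qed (use energy_const_nonneg[OF p \<Lambda> C1 C2, where 'a = 'a] in auto)
  finally show ?thesis by (simp add: mult.assoc)
qed

lemma normalized_energy_step:
  assumes \<beta>: "\<beta> \<le> p / real DIM('a)" and small: "normalized_energy j \<le> 1"
  shows "normalized_energy (Suc j) \<le> iteration_const TYPE('a) p s \<Lambda> C1 C2 * \<delta> powr (1 - p) *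
    growth_const TYPE('a) p s ^ j * (normalized_energy j * normalized_energy j powr \<beta>)"
proof (cases "energy j = 0")
  case True
  then show ?thesis
    using energy_antimono[of j] energy_nonneg[of "Suc j"] by (simp add: normalized_energy_def)
next
  case False
  then have pos: "0 < energy j" using energy_nonneg[of j] by simp
  then have y: "0 < normalized_energy j" by (rule normalized_energy_pos)
  have "0 \<le> p * s" using p s by simp
  then have "energy (Suc j) \<le> iteration_const TYPE('a) p s \<Lambda> C1 C2 * \<delta> powr (1 - p) *
      (2 ^ j) powr (p * p / real DIM('a) + p + (real DIM('a) + p * s)) *
        (normalized_energy j powr \<beta> * energy j)"
    unfolding iteration_const_def
    using p r k \<delta> C1 C2 \<Lambda> \<beta> small y energy_nonneg energy_const_nonneg[of p \<Lambda> C1 C2, where 'a = 'a]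
    by (intro order_trans[OF energy_step[OF pos, unfolded comparison_radius_def]]
      step_const_bound) auto
  also have "(2 ^ j) powr (p * p / real DIM('a) + p + (real DIM('a) + p * s))
      = growth_const TYPE('a) p s ^ j"
    by (simp add: growth_const_def powr_realpow[symmetric] powr_powr mult.commute)
  finally have "normalized_energy (Suc j) \<le> iteration_const TYPE('a) p s \<Lambda> C1 C2 * \<delta> powr (1 - p) *
      growth_const TYPE('a) p s ^ j * (normalized_energy j powr \<beta> * energy j) /
        (k powr p * measure lborel (ball x0 r))"
    unfolding normalized_energy_def[of "Suc j"] using scale_pos by (intro divide_right_mono) auto
  then show ?thesis by (simp add: normalized_energy_def mult_ac)
qed

lemma normalized_energy_tendsto_0:
  assumes "0 < \<beta>" "\<beta> \<le> p / real DIM('a)"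
    and "normalized_energy 0
        \<le> (iteration_const TYPE('a) p s \<Lambda> C1 C2 * \<delta> powr (1 - p)) powr (- 1 / \<beta>)
      * growth_const TYPE('a) p s powr (- 1 / \<beta>\<^sup>2)"
  shows "normalized_energy \<longlonglongrightarrow> 0"
proof (rule fast_geometric_convergence[OF normalized_energy_nonneg
  normalized_energy_step[OF assms(2)] _ _ assms(1,3)])
  show "1 < growth_const TYPE('a) p s" using p s by (intro growth_const_gt_1)
  have "1 * 1 \<le> iteration_const TYPE('a) p s \<Lambda> C1 C2 * \<delta> powr (1 - p)"
    using iteration_const_ge_1[OF p \<Lambda> C1 C2, of s, where 'a = 'a] one_le_powr_one_minus[of \<delta> p] p \<delta>
    by (intro mult_mono) auto
  then show "1 \<le> iteration_const TYPE('a) p s \<Lambda> C1 C2 * \<delta> powr (1 - p)" by simp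
qed

lemma AE_le_final_level:
  assumes lim: "normalized_energy \<longlonglongrightarrow> 0"
  shows "AE x in lborel. x \<in> ball x0 (r / 2) \<longrightarrow> u x \<le> k"
proof -
  let ?Z = "LINT x:ball x0 (r / 2)|lborel. excess u k x powr p"
  have "?Z \<le> energy j" for j
    unfolding energy_def using level_bounds(2)[of j] radius_bounds(1)[of j]
    by (intro excess_energy_mono) auto
  then have "?Z / (k powr p * measure lborel (ball x0 r)) \<le> normalized_energy j" for j
    unfolding normalized_energy_def using scale_pos by (intro divide_right_mono) auto
  then have "?Z / (k powr p * measure lborel (ball x0 r)) \<le> 0"
    by (intro LIMSEQ_le_const[OF lim]) auto
  then have "?Z \<le> 0" using scale_pos by (auto simp: divide_le_0_iff)
  moreover have "0 \<le> ?Z" by (intro set_integral_nonneg_real) simp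
  ultimately have "?Z = 0" by simp
  then have "(\<integral>x. indicat_real (ball x0 (r / 2)) x * excess u k x powr p \<partial>lborel) = 0"
    by (simp add: set_lebesgue_integral_def)
  then have "AE x in lborel. indicat_real (ball x0 (r / 2)) x * excess u k x powr p = 0"
    using integral_nonneg_eq_0_iff_AE[of lborel "\<lambda>x.
        indicat_real (ball x0 (r / 2)) x * excess u k x powr p"]
      excess_set_integrable(2)[of p x0 "r / 2" k] p
    by (simp add: set_integrable_def)
  then show ?thesis by eventually_elim (auto simp: excess_def max_def split: if_splits)
qed

end

definition bound_const :: "'a::euclidean_space itself \<Rightarrow> real \<Rightarrow> real \<Rightarrow> real \<Rightarrow> real \<Rightarrow> real \<Rightarrow> real
    \<Rightarrow> real" where
  "bound_const _ p s \<Lambda> C1 C2 \<beta> = (iteration_const TYPE('a) p s \<Lambda> C1 C2 powr (1 / \<beta>) *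
     growth_const TYPE('a) p s powr (1 / \<beta>\<^sup>2)) powr (1 / p)"

lemma bound_const_pos:
  assumes "p > 1" "s > 0" "\<Lambda> \<ge> 1" "C1 > 0" "C2 > 0"
  shows "0 < bound_const TYPE('a::euclidean_space) p s \<Lambda> C1 C2 \<beta>"
  unfolding bound_const_def
  using iteration_const_ge_1[where 'a = 'a, of p \<Lambda> C1 C2 s]
      growth_const_gt_1[where 'a = 'a, of p s] assms by simp

lemma start_condition:
  fixes A B \<delta> a k p \<beta> :: real
  assumes "A > 0" "B > 0" "\<delta> > 0" "a \<ge> 0" "k > 0" "p > 0" "\<beta> > 0"
    and level_ge: "(A powr (1 / \<beta>) * B powr (1 / \<beta>\<^sup>2)) powr (1 / p)
        * \<delta> powr (- ((p - 1) / (p * \<beta>))) * a powr (1 / p) \<le> k"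
  shows "a / k powr p \<le> (A * \<delta> powr (1 - p)) powr (- 1 / \<beta>) * B powr (- 1 / \<beta>\<^sup>2)"
proof -
  let ?D = "A * \<delta> powr (1 - p)"
  have exponent: "- ((p - 1) / (p * \<beta>)) * p = (1 - p) * (1 / \<beta>)"
    using assms by (simp add: field_simps)
  have "k powr p \<ge> ((A powr (1 / \<beta>) * B powr (1 / \<beta>\<^sup>2)) powr (1 / p)
      * \<delta> powr (- ((p - 1) / (p * \<beta>))) * a powr (1 / p)) powr p" (is "_ \<ge> ?k")
    using level_ge assms by (intro powr_mono2) auto
  also have "?k = A powr (1 / \<beta>) * B powr (1 / \<beta>\<^sup>2) * \<delta> powr ((1 - p) * (1 / \<beta>)) * a"
    using assms by (simp only: powr_mult powr_powr exponent powr_ge_zero mult_nonneg_nonneg)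
      (simp add: powr_mult)
  also have "\<dots> = ?D powr (1 / \<beta>) * B powr (1 / \<beta>\<^sup>2) * a"
    using assms by (simp add: powr_mult powr_powr)
  finally have "a / k powr p \<le> 1 / (?D powr (1 / \<beta>) * B powr (1 / \<beta>\<^sup>2))"
    using assms by (simp add: field_simps)
  then show ?thesis by (simp add: powr_minus_divide)
qed

lemma AE_le_of_AE_le_greater:
  fixes f :: "'a \<Rightarrow> real"
  assumes "\<And>k. k > c \<Longrightarrow> AE x in M. x \<in> S \<longrightarrow> f x \<le> k"
  shows "AE x in M. x \<in> S \<longrightarrow> f x \<le> c"
proof -
  have "AE x in M. (if x \<in> S then f x else c) \<le> c"
  proof (rule AE_upper_bound_inf)
    fix e :: real assume "e > 0"
    then have "AE x in M. x \<in> S \<longrightarrow> f x \<le> c + e" by (intro assms) simp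
    then show "AE x in M. (if x \<in> S then f x else c) \<le> c + e"
      by (rule eventually_mono) (use \<open>e > 0\<close> in auto)
  qed
  then show ?thesis by eventually_elim (auto split: if_splits)
qed

theorem (in mixed_subsolution) local_boundedness:
  assumes r: "0 < r" "r \<le> 1" "ball x0 r \<subseteq> \<Omega>" and \<delta>: "0 < \<delta>" "\<delta> \<le> 1"
      and \<beta>: "0 < \<beta>" "\<beta> \<le> p / real DIM('a)"
  shows "AE x in lborel. x \<in> ball x0 (r / 2) \<longrightarrow> u x \<le>
    \<delta> * ((r / 2) powr p * tail_integral p s (excess u 0) x0 (r / 2)) powr (1 / (p - 1)) +
    bound_const TYPE('a) p s \<Lambda> C1 C2 \<beta> * \<delta> powr (- ((p - 1) / (p * \<beta>))) *
      ((LINT x:ball x0 r|lborel. excess u 0 x powr p) / measure lborel (ball x0 r)) powr (1 / p)"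
    (is "AE x in lborel. _ \<longrightarrow> u x \<le> \<delta> * ?\<theta> + ?c * ?a powr (1 / p)")
proof -
  let ?T = "tail_integral p s (excess u 0) x0 (r / 2)"
  have nonneg: "0 \<le> \<delta> * ?\<theta>" "0 \<le> ?c * ?a powr (1 / p)" "0 \<le> ?a"
    using \<delta> less_imp_le[OF bound_const_pos[OF p s(1) \<Lambda> C1 C2, where 'a = 'a]]
    by (auto intro!: mult_nonneg_nonneg divide_nonneg_nonneg set_integral_nonneg_real)
  have "AE x in lborel. x \<in> ball x0 (r / 2) \<longrightarrow> u x \<le> k" if k: "k > \<delta> * ?\<theta> + ?c * ?a powr (1 / p)"
    for k
  proof -
    have k_pos: "0 < k" and \<theta>_le: "\<delta> * ?\<theta> \<le> k" and a_le: "?c * ?a powr (1 / p) \<le> k"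
      using k nonneg by linarith+
    have "?T = (2 / r) powr p * ((r / 2) powr p * ?T)" using r by (simp flip: powr_mult mult.assoc)
    also have "(r / 2) powr p * ?T = ?\<theta> powr (p - 1)"
      using p tail_integral_nonneg[of p s "excess u 0" x0 "r / 2"] by (simp add: powr_powr)
    also have "(2 / r) powr p * ?\<theta> powr (p - 1) \<le> (2 / r) powr p * (k / \<delta>) powr (p - 1)"
      using \<theta>_le \<delta> p by (intro mult_left_mono powr_mono2) (auto simp: field_simps)
    finally interpret level_iteration p s \<Lambda> K \<Omega> C1 C2 M u g b x0 r k \<delta>
      using r \<delta> k_pos by unfold_locales auto
    have "normalized_energy 0 = ?a / k powr p"
      by (simp add: normalized_energy_def energy_def radius_def level_def)
    also have "\<dots> \<le> (iteration_const TYPE('a) p s \<Lambda> C1 C2 * \<delta> powr (1 - p)) powr (- 1 / \<beta>)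
        * growth_const TYPE('a) p s powr (- 1 / \<beta>\<^sup>2)"
      using iteration_const_ge_1[OF p \<Lambda> C1 C2, of s, where 'a = 'a]
          growth_const_gt_1[OF p s(1), where 'a = 'a]
        nonneg(3) a_le k_pos p \<beta> \<delta> unfolding bound_const_def by (intro start_condition) auto
    finally show ?thesis by (rule AE_le_final_level[OF normalized_energy_tendsto_0[OF \<beta>]])
  qed
  then show ?thesis by (rule AE_le_of_AE_le_greater)
qed

section \<open>Borel representatives\<close>

lemma Borel_representative:
  fixes f :: "'a::euclidean_space \<Rightarrow> 'b::euclidean_space"
  assumes "f \<in> borel_measurable lebesgue"
  obtains f' where "f' \<in> borel_measurable borel" "AE x in lebesgue. f x = f' x"
proof -
  have "\<exists>h\<in>borel_measurable lborel. AE x in lborel. f x \<bullet> i = h x" for i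
    using assms by (intro completion_ex_borel_measurable_real) simp
  then obtain h where h: "\<And>i. h i \<in> borel_measurable lborel" "\<And>i. AE x in lborel. f x \<bullet> i = h i x"
    by metis
  define f' where "f' x = (\<Sum>i\<in>Basis. h i x *\<^sub>R i)" for x
  have "AE x in lborel. \<forall>i\<in>Basis. f x \<bullet> i = h i x" using h(2) by (intro eventually_ball_finite) auto
  then have "AE x in lborel. f x = f' x"
  proof eventually_elim
    case (elim x)
    have "f x = (\<Sum>i\<in>Basis. (f x \<bullet> i) *\<^sub>R i)" by (simp add: euclidean_representation)
    also have "\<dots> = f' x" unfolding f'_def using elim by (intro sum.cong) auto
    finally show ?case .
  qed
  moreover have "f' \<in> borel_measurable borel" unfolding f'_def[abs_def] using h(1) by auto
  ultimately show ?thesis using that by (simp add: AE_completion_iff)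
qed

lemma AE_lborel_pair:
  fixes P :: "'a::euclidean_space \<Rightarrow> bool"
  assumes "AE x in lborel. P x"
  shows "AE z in lborel. P (fst z) \<and> P (snd z)"
proof -
  obtain N where N: "N \<in> null_sets lborel" "{x. \<not> P x} \<subseteq> N"
    using assms unfolding eventually_ae_filter by auto
  have "N \<times> UNIV \<in> null_sets (lborel \<Otimes>\<^sub>M (lborel :: 'a measure))"
    "UNIV \<times> N \<in> null_sets ((lborel :: 'a measure) \<Otimes>\<^sub>M lborel)"
    using N(1) by (auto simp: null_sets_def lborel.emeasure_pair_measure_Times)
  then have "N \<times> UNIV \<union> UNIV \<times> N \<in> null_sets (lborel :: ('a \<times> 'a) measure)"
    using null_sets.Un by (simp add: lborel_prod)
  then show ?thesis by (rule AE_I') (use N(2) in auto)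
qed

lemma set_lebesgue_cong_AE:
  fixes f h :: "'a::euclidean_space \<Rightarrow> 'b::euclidean_space"
  assumes meas: "set_borel_measurable lebesgue S f" and eq: "AE x in lebesgue. x \<in> S \<longrightarrow> f x = h x"
  shows "set_borel_measurable lebesgue S h"
    "set_integrable lebesgue S f \<longleftrightarrow> set_integrable lebesgue S h"
    "(LINT x:S|lebesgue. f x) = (LINT x:S|lebesgue. h x)"
proof -
  have eq': "AE x in lebesgue. indicator S x *\<^sub>R f x = indicator S x *\<^sub>R h x"
    using eq by eventually_elim (auto simp: indicator_def)
  show h: "set_borel_measurable lebesgue S h"
    using borel_measurable_AE[OF _ eq'] meas by (simp add: set_borel_measurable_def)
  show "set_integrable lebesgue S f \<longleftrightarrow> set_integrable lebesgue S h"
    unfolding set_integrable_def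
    using meas h eq' by (intro integrable_cong_AE) (auto simp: set_borel_measurable_def)
  show "(LINT x:S|lebesgue. f x) = (LINT x:S|lebesgue. h x)"
    unfolding set_lebesgue_integral_def
    using meas h eq' by (intro integral_cong_AE) (auto simp: set_borel_measurable_def)
qed

lemma set_integrable_lebesgue_cong_AE:
  fixes f h :: "'a::euclidean_space \<Rightarrow> 'b::euclidean_space"
  assumes "set_integrable lebesgue S f" "AE x in lebesgue. x \<in> S \<longrightarrow> f x = h x"
  shows "set_integrable lebesgue S h" "(LINT x:S|lebesgue. f x) = (LINT x:S|lebesgue. h x)"
proof -
  have "set_borel_measurable lebesgue S f"
    using borel_measurable_integrable assms(1)
    by (simp add: set_borel_measurable_def set_integrable_def)
  then show "set_integrable lebesgue S h" "(LINT x:S|lebesgue. f x) = (LINT x:S|lebesgue. h x)"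
    using set_lebesgue_cong_AE[of S f h] assms by auto
qed

lemma set_integral_lebesgue_eq_lborel:
  fixes f h :: "'a::euclidean_space \<Rightarrow> 'b::euclidean_space"
  assumes h[measurable]: "h \<in> borel_measurable borel" and S[measurable]: "S \<in> sets borel"
    and eq: "AE x in lebesgue. x \<in> S \<longrightarrow> f x = h x"
  shows "(LINT x:S|lebesgue. f x) = (LINT x:S|lborel. h x)"
proof -
  have meas: "(\<lambda>x. indicator S x *\<^sub>R h x) \<in> borel_measurable lborel" by measurable
  then have "set_borel_measurable lebesgue S h"
    unfolding set_borel_measurable_def by (rule measurable_completion)
  then have "(LINT x:S|lebesgue. f x) = (LINT x:S|lebesgue. h x)"
    using eq by (intro set_lebesgue_cong_AE(3)[symmetric]) auto
  also have "\<dots> = (LINT x:S|lborel. h x)"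
    unfolding set_lebesgue_integral_def by (rule integral_completion[OF meas])
  finally show ?thesis .
qed

lemma W1p_loc_cong_AE:
  assumes W: "W1p_loc U p u G" and u: "AE x in lebesgue. x \<in> U \<longrightarrow> u x = v x"
    and G: "AE x in lebesgue. x \<in> U \<longrightarrow> G x = H x"
  shows "W1p_loc U p v H"
proof -
  have "set_integrable lebesgue C (\<lambda>x. \<bar>v x\<bar> powr p)"
    "set_integrable lebesgue C (\<lambda>x. norm (H x) powr p)"
    if C: "compact C" "C \<subseteq> U" for C
  proof -
    have "AE x in lebesgue. x \<in> C \<longrightarrow> \<bar>u x\<bar> powr p = \<bar>v x\<bar> powr p"
      using u by eventually_elim (use C(2) in auto)
    then show "set_integrable lebesgue C (\<lambda>x. \<bar>v x\<bar> powr p)"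
      by (rule set_integrable_lebesgue_cong_AE(1)[rotated]) (use W C in \<open>simp add: W1p_loc_def\<close>)
    have "AE x in lebesgue. x \<in> C \<longrightarrow> norm (G x) powr p = norm (H x) powr p"
      using G by eventually_elim (use C(2) in auto)
    then show "set_integrable lebesgue C (\<lambda>x. norm (H x) powr p)"
      by (rule set_integrable_lebesgue_cong_AE(1)[rotated]) (use W C in \<open>simp add: W1p_loc_def\<close>)
  qed
  moreover have "weak_grad U v H"
    unfolding weak_grad_def
  proof (intro allI impI ballI)
    fix \<phi> and i :: 'a assume "test_fun U \<phi>" "i \<in> Basis"
    then have weak: "set_integrable lebesgue U (\<lambda>x. u x * partial \<phi> i x)"
      "set_integrable lebesgue U (\<lambda>x. (G x \<bullet> i) * \<phi> x)"
      "(LINT x:U|lebesgue. u x * partial \<phi> i x) = - (LINT x:U|lebesgue. (G x \<bullet> i) * \<phi> x)"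
      using W unfolding W1p_loc_def weak_grad_def by blast+
    have u_eq: "AE x in lebesgue. x \<in> U \<longrightarrow> u x * partial \<phi> i x = v x * partial \<phi> i x"
      using u by eventually_elim auto
    have G_eq: "AE x in lebesgue. x \<in> U \<longrightarrow> (G x \<bullet> i) * \<phi> x = (H x \<bullet> i) * \<phi> x"
      using G by eventually_elim auto
    show "set_integrable lebesgue U (\<lambda>x. v x * partial \<phi> i x) \<and>
        set_integrable lebesgue U (\<lambda>x. (H x \<bullet> i) * \<phi> x) \<and>
        (LINT x:U|lebesgue. v x * partial \<phi> i x) = - (LINT x:U|lebesgue. (H x \<bullet> i) * \<phi> x)"
      using set_integrable_lebesgue_cong_AE[OF weak(1) u_eq]
          set_integrable_lebesgue_cong_AE[OF weak(2) G_eq] weak(3)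
      by simp
  qed
  ultimately show ?thesis
    using W set_lebesgue_cong_AE(1)[OF _ u] set_lebesgue_cong_AE(1)[OF _ G]
    by (auto simp: W1p_loc_def)
qed

lemma bounded_Borel_representative:
  fixes f :: "'a::euclidean_space \<Rightarrow> real"
  assumes "f \<in> borel_measurable lebesgue" "AE x in lebesgue. \<bar>f x\<bar> \<le> M"
  obtains f' where "f' \<in> borel_measurable borel" "AE x in lebesgue. f x = f' x" "\<And>x. \<bar>f' x\<bar> \<le> \<bar>M\<bar>"
proof -
  obtain h where h: "h \<in> borel_measurable borel" "AE x in lebesgue. f x = h x"
    using Borel_representative[OF assms(1)] by blast
  have "AE x in lebesgue. f x = max (- \<bar>M\<bar>) (min \<bar>M\<bar> (h x))"
    using h(2) assms(2) by eventually_elim auto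
  then show ?thesis using h(1) by (intro that[of "\<lambda>x. max (- \<bar>M\<bar>) (min \<bar>M\<bar> (h x))"]) auto
qed

lemma (in fractional_kernel) interaction_integral_cong_AE:
  assumes "AE x in lebesgue. u x = v x"
    and "integrable lebesgue (\<lambda>(x, y). ppow p (u x - u y) * (\<phi> x - \<phi> y) * K x y)"
  shows "(LINT z|lebesgue. (\<lambda>(x, y). ppow p (u x - u y) * (\<phi> x - \<phi> y) * K x y) z)
    = (LINT z|lebesgue. interaction v \<phi> (fst z) (snd z))"
proof -
  have "AE x in lborel. u x = v x" using assms(1) by (simp add: AE_completion_iff)
  then have "AE z in lborel. u (fst z) = v (fst z) \<and> u (snd z) = v (snd z)" by (rule AE_lborel_pair)
  then have "AE z in lborel. (case z of (x, y) \<Rightarrow> ppow p (u x - u y) * (\<phi> x - \<phi> y) * K x y)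
      = interaction v \<phi> (fst z) (snd z)"
    by eventually_elim (simp add: interaction_def split_beta')
  then have "AE z in lebesgue. z \<in> UNIV
      \<longrightarrow> (case z of (x, y) \<Rightarrow> ppow p (u x - u y) * (\<phi> x - \<phi> y) * K x y)
      = interaction v \<phi> (fst z) (snd z)" by (simp add: AE_completion_iff)
  from set_integrable_lebesgue_cong_AE(2)[OF _ this] show ?thesis
    using assms(2) by (simp add: set_integrable_def set_lebesgue_integral_def)
qed

lemma weak_subsolution_imp_mixed_subsolution:
  fixes \<Omega> :: "'a::euclidean_space set"
  assumes kernel: "fractional_kernel p s \<Lambda> K" and C: "0 < C1" "0 < C2"
    and structure_B: "AE x in lebesgue. x \<in> \<Omega> \<longrightarrow> (\<forall>v \<zeta>. C1 * norm \<zeta> powr p \<le> B x v \<zeta> \<bullet> \<zeta> \<and>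
      norm (B x v \<zeta>) \<le> C2 * norm \<zeta> powr (p - 1))"
    and weak: "weak_subsolution \<Omega> p B K u"
  obtains M v g b where "mixed_subsolution p s \<Lambda> K \<Omega> C1 C2 M v g b" "AE x in lebesgue. u x = v x"
proof -
  interpret fractional_kernel p s \<Lambda> K by (rule kernel)
  obtain M G where u: "u \<in> borel_measurable lebesgue" "AE x in lebesgue. \<bar>u x\<bar> \<le> M"
    and W: "W1p_loc \<Omega> p u G"
    and inequality: "\<And>\<Omega>' \<phi> G\<phi>. open \<Omega>' \<and> compact (closure \<Omega>') \<and> closure \<Omega>' \<subseteq> \<Omega> \<and>
        W01p \<Omega>' p \<phi> G\<phi> \<and> (AE x in lebesgue. 0 \<le> \<phi> x) \<Longrightarrow>
      set_integrable lebesgue \<Omega>' (\<lambda>x. B x (u x) (G x) \<bullet> G\<phi> x) \<and>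
      integrable lebesgue (\<lambda>(x,y). ppow p (u x - u y) * (\<phi> x - \<phi> y) * K x y) \<and>
      (LINT x:\<Omega>'|lebesgue. B x (u x) (G x) \<bullet> G\<phi> x)
        + (LINT z|lebesgue. (\<lambda>(x,y). ppow p (u x - u y) * (\<phi> x - \<phi> y) * K x y) z) \<le> 0"
    using weak unfolding weak_subsolution_def by blast
  obtain v where v: "v \<in> borel_measurable borel" "AE x in lebesgue. u x = v x" "\<And>x. \<bar>v x\<bar> \<le> \<bar>M\<bar>"
    using bounded_Borel_representative[OF u] by blast
  have "(\<lambda>x. indicator \<Omega> x *\<^sub>R G x) \<in> borel_measurable lebesgue"
    using W by (simp add: W1p_loc_def set_borel_measurable_def)
  then obtain g where g: "g \<in> borel_measurable borel"
    "AE x in lebesgue. indicator \<Omega> x *\<^sub>R G x = g x"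
    by (rule Borel_representative)
  have Gg: "AE x in lebesgue. x \<in> \<Omega> \<longrightarrow> G x = g x" using g(2) by eventually_elim auto
  have "mixed_subsolution p s \<Lambda> K \<Omega> C1 C2 \<bar>M\<bar> v g (\<lambda>x. B x (u x) (G x))"
  proof (unfold_locales, goal_cases)
    case 6
    show ?case using v(2) by (intro W1p_loc_cong_AE[OF W _ Gg]) (auto elim: eventually_mono)
  next
    case 7
    show ?case using structure_B Gg by eventually_elim auto
  next
    case (8 \<tau> x0 \<phi> G\<phi>)
    then show ?case
      using inequality[of "ball x0 \<tau>" \<phi> G\<phi>] interaction_integral_cong_AE[OF v(2), of \<phi>] by auto
  qed (use C v g(1) in auto)
  then show ?thesis using v(2) by (rule that)
qed

section \<open>The local boundedness estimate\<close>

lemma Tail_eq_tail_integral: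
  fixes u v :: "'a::euclidean_space \<Rightarrow> real"
  assumes "v \<in> borel_measurable borel" "AE x in lebesgue. u x = v x"
  shows "Tail p s (\<lambda>x. max (u x) 0) x0 \<rho>
    = (\<rho> powr p * tail_integral p s (excess v 0) x0 \<rho>) powr (1 / (p - 1))"
proof -
  have "(LINT y:UNIV - ball x0 \<rho>|lebesgue.
        \<bar>max (u y) 0\<bar> powr (p - 1) / dist y x0 powr (real DIM('a) + p * s))
      = (LINT y:UNIV - ball x0 \<rho>|lborel. tail_density p s (excess v 0) x0 y)"
  proof (rule set_integral_lebesgue_eq_lborel)
    show "tail_density p s (excess v 0) x0 \<in> borel_measurable borel"
      using assms(1) by measurable
    show "AE y in lebesgue. y \<in> UNIV - ball x0 \<rho> \<longrightarrow>
        \<bar>max (u y) 0\<bar> powr (p - 1) / dist y x0 powr (real DIM('a) + p * s)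
        = tail_density p s (excess v 0) x0 y"
      using assms(2)
      by eventually_elim (simp only: tail_density_def powr_minus_divide, simp add: excess_def
        max.commute)
  qed auto
  then show ?thesis by (simp add: Tail_def tail_integral_def Compl_eq_Diff_UNIV)
qed

lemma kappa_gain:
  assumes "p > 1" "N \<ge> 2"
  shows "1 < kappa N p" "0 < (kappa N p - 1) / kappa N p" "(kappa N p - 1) / kappa N p \<le> p / real N"
proof -
  show "1 < kappa N p" using assms by (auto simp: kappa_def)
  then show "0 < (kappa N p - 1) / kappa N p" by simp
  show "(kappa N p - 1) / kappa N p \<le> p / real N"
    using assms by (cases "p < real N") (auto simp: kappa_def field_simps)
qed

theorem weak_subsolution_esssup_le:
  fixes \<Omega> :: "'a::euclidean_space set"
  assumes kernel: "fractional_kernel p s \<Lambda> K" and C: "0 < C1" "0 < C2"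
    and structure_B: "AE x in lebesgue. x \<in> \<Omega> \<longrightarrow> (\<forall>v \<zeta>. C1 * norm \<zeta> powr p \<le> B x v \<zeta> \<bullet> \<zeta> \<and>
      norm (B x v \<zeta>) \<le> C2 * norm \<zeta> powr (p - 1))"
    and weak: "weak_subsolution \<Omega> p B K u"
    and r: "0 < r" "r \<le> 1" "ball x0 r \<subseteq> \<Omega>" and \<delta>: "0 < \<delta>" "\<delta> \<le> 1"
        and \<beta>: "0 < \<beta>" "\<beta> \<le> p / real DIM('a)"
  shows "esssup (restrict_space lebesgue (ball x0 (r / 2))) (\<lambda>x. ereal (u x))
    \<le> ereal (\<delta> * Tail p s (\<lambda>x. max (u x) 0) x0 (r / 2)
        + bound_const TYPE('a) p s \<Lambda> C1 C2 \<beta> * \<delta> powr (- ((p - 1) / (p * \<beta>)))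
          * ((1 / measure lebesgue (ball x0 r)) *
             (LINT x:ball x0 r|lebesgue. max (u x) 0 powr p)) powr (1 / p))"
    (is "_ \<le> ereal ?bound")
proof -
  obtain M v g b where "mixed_subsolution p s \<Lambda> K \<Omega> C1 C2 M v g b"
    and uv: "AE x in lebesgue. u x = v x"
    using weak_subsolution_imp_mixed_subsolution[OF kernel C structure_B weak] .
  then interpret mixed_subsolution p s \<Lambda> K \<Omega> C1 C2 M v g b by simp
  have "(LINT x:ball x0 r|lebesgue. max (u x) 0 powr p)
      = (LINT x:ball x0 r|lborel. excess v 0 x powr p)"
    using uv by (intro set_integral_lebesgue_eq_lborel)
        (auto simp: excess_def max.commute elim: eventually_mono)
  then have bound: "AE x in lborel. x \<in> ball x0 (r / 2) \<longrightarrow> v x \<le> ?bound"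
    using local_boundedness[OF r \<delta> \<beta>] by (simp add: Tail_eq_tail_integral[OF u_measurable uv])
  have "AE x in lebesgue. x \<in> ball x0 (r / 2) \<longrightarrow> ereal (u x) \<le> ereal ?bound"
    using uv AE_completion[OF bound] by eventually_elim simp
  then have "AE x in restrict_space lebesgue (ball x0 (r / 2)). ereal (u x) \<le> ereal ?bound"
    by (subst AE_restrict_space_iff) auto
  moreover have "(\<lambda>x. ereal (u x)) \<in> borel_measurable (restrict_space lebesgue (ball x0 (r / 2)))"
    using weak by (intro measurable_restrict_space1 borel_measurable_ereal)
        (simp add: weak_subsolution_def)
  ultimately show ?thesis by (intro esssup_I)
qed

theorem mainTheorem6:
  fixes p s \<Lambda> C\<^sub>1 C\<^sub>2 :: real
  assumes "DIM('a::euclidean_space) \<ge> 2"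
    and "1 < p" and "0 < s" and "s < 1" and "\<Lambda> \<ge> 1" and "C\<^sub>1 > 0" and "C\<^sub>2 > 0"
  shows "\<exists>c>0. \<forall>(\<Omega>::'a set) (\<B>::'a \<Rightarrow> real \<Rightarrow> 'a \<Rightarrow> 'a) (K::'a \<Rightarrow> 'a \<Rightarrow> real) u x0 r \<delta>.
     smooth_bounded_domain \<Omega> \<and>
     (\<forall>v \<zeta>. set_borel_measurable lebesgue \<Omega> (\<lambda>x. \<B> x v \<zeta>)) \<and>
     (\<forall>x\<in>\<Omega>. continuous_on UNIV (\<lambda>(v, \<zeta>). \<B> x v \<zeta>)) \<and>
     (AE x in lebesgue. x \<in> \<Omega> \<longrightarrow> (\<forall>v \<zeta>. \<B> x v \<zeta> \<bullet> \<zeta> \<ge> C\<^sub>1 * norm \<zeta> powr p \<and>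
                                           norm (\<B> x v \<zeta>) \<le> C\<^sub>2 * norm \<zeta> powr (p - 1))) \<and>
     (\<lambda>z. K (fst z) (snd z)) \<in> borel_measurable lebesgue \<and>
     (\<forall>x y. K x y = K y x) \<and>
     (\<forall>x y. x \<noteq> y \<longrightarrow> dist x y powr (- (real DIM('a) + p * s)) / \<Lambda> \<le> K x y \<and>
                         K x y \<le> \<Lambda> * dist x y powr (- (real DIM('a) + p * s))) \<and>
     weak_subsolution \<Omega> p \<B> K u \<and>
     ball x0 r \<subseteq> \<Omega> \<and> 0 < r \<and> r \<le> 1 \<and> 0 < \<delta> \<and> \<delta> \<le> 1
     \<longrightarrow> esssup (restrict_space lebesgue (ball x0 (r / 2))) (\<lambda>x. ereal (u x))
         \<le> ereal (\<delta> * Tail p s (\<lambda>x. max (u x) 0) x0 (r / 2)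
             + c * \<delta> powr (- ((p - 1) * kappa DIM('a) p / (p * (kappa DIM('a) p - 1))))
               * ((1 / measure lebesgue (ball x0 r)) *
                  (LINT x:ball x0 r|lebesgue. max (u x) 0 powr p)) powr (1 / p))"
proof -
  define \<beta> where "\<beta> = (kappa DIM('a) p - 1) / kappa DIM('a) p"
  note kappa = kappa_gain[OF assms(2,1), folded \<beta>_def]
  have exponent: "(p - 1) * kappa DIM('a) p / (p * (kappa DIM('a) p - 1)) = (p - 1) / (p * \<beta>)"
    using kappa(1) by (simp add: \<beta>_def)
  show ?thesis
    unfolding exponent
  proof (intro exI conjI allI impI; (elim conjE)?)
    show "0 < bound_const TYPE('a) p s \<Lambda> C\<^sub>1 C\<^sub>2 \<beta>"
      using assms by (intro bound_const_pos)
  next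
    fix \<Omega> :: "'a set" and \<B> u x0 and r \<delta> :: real and K :: "'a \<Rightarrow> 'a \<Rightarrow> real"
    assume "\<forall>x y. K x y = K y x"
      "\<forall>x y. x \<noteq> y \<longrightarrow> dist x y powr (- (real DIM('a) + p * s)) / \<Lambda> \<le> K x y \<and>
         K x y \<le> \<Lambda> * dist x y powr (- (real DIM('a) + p * s))"
    then have "fractional_kernel p s \<Lambda> K" using assms by unfold_locales auto
    moreover assume "AE x in lebesgue. x \<in> \<Omega> \<longrightarrow> (\<forall>v \<zeta>. \<B> x v \<zeta> \<bullet> \<zeta> \<ge> C\<^sub>1 * norm \<zeta> powr p \<and>
        norm (\<B> x v \<zeta>) \<le> C\<^sub>2 * norm \<zeta> powr (p - 1))"
      "weak_subsolution \<Omega> p \<B> K u" "ball x0 r \<subseteq> \<Omega>" "0 < r" "r \<le> 1" "0 < \<delta>" "\<delta> \<le> 1"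
    ultimately show "esssup (restrict_space lebesgue (ball x0 (r / 2))) (\<lambda>x. ereal (u x))
      \<le> ereal (\<delta> * Tail p s (\<lambda>x. max (u x) 0) x0 (r / 2)
        + bound_const TYPE('a) p s \<Lambda> C\<^sub>1 C\<^sub>2 \<beta> * \<delta> powr (- ((p - 1) / (p * \<beta>)))
          * ((1 / measure lebesgue (ball x0 r)) * (LINT x:ball x0 r|lebesgue. max (u x) 0 powr p))
            powr (1 / p))"
      using assms kappa(2,3) by (intro weak_subsolution_esssup_le)
  qed
qed

end
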